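(* Let $K\in\mathbb{R}$ and let $D$ be a convex compact domain in $\mathbb{X}_K$ with $C^1$ boundary $\partial D$. Then $$L(\partial D)^2\ge 4\pi A(D)-K\,A(D)^2,$$ where $L(\partial D)$ is the length of $\partial D$ and $A(D)$ is the area of $D$.
   Context: $\mathbb{X}_K$ is the maximally symmetric, simply connected, 2-dimensional Riemannian manifold of constant sectional curvature $K$ (sphere of radius $1/\sqrt K$ if $K>0$, Euclidean plane if $K=0$, rescaled hyperbolic plane if $K<0$). *)

theory Defs
  imports "HOL-Analysis.Analysis"
begin

text \<open>The space forms are realised as surfaces in \<open>\<complex> \<times> \<real>\<close>: a round sphere, a plane, or the upper
  sheet of a hyperboloid, with the Riemannian metric induced by the Euclidean inner product
  (\<open>K \<ge> 0\<close>) or by the Minkowski form (\<open>K < 0\<close>), which is positive definite on tangent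
  spaces of the hyperboloid.\<close>

definition ambient_form :: "real \<Rightarrow> complex \<times> real \<Rightarrow> complex \<times> real \<Rightarrow> real" where
  "ambient_form K u v =
     (if K < 0 then fst u \<bullet> fst v - snd u * snd v else fst u \<bullet> fst v + snd u * snd v)"

definition space_form :: "real \<Rightarrow> (complex \<times> real) set" where
  "space_form K =
     (if K > 0 then sphere 0 (1 / sqrt K)
      else if K = 0 then UNIV \<times> {0}
      else {p. ambient_form K p p = 1 / K \<and> snd p > 0})"

definition tangent_space :: "real \<Rightarrow> complex \<times> real \<Rightarrow> (complex \<times> real) set" where
  "tangent_space K p = (if K = 0 then UNIV \<times> {0} else {v. ambient_form K p v = 0})"

definition unit_tangent :: "real \<Rightarrow> complex \<times> real \<Rightarrow> (complex \<times> real) set" where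
  "unit_tangent K p = {v \<in> tangent_space K p. ambient_form K v v = 1}"

definition cs :: "real \<Rightarrow> real \<Rightarrow> real" where
  "cs K t = (if K > 0 then cos (sqrt K * t) else if K = 0 then 1 else cosh (sqrt (- K) * t))"

definition sn :: "real \<Rightarrow> real \<Rightarrow> real" where
  "sn K t = (if K > 0 then sin (sqrt K * t) / sqrt K
             else if K = 0 then t else sinh (sqrt (- K) * t) / sqrt (- K))"

text \<open>The unit-speed geodesic with initial point \<open>p\<close> and initial unit velocity \<open>v\<close>.
  Its restriction to \<open>[0, l]\<close> is minimising iff \<open>K \<le> 0\<close> or \<open>l \<le> \<pi> / \<surd>K\<close>.\<close>

definition geodesic :: "real \<Rightarrow> complex \<times> real \<Rightarrow> complex \<times> real \<Rightarrow> real \<Rightarrow> complex \<times> real" where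
  "geodesic K p v t = cs K t *\<^sub>R p + sn K t *\<^sub>R v"

text \<open>Any two points are joined by some minimising geodesic inside \<open>D\<close>. Minimising geodesics are
  unique except between antipodal points of the sphere, so demanding only one of them is the most
  inclusive convention; for instance, closed hemispheres are convex.\<close>

definition geodesically_convex :: "real \<Rightarrow> (complex \<times> real) set \<Rightarrow> bool" where
  "geodesically_convex K D \<longleftrightarrow>
     (\<forall>x\<in>D. \<forall>y\<in>D. \<exists>v\<in>unit_tangent K x. \<exists>l\<ge>0.
        (K > 0 \<longrightarrow> l \<le> pi / sqrt K) \<and> geodesic K x v l = y \<and> (\<forall>t\<in>{0..l}. geodesic K x v t \<in> D))"

definition boundary :: "real \<Rightarrow> (complex \<times> real) set \<Rightarrow> (complex \<times> real) set" where
  "boundary K D = top_of_set (space_form K) frontier_of D"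

text \<open>\<open>S\<close> is an embedded one-dimensional \<open>C\<^sup>1\<close> submanifold of the space form: locally the zero set of a
  \<open>C\<^sup>1\<close> function whose differential does not vanish on the tangent plane of the space form.\<close>

definition C1_submanifold :: "real \<Rightarrow> (complex \<times> real) set \<Rightarrow> bool" where
  "C1_submanifold K S \<longleftrightarrow> S \<subseteq> space_form K \<and>
     (\<forall>p\<in>S. \<exists>U (f :: complex \<times> real \<Rightarrow> real) (f' :: complex \<times> real \<Rightarrow> (complex \<times> real) \<Rightarrow>\<^sub>L real).
        open U \<and> p \<in> U \<and>
        (\<forall>x\<in>U. (f has_derivative blinfun_apply (f' x)) (at x)) \<and> continuous_on U f' \<and>
        (\<exists>v\<in>tangent_space K p. blinfun_apply (f' p) v \<noteq> 0) \<and>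
        S \<inter> U = {x \<in> space_form K \<inter> U. f x = 0})"

text \<open>Closed curves are functions on the real line of period 1, so that \<open>C\<^sup>1\<close> includes the closing
  point.\<close>

definition simple_closed_C1_curve :: "(real \<Rightarrow> complex \<times> real) \<Rightarrow> bool" where
  "simple_closed_C1_curve \<gamma> \<longleftrightarrow>
     \<gamma> C1_differentiable_on UNIV \<and> (\<forall>t. vector_derivative \<gamma> (at t) \<noteq> 0) \<and>
     (\<forall>t. \<gamma> (t + 1) = \<gamma> t) \<and> inj_on \<gamma> {0..<1}"

definition curve_length :: "real \<Rightarrow> (real \<Rightarrow> complex \<times> real) \<Rightarrow> real" where
  "curve_length K \<gamma> =
     integral {0..1} (\<lambda>t. sqrt (ambient_form K (vector_derivative \<gamma> (at t)) (vector_derivative \<gamma> (at t))))"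

definition parametrizes :: "(real \<Rightarrow> complex \<times> real) set \<Rightarrow> (complex \<times> real) set \<Rightarrow> bool" where
  "parametrizes \<Gamma> S \<longleftrightarrow>
     finite \<Gamma> \<and> (\<forall>\<gamma>\<in>\<Gamma>. simple_closed_C1_curve \<gamma>) \<and>
     pairwise (\<lambda>\<gamma> \<delta>. disjnt (range \<gamma>) (range \<delta>)) \<Gamma> \<and> (\<Union>\<gamma>\<in>\<Gamma>. range \<gamma>) = S"

text \<open>A compact one-dimensional \<open>C\<^sup>1\<close> submanifold is a finite disjoint union of simple closed regular
  \<open>C\<^sup>1\<close> curves; its length is their total length, which does not depend on the parametrization chosen.
  The empty family gives length 0 to the (empty) boundary of the full sphere.\<close>

definition length_of :: "real \<Rightarrow> (complex \<times> real) set \<Rightarrow> real" where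
  "length_of K S = (\<Sum>\<gamma>\<in>(SOME \<Gamma>. parametrizes \<Gamma> S). curve_length K \<gamma>)"

definition base_point :: "real \<Rightarrow> complex \<times> real" where
  "base_point K = (0, if K = 0 then 0 else 1 / sqrt \<bar>K\<bar>)"

text \<open>Geodesic polar coordinates around the base point; they omit only the base point and, on the
  sphere, its antipode.\<close>

definition polar :: "real \<Rightarrow> real \<Rightarrow> real \<Rightarrow> complex \<times> real" where
  "polar K r \<theta> = geodesic K (base_point K) (cis \<theta>, 0) r"

definition polar_domain :: "real \<Rightarrow> (real \<times> real) set" where
  "polar_domain K = {(r, \<theta>). 0 < r \<and> (K > 0 \<longrightarrow> r < pi / sqrt K) \<and> 0 \<le> \<theta> \<and> \<theta> < 2 * pi}"

text \<open>The Riemannian area element \<open>\<surd>(E G - F\<^sup>2)\<close> in polar coordinates (it equals \<open>sn K r\<close>).\<close>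

definition area_element :: "real \<Rightarrow> real \<Rightarrow> real \<Rightarrow> real" where
  "area_element K r \<theta> =
     (let a = vector_derivative (\<lambda>s. polar K s \<theta>) (at r);
          b = vector_derivative (\<lambda>\<phi>. polar K r \<phi>) (at \<theta>)
      in sqrt (ambient_form K a a * ambient_form K b b - (ambient_form K a b)\<^sup>2))"

definition area :: "real \<Rightarrow> (complex \<times> real) set \<Rightarrow> real" where
  "area K S =
     set_lebesgue_integral lborel {(r, \<theta>) \<in> polar_domain K. polar K r \<theta> \<in> S}
       (\<lambda>(r, \<theta>). area_element K r \<theta>)"

end

(*
  For two points x, y of the boundary curve let R be the reflection that interchanges them. It is an
  isometry, so <R x', y'> is at most |x'| |y'|, and integrating over both parameters bounds L^2 from
  below by the double integral of <R x', y'>. Write q = <x - y, x - y> / 2. Up to an exact term the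
  integrand is - q_s q_t / q, and Stokes' theorem applied in each variable turns its integral into one
  over D x D. With q replaced by q + e in the denominator everything is smooth and the resulting kernel
  is (2 e + K e^2) / (q + e)^2 - K, which converges to 4 pi delta - K as e tends to 0; this gives
  L^2 >= 4 pi A - K A^2.

  Stokes' theorem is only needed for domains that are star-shaped in geodesic polar coordinates about
  an interior point. A convex D is of this kind unless it is the whole sphere, and its radial function
  is C^1 because the cone over a ball with apex a boundary point prevents the boundary from being
  tangent to the radius.
*)

theory Submission
  imports Defs
begin

section \<open>Trigonometry of constant curvature\<close>

text \<open>Replacing q by q + e in the denominator turns the eigenvalue -1 of the reflection into a
  number that stays in [-1, 1] as long as \<open>- K * e \<le> 2\<close>, so the bound by |x'| |y'|
  survives and no singular integral occurs. The constant 4 pi is 2 e times the leading term 2 pi / e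
  of the integral of 1 / (q + e)^2 over a small disc. It enters only as a lower bound at interior
  points, which is why Fatou's lemma can take the limit. The obstacle is the choice of coordinates:
  area is defined in polar coordinates about a fixed base point, Stokes' theorem wants a centre
  inside D, and the disc integral wants the point x as centre. These polar measures agree because
  each one gives, up to a common factor, the Lebesgue volume of the cone in three-space over a set.
  The length is estimated from below only: a simple closed curve in a polar graph about p has to
  wind around p. Formulas use \<open>vers\<close>, that is (1 - cs) / K with its limit t^2 / 2 at K
  = 0, to stay free of division by K.\<close>

definition vers :: "real \<Rightarrow> real \<Rightarrow> real" where
  "vers K t = (if K = 0 then t\<^sup>2 / 2 else (1 - cs K t) / K)"

lemma cs_0 [simp]: "cs K 0 = 1" and sn_0 [simp]: "sn K 0 = 0" and vers_0 [simp]: "vers K 0 = 0"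
  by (auto simp: cs_def sn_def vers_def)

lemma cs_minus [simp]: "cs K (- t) = cs K t" and sn_minus [simp]: "sn K (- t) = - sn K t"
  and vers_minus [simp]: "vers K (- t) = vers K t"
  by (auto simp: cs_def sn_def vers_def)

lemma cs_vers: "cs K t = 1 - K * vers K t"
  by (auto simp: cs_def vers_def)

lemma cs_add: "cs K (x + y) = cs K x * cs K y - K * sn K x * sn K y"
proof (cases "K > 0")
  case True
  then have "sqrt K * sqrt K = K" by simp
  with True show ?thesis by (simp add: cs_def sn_def ring_distribs cos_add)
next
  case False
  then have "K < 0 \<Longrightarrow> sqrt (-K) * sqrt (-K) = -K" by (simp add: real_sqrt_mult_self)
  with False show ?thesis by (auto simp: cs_def sn_def ring_distribs cosh_add divide_simps)
qed

lemma sn_add: "sn K (x + y) = sn K x * cs K y + cs K x * sn K y"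
  by (auto simp: cs_def sn_def ring_distribs sin_add sinh_add add_divide_distrib)

lemma cs_diff: "cs K (x - y) = cs K x * cs K y + K * sn K x * sn K y"
  using cs_add[of K x "- y"] by simp

lemma sn_diff: "sn K (x - y) = sn K x * cs K y - cs K x * sn K y"
  using sn_add[of K x "- y"] by simp

lemma cs_sn_sq: "(cs K t)\<^sup>2 + K * (sn K t)\<^sup>2 = 1"
  using cs_diff[of K t t] by (simp add: power2_eq_square)

text \<open>Together with \<open>cs_vers\<close> this is the polynomial relation that the algebra of
  chords assumes; without division by K it covers the plane as well.\<close>

lemma sn_sq: "(sn K t)\<^sup>2 = 2 * vers K t - K * (vers K t)\<^sup>2"
proof (cases "K = 0")
  case False
  then have "K * (sn K t)\<^sup>2 = K * (2 * vers K t - K * (vers K t)\<^sup>2)"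
    using cs_sn_sq[of K t] unfolding cs_vers by (simp add: power2_eq_square algebra_simps)
  with False show ?thesis by (simp only: mult_cancel_left simp_thms)
qed (simp add: sn_def vers_def)

lemma vers_add: "vers K (x + y) = vers K x + vers K y - K * vers K x * vers K y + sn K x * sn K y"
proof (cases "K = 0")
  case False
  then have "K * vers K (x + y) = K * (vers K x + vers K y - K * vers K x * vers K y + sn K x * sn K y)"
    using cs_add[of K x y] unfolding cs_vers by (simp add: algebra_simps)
  with False show ?thesis by (simp only: mult_cancel_left simp_thms)
qed (simp add: sn_def vers_def power2_eq_square field_simps)

lemma vers_diff: "vers K (x - y) = vers K x + vers K y - K * vers K x * vers K y - sn K x * sn K y"
  using vers_add[of K x "- y"] by simp

text \<open>\<open>2 * sn K (t / 2)\<close> is the ambient length of the chord of an arc of length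
  t, so \<open>vers\<close> is half the squared chord.\<close>

lemma vers_double: "vers K t = 2 * (sn K (t / 2))\<^sup>2"
  using vers_add[of K "t/2" "t/2"] sn_sq[of K "t/2"] by (simp add: power2_eq_square)

lemma vers_nonneg: "0 \<le> vers K t"
  by (simp add: vers_double)

lemma DERIV_cs: "(cs K has_real_derivative - K * sn K t) (at t)"
proof -
  consider "K > 0" | "K = 0" | "K < 0" by linarith
  then show ?thesis
  proof cases
    case 1
    then show ?thesis
      unfolding cs_def sn_def by (auto intro!: derivative_eq_intros simp: field_simps)
  next
    case 3
    define w where "w = sqrt (-K)"
    have w: "w > 0" "w * w = - K" using 3 by (simp_all add: w_def)
    have "((\<lambda>t. cosh (w * t)) has_real_derivative sinh (w * t) * w) (at t)"
      by (auto intro!: derivative_eq_intros)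
    also have "sinh (w * t) * w = (w * w) * (sinh (w * t) / w)" using w(1) by simp
    finally show ?thesis using 3 unfolding cs_def sn_def w_def[symmetric] w(2) by simp
  next
    case 2
    then have "cs K = (\<lambda>t. 1)" by (auto simp: cs_def)
    then show ?thesis using 2 by simp
  qed
qed

lemma DERIV_sn: "(sn K has_real_derivative cs K t) (at t)"
  unfolding cs_def sn_def
  by (cases "K > 0"; cases "K = 0") (auto intro!: derivative_eq_intros simp: mult.assoc)

lemma DERIV_vers: "(vers K has_real_derivative sn K t) (at t)"
proof (cases "K = 0")
  case False
  then have "vers K = (\<lambda>t. (1 - cs K t) / K)" by (auto simp: vers_def)
  then show ?thesis using False by (auto intro!: derivative_eq_intros DERIV_cs)
next
  case True
  then have "vers K = (\<lambda>t. t\<^sup>2 / 2)" by (auto simp: vers_def)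
  then show ?thesis using True by (auto simp: sn_def intro!: derivative_eq_intros)
qed

lemmas DERIV_trig [derivative_intros] =
  DERIV_cs[THEN DERIV_chain2] DERIV_sn[THEN DERIV_chain2] DERIV_vers[THEN DERIV_chain2]

lemma continuous_on_trig [continuous_intros]:
  assumes "continuous_on S f"
  shows "continuous_on S (\<lambda>x. cs K (f x))" "continuous_on S (\<lambda>x. sn K (f x))"
    "continuous_on S (\<lambda>x. vers K (f x))"
proof -
  have "continuous_on UNIV (cs K)" "continuous_on UNIV (sn K)" "continuous_on UNIV (vers K)"
    using DERIV_cs DERIV_sn DERIV_vers DERIV_isCont by (blast intro: continuous_at_imp_continuous_on)+
  then show "continuous_on S (\<lambda>x. cs K (f x))" "continuous_on S (\<lambda>x. sn K (f x))"
    "continuous_on S (\<lambda>x. vers K (f x))"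
    using assms continuous_on_compose2 by blast+
qed

lemma sn_pos:
  assumes "0 < t" "K > 0 \<Longrightarrow> t < pi / sqrt K"
  shows "0 < sn K t"
proof (cases "K > 0")
  case True
  then have "sqrt K * t < pi" using assms by (simp add: field_simps)
  then show ?thesis using True assms by (simp add: sn_def sin_gt_zero)
qed (use assms in \<open>auto simp: sn_def\<close>)

lemma sn_nonneg:
  assumes "0 \<le> t" "K > 0 \<Longrightarrow> t \<le> pi / sqrt K"
  shows "0 \<le> sn K t"
proof (cases "K > 0")
  case True
  then have "sqrt K * t \<le> pi" using assms by (simp add: field_simps)
  then show ?thesis using True assms by (simp add: sn_def sin_ge_zero)
qed (use assms in \<open>auto simp: sn_def\<close>)

lemma vers_strict_mono:
  assumes "0 \<le> s" "s < t" "K > 0 \<Longrightarrow> t \<le> pi / sqrt K"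
  shows "vers K s < vers K t"
proof -
  have "\<exists>z>s. z < t \<and> vers K t - vers K s = (t - s) * sn K z"
    using MVT2[OF assms(2), of "vers K" "sn K"] DERIV_vers by blast
  then obtain z where z: "s < z" "z < t" "vers K t - vers K s = (t - s) * sn K z" by blast
  have "sn K z > 0" using z assms by (intro sn_pos) force+
  then have "(t - s) * sn K z > 0" using assms by simp
  then show ?thesis using z by linarith
qed

lemma vers_inj:
  assumes "0 \<le> s" "0 \<le> t" "K > 0 \<Longrightarrow> t \<le> pi / sqrt K" "K > 0 \<Longrightarrow> s \<le> pi / sqrt K"
    "vers K s = vers K t"
  shows "s = t"
  using vers_strict_mono[of s t K] vers_strict_mono[of t s K] assms by (metis less_irrefl linorder_less_linear)

lemma cs_ge_1: "K \<le> 0 \<Longrightarrow> 1 \<le> cs K t"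
  using vers_nonneg[of K t] by (simp add: cs_vers mult_nonpos_nonneg)

lemma sn_ge_id: "K \<le> 0 \<Longrightarrow> 0 \<le> t \<Longrightarrow> t \<le> sn K t"
  using DERIV_nonneg_imp_nondecreasing[of 0 t "\<lambda>x. sn K x - x"] cs_ge_1[of K]
  by (fastforce intro!: derivative_eq_intros)

text \<open>For K \<le> 0 this turns a bound on chords into a bound on radii, which makes the
  supremum defining the radial function exist.\<close>

lemma vers_ge_square: "K \<le> 0 \<Longrightarrow> t\<^sup>2 / 2 \<le> vers K t"
proof -
  assume "K \<le> 0"
  then have "\<bar>t / 2\<bar> \<le> sn K \<bar>t / 2\<bar>" by (intro sn_ge_id) auto
  then have "\<bar>t / 2\<bar>\<^sup>2 \<le> (sn K \<bar>t / 2\<bar>)\<^sup>2" by (intro power_mono) auto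
  moreover have "(sn K \<bar>t / 2\<bar>)\<^sup>2 = (sn K (t / 2))\<^sup>2"
    by (metis abs_if power2_minus sn_minus)
  ultimately show ?thesis by (simp add: vers_double[of K t] power_divide)
qed

text \<open>The conic k^2 + K z^2 = 1 is an ellipse, a line or a branch of a hyperbola, parametrised
  by (\<open>cs\<close>, \<open>sn\<close>); the inverses are arccos, the identity and
  arsinh.\<close>

lemma polar_radius_exists:
  assumes "k\<^sup>2 + K * z\<^sup>2 = 1" "0 \<le> z" "K < 0 \<Longrightarrow> 0 < k" "K = 0 \<Longrightarrow> k = 1"
  obtains r where "0 \<le> r" "K > 0 \<longrightarrow> r \<le> pi / sqrt K" "cs K r = k" "sn K r = z"
proof -
  consider "K > 0" | "K = 0" | "K < 0" by linarith
  then show thesis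
  proof cases
    case 1
    then have k: "k\<^sup>2 + (sqrt K * z)\<^sup>2 = 1" using assms by (simp add: power_mult_distrib)
    have "k\<^sup>2 \<le> 1" using k zero_le_power2[of "sqrt K * z"] by linarith
    then have "\<bar>k\<bar> \<le> 1" by (simp add: abs_square_le_1)
    then have k1: "-1 \<le> k" "k \<le> 1" by auto
    have "sin (arccos k) = sqrt K * z"
      using k 1 assms by (simp add: sin_arccos_abs \<open>\<bar>k\<bar> \<le> 1\<close> real_sqrt_unique algebra_simps)
    then show thesis
      using that[of "arccos k / sqrt K"] 1 k1 arccos_bounded[OF k1]
      by (simp add: cs_def sn_def divide_right_mono)
  next
    case 2
    then show thesis using that[of z] assms by (simp add: cs_def sn_def)
  next
    case 3
    let ?x = "sqrt (-K) * z"
    have k: "k\<^sup>2 = 1 + ?x\<^sup>2" using assms 3 by (simp add: power_mult_distrib)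
    have "cosh (arsinh ?x) = k"
      using k 3 assms by (simp add: cosh_arsinh_real real_sqrt_unique add.commute)
    then show thesis
      using that[of "arsinh ?x / sqrt (-K)"] 3 assms
      by (cases "z = 0") (simp_all add: cs_def sn_def zero_le_divide_iff less_imp_le)
  qed
qed

section \<open>The isoperimetric inequality for polar graphs\<close>

text \<open>Half the squared (Minkowski) distance of two points of the surface, in polar coordinates.\<close>

definition qp :: "real \<Rightarrow> real \<Rightarrow> real \<Rightarrow> real \<Rightarrow> real \<Rightarrow> real" where
  "qp K R \<phi> r \<psi> = vers K R + vers K r - K * vers K R * vers K r - sn K R * sn K r * cos (\<phi> - \<psi>)"

text \<open>Half the squared chord is the mean of its values at angle 0 and at angle pi,
  \<open>vers K (R - r)\<close> and \<open>vers K (R + r)\<close>, with weights (1 + cos) / 2 and (1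
  - cos) / 2.\<close>

lemma qp_nonneg: "0 \<le> qp K R \<phi> r \<psi>"
proof -
  let ?c = "cos (\<phi> - \<psi>)"
  have c: "0 \<le> 1 + ?c" "0 \<le> 1 - ?c"
    using cos_ge_minus_one[of "\<phi> - \<psi>"] cos_le_one[of "\<phi> - \<psi>"] by linarith+
  have "0 \<le> (1 + ?c) * vers K (R - r) + (1 - ?c) * vers K (R + r)"
    using c by (intro add_nonneg_nonneg[OF mult_nonneg_nonneg mult_nonneg_nonneg] vers_nonneg)
  also have "\<dots> = 2 * qp K R \<phi> r \<psi>"
    by (simp add: qp_def vers_add vers_diff algebra_simps)
  finally show ?thesis by simp
qed

lemma continuous_on_qp [continuous_intros]:
  fixes S :: "'a::t2_space set"
  assumes "continuous_on S f1" "continuous_on S f2" "continuous_on S f3" "continuous_on S f4"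
  shows "continuous_on S (\<lambda>x. qp K (f1 x) (f2 x) (f3 x) (f4 x))"
proof -
  have "continuous_on S (\<lambda>x. cos (f2 x - f4 x))"
    using assms by (intro continuous_intros)
  then show ?thesis
    unfolding qp_def using assms by (intro continuous_intros)
qed

section \<open>Stokes' theorem for regions under a polar graph\<close>

lemma graph_stokes:
  fixes a ar a\<theta> b br :: "real \<Rightarrow> real \<Rightarrow> real" and \<rho> \<rho>' :: "real \<Rightarrow> real"
  assumes \<rho>: "\<And>\<theta>. (\<rho> has_real_derivative \<rho>' \<theta>) (at \<theta>)" "continuous_on UNIV \<rho>'" "\<rho> (2 * pi) = \<rho> 0"
    and ar: "\<And>r \<theta>. ((\<lambda>r. a r \<theta>) has_real_derivative ar r \<theta>) (at r)"
    and a\<theta>: "\<And>f f' \<theta>. (f has_real_derivative f') (at \<theta>) \<Longrightarrow>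
        ((\<lambda>\<theta>. a (f \<theta>) \<theta>) has_real_derivative ar (f \<theta>) \<theta> * f' + a\<theta> (f \<theta>) \<theta>) (at \<theta>)"
    and br: "\<And>r \<theta>. ((\<lambda>r. b r \<theta>) has_real_derivative br r \<theta>) (at r)"
    and b0: "\<And>\<theta>. b 0 \<theta> = 0"
    and per: "\<And>r. a r (2 * pi) = a r 0"
    and cont: "continuous_on UNIV (\<lambda>p. a (fst p) (snd p))" "continuous_on UNIV (\<lambda>p. ar (fst p) (snd p))"
      "continuous_on UNIV (\<lambda>p. a\<theta> (fst p) (snd p))" "continuous_on UNIV (\<lambda>p. br (fst p) (snd p))"
  shows "integral {0..2*pi} (\<lambda>\<theta>. a (\<rho> \<theta>) \<theta> * \<rho>' \<theta> + b (\<rho> \<theta>) \<theta>) =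
    integral {0..2*pi} (\<lambda>\<theta>. integral {0..1} (\<lambda>u. (br (u * \<rho> \<theta>) \<theta> - a\<theta> (u * \<rho> \<theta>) \<theta>) * \<rho> \<theta>))"
proof -
  have c\<rho>: "continuous_on UNIV \<rho>" using \<rho>(1) DERIV_isCont by (blast intro: continuous_at_imp_continuous_on)
  \<comment> \<open>Shrink the graph to u \<rho> and differentiate the line integral of a dr + b
    d\<theta> in u. The derivative is \<kappa>, the curl times the Jacobian \<rho>, plus \<alpha>,
    which is the \<theta>-derivative of a(u \<rho>, \<theta>) \<rho> and therefore integrates to 0
    over a period.\<close>
  define \<alpha> where "\<alpha> = (\<lambda>u \<theta>. (ar (u * \<rho> \<theta>) \<theta> * (u * \<rho>' \<theta>) + a\<theta> (u * \<rho> \<theta>) \<theta>) * \<rho> \<theta> + a (u * \<rho> \<theta>) \<theta> * \<rho>' \<theta>)"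
  define \<kappa> where "\<kappa> = (\<lambda>u \<theta>. (br (u * \<rho> \<theta>) \<theta> - a\<theta> (u * \<rho> \<theta>) \<theta>) * \<rho> \<theta>)"
  have [continuous_intros]: "continuous_on S (\<lambda>x. a (f x) (g x))" "continuous_on S (\<lambda>x. ar (f x) (g x))"
    "continuous_on S (\<lambda>x. a\<theta> (f x) (g x))" "continuous_on S (\<lambda>x. br (f x) (g x))"
    if "continuous_on S f" "continuous_on S g" for S :: "'x::topological_space set" and f g
    using cont[THEN continuous_on_compose2, of S "\<lambda>x. (f x, g x)"] that by (auto intro: continuous_intros)
  have [continuous_intros]: "continuous_on S (\<lambda>x. \<rho> (g x))" "continuous_on S (\<lambda>x. \<rho>' (g x))"
    if "continuous_on S g" for S :: "'x::topological_space set" and g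
    using c\<rho> \<rho>(2) that continuous_on_compose2 by blast+
  have c\<alpha>: "continuous_on S (\<lambda>(\<theta>, u). \<alpha> u \<theta>)" and c\<kappa>: "continuous_on S (\<lambda>(\<theta>, u). \<kappa> u \<theta>)" for S
    unfolding \<alpha>_def \<kappa>_def split_def by (intro continuous_intros)+
  have c\<alpha>': "continuous_on S (\<lambda>u. \<alpha> u \<theta>)" and c\<kappa>': "continuous_on S (\<lambda>u. \<kappa> u \<theta>)" for S \<theta>
    unfolding \<alpha>_def \<kappa>_def split_def by (intro continuous_intros)+
  have 1: "a (\<rho> \<theta>) \<theta> * \<rho>' \<theta> + b (\<rho> \<theta>) \<theta> = integral {0..1} (\<lambda>u. \<kappa> u \<theta>) + integral {0..1} (\<lambda>u. \<alpha> u \<theta>)" for \<theta>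
  proof -
    \<comment> \<open>At u = 0 the factor u kills the dr part and \<open>b0\<close> kills the
      d\<theta> part, so the centre contributes nothing.\<close>
    have "((\<lambda>u. \<kappa> u \<theta> + \<alpha> u \<theta>) has_integral
        (a (1 * \<rho> \<theta>) \<theta> * (1 * \<rho>' \<theta>) + b (1 * \<rho> \<theta>) \<theta>) - (a (0 * \<rho> \<theta>) \<theta> * (0 * \<rho>' \<theta>) + b (0 * \<rho> \<theta>) \<theta>)) {0..1}"
    proof (rule fundamental_theorem_of_calculus)
      fix u :: real assume "u \<in> {0..1}"
      have "((\<lambda>u. a (u * \<rho> \<theta>) \<theta>) has_real_derivative ar (u * \<rho> \<theta>) \<theta> * \<rho> \<theta>) (at u within {0..1})"
        by (rule DERIV_chain2[OF ar]) (auto intro!: derivative_eq_intros)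
      moreover have "((\<lambda>u. b (u * \<rho> \<theta>) \<theta>) has_real_derivative br (u * \<rho> \<theta>) \<theta> * \<rho> \<theta>) (at u within {0..1})"
        by (rule DERIV_chain2[OF br]) (auto intro!: derivative_eq_intros)
      ultimately show "((\<lambda>u. a (u * \<rho> \<theta>) \<theta> * (u * \<rho>' \<theta>) + b (u * \<rho> \<theta>) \<theta>) has_vector_derivative \<kappa> u \<theta> + \<alpha> u \<theta>) (at u within {0..1})"
        unfolding has_real_derivative_iff_has_vector_derivative[symmetric]
        by (auto intro!: derivative_eq_intros simp: \<kappa>_def \<alpha>_def algebra_simps)
    qed auto
    then have "integral {0..1} (\<lambda>u. \<kappa> u \<theta> + \<alpha> u \<theta>) = a (\<rho> \<theta>) \<theta> * \<rho>' \<theta> + b (\<rho> \<theta>) \<theta>"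
      by (simp add: b0 integral_unique)
    then show ?thesis
      using c\<alpha>' c\<kappa>' by (simp add: integral_add integrable_continuous_interval)
  qed
  have i: "(\<lambda>\<theta>. integral {0..1} (\<lambda>u. \<alpha> u \<theta>)) integrable_on {0..2*pi}"
    "(\<lambda>\<theta>. integral {0..1} (\<lambda>u. \<kappa> u \<theta>)) integrable_on {0..2*pi}"
    using integral_continuous_on_param[of "{0..2*pi}" 0 1 "\<lambda>\<theta> u. \<alpha> u \<theta>"]
      integral_continuous_on_param[of "{0..2*pi}" 0 1 "\<lambda>\<theta> u. \<kappa> u \<theta>"] c\<alpha> c\<kappa>
    by (auto intro!: integrable_continuous_interval)
  have "integral {0..2*pi} (\<lambda>\<theta>. integral {0..1} (\<lambda>u. \<alpha> u \<theta>)) = integral {0..1} (\<lambda>u. integral {0..2*pi} (\<alpha> u))"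
    using integral_swap_continuous[of 0 0 "2*pi" 1 "\<lambda>\<theta> u. \<alpha> u \<theta>"] c\<alpha> by simp
  also have "(\<lambda>u. integral {0..2*pi} (\<alpha> u)) = (\<lambda>u. 0)"
  proof
    fix u
    have "(\<alpha> u has_integral a (u * \<rho> (2*pi)) (2*pi) * \<rho> (2*pi) - a (u * \<rho> 0) 0 * \<rho> 0) {0..2*pi}"
    proof (rule fundamental_theorem_of_calculus)
      fix \<theta> :: real
      have "((\<lambda>\<theta>. a (u * \<rho> \<theta>) \<theta>) has_real_derivative ar (u * \<rho> \<theta>) \<theta> * (u * \<rho>' \<theta>) + a\<theta> (u * \<rho> \<theta>) \<theta>) (at \<theta>)"
        by (rule a\<theta>) (auto intro!: derivative_eq_intros \<rho>)
      then have "((\<lambda>\<theta>. a (u * \<rho> \<theta>) \<theta> * \<rho> \<theta>) has_real_derivative \<alpha> u \<theta>) (at \<theta>)"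
        by (auto intro!: derivative_eq_intros \<rho> simp: \<alpha>_def algebra_simps)
      then show "((\<lambda>\<theta>. a (u * \<rho> \<theta>) \<theta> * \<rho> \<theta>) has_vector_derivative \<alpha> u \<theta>) (at \<theta> within {0..2*pi})"
        unfolding has_real_derivative_iff_has_vector_derivative[symmetric] by (rule DERIV_subset) simp
    qed simp
    then show "integral {0..2*pi} (\<alpha> u) = 0" by (simp add: \<rho> per integral_unique)
  qed
  finally show ?thesis
    using i by (simp add: 1 integral_add) (simp add: \<kappa>_def)
qed

section \<open>Algebraic identities for the chord between two points\<close>

context
  fixes K v1 s1 c1 v2 s2 c2 C S q :: real
  assumes c1: "c1 = 1 - K * v1" and c2: "c2 = 1 - K * v2"
    and s1: "s1\<^sup>2 = 2 * v1 - K * v1\<^sup>2" and s2: "s2\<^sup>2 = 2 * v2 - K * v2\<^sup>2"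
    and CS: "S\<^sup>2 + C\<^sup>2 = 1" and q: "q = v1 + v2 - K * v1 * v2 - s1 * s2 * C"
begin

text \<open>With r1, r2 the radii and C, S the cosine and sine of the angle difference, the two
  squared terms are the components of the gradient of q in its first point: the r1-derivative, and
  the angular derivative divided by s1. The identity is the eikonal equation of the half squared
  chord.\<close>

lemma chord_grad1: "2 * q - K * q\<^sup>2 = (s1 * c2 - c1 * s2 * C)\<^sup>2 + (s2 * S)\<^sup>2"
  using c1 c2 s1 s2 CS q by algebra

lemma chord_grad2: "2 * q - K * q\<^sup>2 = (s2 * c1 - c2 * s1 * C)\<^sup>2 + (s1 * S)\<^sup>2"
  using c1 c2 s1 s2 CS q by algebra

text \<open>Let the points move with velocities (a, s1) and (b, s2) in the orthonormal polar frames.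
  The long factor on the left is the mixed derivative q_st. On the right stand q_s q_t, the product
  of the inner products of velocity and gradient, and the product of the corresponding cross
  products. So the gradients diagonalise the mixed Hessian.\<close>

lemma chord_mixed:
  "(2 * q - K * q\<^sup>2) * (- (K * s1 * s2 + c1 * c2 * C) * a * b - c1 * s2 * S * a + s1 * c2 * S * b - s1 * s2 * C) =
    (1 - K * q) * (((s1 * c2 - c1 * s2 * C) * a + s1 * s2 * S) * ((s2 * c1 - c2 * s1 * C) * b - s1 * s2 * S)) +
    ((s1 * c2 - c1 * s2 * C) * s1 - s2 * S * a) * ((s2 * c1 - c2 * s1 * C) * s2 + s1 * S * b)"
  using c1 c2 s1 s2 CS q by algebra

text \<open>The numerator left by the quotient rule after the second use of Stokes' theorem; divided
  by (q + e)^2 and by the area densities s1 s2 it is the kernel.\<close>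

lemma chord_kernel:
  "(s2 * (c1 * (s1 * c2 - c1 * s2 * C) + s1 * (c1 * c2 + K * s1 * s2 * C)) + s2\<^sup>2 * C) * (q + e) -
     (s1 * s2 * (s1 * c2 - c1 * s2 * C)\<^sup>2 + s2\<^sup>2 * S * (s1 * s2 * S)) =
   s1 * s2 * ((2 * e + K * e\<^sup>2) - K * (q + e)\<^sup>2)"
  using c1 c2 s1 s2 CS q by algebra

lemma cauchy_schwarz2: "x * y + z * w \<le> sqrt (x\<^sup>2 + z\<^sup>2) * sqrt (y\<^sup>2 + w\<^sup>2)" for x y z w :: real
proof -
  have "(x * y + z * w)\<^sup>2 + (x * w - y * z)\<^sup>2 = (x\<^sup>2 + z\<^sup>2) * (y\<^sup>2 + w\<^sup>2)"
    by (simp add: power2_eq_square algebra_simps)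
  then have "(x * y + z * w)\<^sup>2 \<le> (x\<^sup>2 + z\<^sup>2) * (y\<^sup>2 + w\<^sup>2)"
    using zero_le_power2[of "x * w - y * z"] by linarith
  then show ?thesis by (simp add: real_le_rsqrt flip: real_sqrt_mult)
qed

text \<open>For \<open>e = 0\<close> the left-hand side is \<open>\<langle>R x', y'\<rangle>\<close> up to sign, with \<open>R\<close> the reflection that interchanges the
  two points; the regularisation by \<open>e\<close> keeps its eigenvalues in \<open>[-1, 1]\<close>.\<close>

lemma reflection_bound:
  assumes "0 \<le> q" "0 < e" "- K * e \<le> 2" "0 < s1" "0 < s2"
  shows "- (K * s1 * s2 + c1 * c2 * C) * a * b - c1 * s2 * S * a + s1 * c2 * S * b - s1 * s2 * C -
     ((s1 * c2 - c1 * s2 * C) * a + s1 * s2 * S) * ((s2 * c1 - c2 * s1 * C) * b - s1 * s2 * S) / (q + e)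
    \<le> sqrt (a\<^sup>2 + s1\<^sup>2) * sqrt (b\<^sup>2 + s2\<^sup>2)"
proof -
  define qs where "qs = (s1 * c2 - c1 * s2 * C) * a + s1 * s2 * S"
  define qt where "qt = (s2 * c1 - c2 * s1 * C) * b - s1 * s2 * S"
  define mx where "mx = (s1 * c2 - c1 * s2 * C) * s1 - s2 * S * a"
  define my where "my = (s2 * c1 - c2 * s1 * C) * s2 + s1 * S * b"
  define \<Sigma> where "\<Sigma> = 2 * q - K * q\<^sup>2"
  define T where "T = - (K * s1 * s2 + c1 * c2 * C) * a * b - c1 * s2 * S * a + s1 * c2 * S * b - s1 * s2 * C"
  have qe: "q + e > 0" using assms by simp
  have nn: "\<Sigma> \<ge> 0" unfolding \<Sigma>_def chord_grad1 by simp
  have "T - qs * qt / (q + e) \<le> sqrt (a\<^sup>2 + s1\<^sup>2) * sqrt (b\<^sup>2 + s2\<^sup>2)"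
  proof (cases "\<Sigma> = 0")
    case False
    \<comment> \<open>The eigenvalue along the gradients after subtracting q_s q_t / (q + e); at e =
      0 it would be exactly -1, since \<Sigma> / q = 2 - K q.\<close>
    define mu where "mu = 1 - K * q - \<Sigma> / (q + e)"
    have x: "qs\<^sup>2 + mx\<^sup>2 = \<Sigma> * (a\<^sup>2 + s1\<^sup>2)"
      unfolding \<Sigma>_def chord_grad1 qs_def mx_def by algebra
    have y: "qt\<^sup>2 + my\<^sup>2 = \<Sigma> * (b\<^sup>2 + s2\<^sup>2)"
      unfolding \<Sigma>_def chord_grad2 qt_def my_def by algebra
    have "\<Sigma> * T = (1 - K * q) * (qs * qt) + mx * my"
      unfolding \<Sigma>_def T_def chord_mixed qs_def qt_def mx_def my_def ..
    then have T: "\<Sigma> * (T - qs * qt / (q + e)) = mu * (qs * qt) + mx * my"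
      by (simp add: mu_def algebra_simps)
    have K2: "2 - K * q \<ge> 0"
    proof (cases "q = 0")
      case False
      have "q * (2 - K * q) \<ge> 0" using nn by (simp add: \<Sigma>_def power2_eq_square algebra_simps)
      then show ?thesis using False assms by (simp add: zero_le_mult_iff)
    qed simp
    have "\<Sigma> \<le> (2 - K * q) * (q + e)"
      using K2 assms by (simp add: \<Sigma>_def power2_eq_square algebra_simps)
    then have "- 1 \<le> mu" using qe by (simp add: mu_def divide_simps algebra_simps)
    \<comment> \<open>The assumption \<open>- K * e \<le> 2\<close> enters here; it limits e when K
      is negative.\<close>
    have "- K * q * (q + e) \<le> \<Sigma>"
      using mult_left_mono[OF assms(3,1)] by (simp add: \<Sigma>_def power2_eq_square algebra_simps)
    then have "mu \<le> 1" using qe by (simp add: mu_def divide_simps algebra_simps)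
    then have "\<bar>mu\<bar> \<le> 1" using \<open>- 1 \<le> mu\<close> by simp
    then have "\<bar>mu * (qs * qt)\<bar> \<le> 1 * \<bar>qs * qt\<bar>" unfolding abs_mult[of mu] by (intro mult_right_mono) auto
    then have "mu * (qs * qt) + mx * my \<le> \<bar>qs\<bar> * \<bar>qt\<bar> + \<bar>mx\<bar> * \<bar>my\<bar>"
      unfolding abs_mult[symmetric] by linarith
    also have "\<dots> \<le> sqrt (qs\<^sup>2 + mx\<^sup>2) * sqrt (qt\<^sup>2 + my\<^sup>2)"
      using cauchy_schwarz2[of "\<bar>qs\<bar>" "\<bar>qt\<bar>" "\<bar>mx\<bar>" "\<bar>my\<bar>"] by simp
    also have "\<dots> = \<Sigma> * (sqrt (a\<^sup>2 + s1\<^sup>2) * sqrt (b\<^sup>2 + s2\<^sup>2))"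
      unfolding x y using nn by (simp add: real_sqrt_mult)
    finally have "\<Sigma> * (T - qs * qt / (q + e)) \<le> \<Sigma> * (sqrt (a\<^sup>2 + s1\<^sup>2) * sqrt (b\<^sup>2 + s2\<^sup>2))"
      unfolding T .
    moreover have "\<Sigma> > 0" using nn False by simp
    ultimately show ?thesis by (simp only: mult_le_cancel_left_pos)
  next
    \<comment> \<open>Now the points coincide or are antipodal. The gradients vanish, so the
      quotient drops out, and the coefficients remaining in T have absolute value 1.\<close>
    case True
    have "s1 * c2 - c1 * s2 * C = 0" "s2 * S = 0"
      using True unfolding \<Sigma>_def chord_grad1 by (simp_all add: sum_power2_eq_zero_iff)
    moreover have "s2 * c1 - c2 * s1 * C = 0"
      using True unfolding \<Sigma>_def chord_grad2 by (simp add: sum_power2_eq_zero_iff)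
    ultimately have S: "S = 0" "C\<^sup>2 = 1" and qs: "qs = 0" and z: "s1 * c2 = c1 * s2 * C"
      using assms CS by (simp_all add: qs_def)
    have "(K * s1 * s2 + c1 * c2 * C)\<^sup>2 = 1"
      using c1 c2 s1 s2 S z by algebra
    then have k: "\<bar>K * s1 * s2 + c1 * c2 * C\<bar> = 1" "\<bar>C\<bar> = 1" using S(2) by (simp_all add: abs_square_eq_1)
    have "T = - (K * s1 * s2 + c1 * c2 * C) * (a * b) - s1 * s2 * C" by (simp add: T_def S)
    also have "\<dots> \<le> \<bar>K * s1 * s2 + c1 * c2 * C\<bar> * \<bar>a * b\<bar> + \<bar>s1 * s2\<bar> * \<bar>C\<bar>"
      unfolding abs_mult[symmetric] by linarith
    also have "\<dots> = \<bar>a\<bar> * \<bar>b\<bar> + s1 * s2" using k assms by (simp add: abs_mult)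
    also have "\<dots> \<le> sqrt (a\<^sup>2 + s1\<^sup>2) * sqrt (b\<^sup>2 + s2\<^sup>2)"
      using cauchy_schwarz2[of "\<bar>a\<bar>" "\<bar>b\<bar>" s1 s2] by simp
    finally show ?thesis by (simp add: qs)
  qed
  then show ?thesis unfolding T_def qs_def qt_def .
qed

end

text \<open>Stokes' theorem for (a dr + b d\<theta>) / d with the quotient rule carried out. The
  curl enters through the equation \<open>g\<close>, so that a simplified form of it can be
  supplied.\<close>

lemma graph_stokes_quotient:
  fixes a ar a\<theta> b br d dr d\<theta> :: "real \<Rightarrow> real \<Rightarrow> real" and \<rho> \<rho>' :: "real \<Rightarrow> real"
  assumes \<rho>: "\<And>\<theta>. (\<rho> has_real_derivative \<rho>' \<theta>) (at \<theta>)" "continuous_on UNIV \<rho>'" "\<rho> (2 * pi) = \<rho> 0"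
    and ar: "\<And>r \<theta>. ((\<lambda>r. a r \<theta>) has_real_derivative ar r \<theta>) (at r)"
    and a\<theta>: "\<And>f f' \<theta>. (f has_real_derivative f') (at \<theta>) \<Longrightarrow>
        ((\<lambda>\<theta>. a (f \<theta>) \<theta>) has_real_derivative ar (f \<theta>) \<theta> * f' + a\<theta> (f \<theta>) \<theta>) (at \<theta>)"
    and dr: "\<And>r \<theta>. ((\<lambda>r. d r \<theta>) has_real_derivative dr r \<theta>) (at r)"
    and d\<theta>: "\<And>f f' \<theta>. (f has_real_derivative f') (at \<theta>) \<Longrightarrow>
        ((\<lambda>\<theta>. d (f \<theta>) \<theta>) has_real_derivative dr (f \<theta>) \<theta> * f' + d\<theta> (f \<theta>) \<theta>) (at \<theta>)"
    and br: "\<And>r \<theta>. ((\<lambda>r. b r \<theta>) has_real_derivative br r \<theta>) (at r)"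
    and b0: "\<And>\<theta>. b 0 \<theta> = 0"
    and per: "\<And>r. a r (2 * pi) = a r 0" "\<And>r. d r (2 * pi) = d r 0"
    and pos: "\<And>r \<theta>. d r \<theta> > 0"
    and cont: "continuous_on UNIV (\<lambda>p. a (fst p) (snd p))" "continuous_on UNIV (\<lambda>p. ar (fst p) (snd p))"
      "continuous_on UNIV (\<lambda>p. a\<theta> (fst p) (snd p))"
      "continuous_on UNIV (\<lambda>p. b (fst p) (snd p))" "continuous_on UNIV (\<lambda>p. br (fst p) (snd p))"
      "continuous_on UNIV (\<lambda>p. d (fst p) (snd p))" "continuous_on UNIV (\<lambda>p. dr (fst p) (snd p))"
      "continuous_on UNIV (\<lambda>p. d\<theta> (fst p) (snd p))"
    and g: "\<And>r \<theta>. g r \<theta> = ((br r \<theta> - a\<theta> r \<theta>) * d r \<theta> - (b r \<theta> * dr r \<theta> - a r \<theta> * d\<theta> r \<theta>)) / (d r \<theta>)\<^sup>2"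
  shows "integral {0..2*pi} (\<lambda>\<theta>. (a (\<rho> \<theta>) \<theta> * \<rho>' \<theta> + b (\<rho> \<theta>) \<theta>) / d (\<rho> \<theta>) \<theta>) =
    integral {0..2*pi} (\<lambda>\<theta>. integral {0..1} (\<lambda>u. g (u * \<rho> \<theta>) \<theta> * \<rho> \<theta>))"
proof -
  have nz: "d r \<theta> \<noteq> 0" for r \<theta> using pos[of r \<theta>] by simp
  have "integral {0..2*pi} (\<lambda>\<theta>. (a (\<rho> \<theta>) \<theta> / d (\<rho> \<theta>) \<theta>) * \<rho>' \<theta> + b (\<rho> \<theta>) \<theta> / d (\<rho> \<theta>) \<theta>) =
    integral {0..2*pi} (\<lambda>\<theta>. integral {0..1} (\<lambda>u.
      ((br (u * \<rho> \<theta>) \<theta> * d (u * \<rho> \<theta>) \<theta> - b (u * \<rho> \<theta>) \<theta> * dr (u * \<rho> \<theta>) \<theta>) / (d (u * \<rho> \<theta>) \<theta>)\<^sup>2 -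
       (a\<theta> (u * \<rho> \<theta>) \<theta> * d (u * \<rho> \<theta>) \<theta> - a (u * \<rho> \<theta>) \<theta> * d\<theta> (u * \<rho> \<theta>) \<theta>) / (d (u * \<rho> \<theta>) \<theta>)\<^sup>2) * \<rho> \<theta>))"
  proof (rule graph_stokes[where ar = "\<lambda>r \<theta>. (ar r \<theta> * d r \<theta> - a r \<theta> * dr r \<theta>) / (d r \<theta>)\<^sup>2"])
    fix r \<theta>
    show "((\<lambda>r. a r \<theta> / d r \<theta>) has_real_derivative (ar r \<theta> * d r \<theta> - a r \<theta> * dr r \<theta>) / (d r \<theta>)\<^sup>2) (at r)"
      using DERIV_divide[OF ar dr nz] by (simp add: power2_eq_square)
    show "((\<lambda>r. b r \<theta> / d r \<theta>) has_real_derivative (br r \<theta> * d r \<theta> - b r \<theta> * dr r \<theta>) / (d r \<theta>)\<^sup>2) (at r)"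
      using DERIV_divide[OF br dr nz] by (simp add: power2_eq_square)
  next
    fix f f' \<theta> assume f: "(f has_real_derivative f') (at \<theta>)"
    have "((\<lambda>\<theta>. a (f \<theta>) \<theta> / d (f \<theta>) \<theta>) has_real_derivative
      ((ar (f \<theta>) \<theta> * f' + a\<theta> (f \<theta>) \<theta>) * d (f \<theta>) \<theta> - a (f \<theta>) \<theta> * (dr (f \<theta>) \<theta> * f' + d\<theta> (f \<theta>) \<theta>)) / (d (f \<theta>) \<theta>)\<^sup>2) (at \<theta>)"
      using DERIV_divide[OF a\<theta>[OF f] d\<theta>[OF f] nz] by (simp add: power2_eq_square)
    also have "((ar (f \<theta>) \<theta> * f' + a\<theta> (f \<theta>) \<theta>) * d (f \<theta>) \<theta> - a (f \<theta>) \<theta> * (dr (f \<theta>) \<theta> * f' + d\<theta> (f \<theta>) \<theta>)) / (d (f \<theta>) \<theta>)\<^sup>2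
      = (ar (f \<theta>) \<theta> * d (f \<theta>) \<theta> - a (f \<theta>) \<theta> * dr (f \<theta>) \<theta>) / (d (f \<theta>) \<theta>)\<^sup>2 * f' +
        (a\<theta> (f \<theta>) \<theta> * d (f \<theta>) \<theta> - a (f \<theta>) \<theta> * d\<theta> (f \<theta>) \<theta>) / (d (f \<theta>) \<theta>)\<^sup>2"
      using nz[of "f \<theta>" \<theta>] by (simp add: field_simps)
    finally show "((\<lambda>\<theta>. a (f \<theta>) \<theta> / d (f \<theta>) \<theta>) has_real_derivative
      (ar (f \<theta>) \<theta> * d (f \<theta>) \<theta> - a (f \<theta>) \<theta> * dr (f \<theta>) \<theta>) / (d (f \<theta>) \<theta>)\<^sup>2 * f' +
        (a\<theta> (f \<theta>) \<theta> * d (f \<theta>) \<theta> - a (f \<theta>) \<theta> * d\<theta> (f \<theta>) \<theta>) / (d (f \<theta>) \<theta>)\<^sup>2) (at \<theta>)" .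
  qed (auto intro!: continuous_intros \<rho> cont simp: nz b0 per)
  then show ?thesis
    by (simp add: g add_divide_distrib[symmetric] diff_divide_distrib[symmetric] algebra_simps)
qed

theorem graph_isoperimetric:
  fixes \<rho> \<rho>' :: "real \<Rightarrow> real"
  assumes \<rho>: "\<And>\<theta>. (\<rho> has_real_derivative \<rho>' \<theta>) (at \<theta>)" "continuous_on UNIV \<rho>'" "\<rho> (2 * pi) = \<rho> 0"
    and pos: "\<And>\<theta>. 0 < sn K (\<rho> \<theta>)"
    and e: "0 < e" "- K * e \<le> 2"
  shows "integral {0..2*pi} (\<lambda>\<psi>. integral {0..1} (\<lambda>u. integral {0..2*pi} (\<lambda>\<phi>. integral {0..1} (\<lambda>v.
      sn K (v * \<rho> \<phi>) * sn K (u * \<rho> \<psi>) * ((2 * e + K * e\<^sup>2) / (qp K (v * \<rho> \<phi>) \<phi> (u * \<rho> \<psi>) \<psi> + e)\<^sup>2 - K)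
      * \<rho> \<phi>)) * \<rho> \<psi>))
    \<le> (integral {0..2*pi} (\<lambda>\<theta>. sqrt ((\<rho>' \<theta>)\<^sup>2 + (sn K (\<rho> \<theta>))\<^sup>2)))\<^sup>2"
    (is "integral _ (\<lambda>\<psi>. integral _ (\<lambda>u. integral _ (\<lambda>\<phi>. integral _ (\<lambda>v. ?k v \<phi> u \<psi> * _)) * _)) \<le> (integral _ ?l)\<^sup>2")
proof -
  have c\<rho>: "continuous_on UNIV \<rho>" using \<rho>(1) DERIV_isCont by (blast intro: continuous_at_imp_continuous_on)
  have [continuous_intros]: "continuous_on S (\<lambda>x. \<rho> (g x))" "continuous_on S (\<lambda>x. \<rho>' (g x))"
    if "continuous_on S g" for S :: "'x::topological_space set" and g
    using c\<rho> \<rho>(2) that continuous_on_compose2 by blast+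
  have qe: "qp K R \<phi> r \<psi> + e > 0" for R \<phi> r \<psi>
    using qp_nonneg[of K R \<phi> r \<psi>] e by simp
  then have qe': "qp K R \<phi> r \<psi> + e \<noteq> 0" for R \<phi> r \<psi> by (metis less_irrefl)
  \<comment> \<open>Let q be half the squared chord from the boundary point at angle \<phi> to X r
    \<psi>. \<open>qs\<close> is its derivative when the first point runs along the boundary,
    \<open>qr\<close> and \<open>q\<psi>\<close> are the partial derivatives in the second point,
    and \<open>qst\<close> differentiates \<open>qs\<close> along the boundary in the second
    point.\<close>
  define qs where "qs = (\<lambda>\<phi> r \<psi>. (sn K (\<rho> \<phi>) * cs K r - cs K (\<rho> \<phi>) * sn K r * cos (\<phi> - \<psi>)) * \<rho>' \<phi> +
      sn K (\<rho> \<phi>) * sn K r * sin (\<phi> - \<psi>))"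
  define qst where "qst = (\<lambda>\<phi> \<psi>. - (K * sn K (\<rho> \<phi>) * sn K (\<rho> \<psi>) + cs K (\<rho> \<phi>) * cs K (\<rho> \<psi>) * cos (\<phi> - \<psi>)) * \<rho>' \<phi> * \<rho>' \<psi>
      - cs K (\<rho> \<phi>) * sn K (\<rho> \<psi>) * sin (\<phi> - \<psi>) * \<rho>' \<phi> + sn K (\<rho> \<phi>) * cs K (\<rho> \<psi>) * sin (\<phi> - \<psi>) * \<rho>' \<psi>
      - sn K (\<rho> \<phi>) * sn K (\<rho> \<psi>) * cos (\<phi> - \<psi>))"
  define qr where "qr = (\<lambda>\<phi> r \<psi>. sn K r * cs K (\<rho> \<phi>) - cs K r * sn K (\<rho> \<phi>) * cos (\<phi> - \<psi>))"
  define q\<psi> where "q\<psi> = (\<lambda>\<phi> r \<psi>. - sn K (\<rho> \<phi>) * sn K r * sin (\<phi> - \<psi>))"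
  define N where "N = (\<lambda>\<phi> \<psi>. (- qs \<phi> (\<rho> \<psi>) \<psi> * qr \<phi> (\<rho> \<psi>) \<psi> * \<rho>' \<psi> + - qs \<phi> (\<rho> \<psi>) \<psi> * q\<psi> \<phi> (\<rho> \<psi>) \<psi>) /
      (qp K (\<rho> \<phi>) \<phi> (\<rho> \<psi>) \<psi> + e))"
  \<comment> \<open>The curl in the second point of the form - q_s dq / (q + e), whose value on the
    boundary tangent is \<open>N\<close>.\<close>
  define M where "M = (\<lambda>r \<psi> \<phi>. (- (sn K r)\<^sup>2 * sin (\<phi> - \<psi>) * \<rho>' \<phi> +
      sn K r * (sn K (\<rho> \<phi>) * (sn K (\<rho> \<phi>) * cs K r - cs K (\<rho> \<phi>) * sn K r * cos (\<phi> - \<psi>)))) / (qp K (\<rho> \<phi>) \<phi> r \<psi> + e))"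
  have cl: "continuous_on S ?l" for S by (intro continuous_intros)
  have cqst: "continuous_on S (\<lambda>x. qst (fst x) (snd x))" "continuous_on T (\<lambda>x. qst c x)" for S T c
    unfolding qst_def by (intro continuous_intros)+
  have cN: "continuous_on S (\<lambda>x. N (fst x) (snd x))" "continuous_on T (\<lambda>x. N c x)" for S T c
    unfolding N_def qs_def qr_def q\<psi>_def by (intro continuous_intros ballI qe')+
  have cM: "continuous_on S (\<lambda>x. M (f x) (g x) (h x))" if "continuous_on S f" "continuous_on S g" "continuous_on S h"
    for S :: "'x::t2_space set" and f g h
    unfolding M_def using that by (intro continuous_intros ballI qe')
  have S1: "qst \<phi> \<psi> + N \<phi> \<psi> \<le> ?l \<phi> * ?l \<psi>" for \<phi> \<psi>
  proof -
    have "qst \<phi> \<psi> - qs \<phi> (\<rho> \<psi>) \<psi> * (qr \<phi> (\<rho> \<psi>) \<psi> * \<rho>' \<psi> - sn K (\<rho> \<phi>) * sn K (\<rho> \<psi>) * sin (\<phi> - \<psi>)) /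
      (qp K (\<rho> \<phi>) \<phi> (\<rho> \<psi>) \<psi> + e) \<le> ?l \<phi> * ?l \<psi>"
      unfolding qst_def qs_def qr_def
      by (rule reflection_bound[OF cs_vers cs_vers sn_sq sn_sq _ qp_def qp_nonneg e pos pos]) simp
    also have "qs \<phi> (\<rho> \<psi>) \<psi> * (qr \<phi> (\<rho> \<psi>) \<psi> * \<rho>' \<psi> - sn K (\<rho> \<phi>) * sn K (\<rho> \<psi>) * sin (\<phi> - \<psi>)) /
      (qp K (\<rho> \<phi>) \<phi> (\<rho> \<psi>) \<psi> + e) = - N \<phi> \<psi>"
      unfolding N_def q\<psi>_def minus_divide_left by (simp add: algebra_simps)
    finally show ?thesis by simp
  qed
  \<comment> \<open>\<open>qst \<phi>\<close> is the derivative of \<open>qs \<phi>\<close> along a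
    closed curve.\<close>
  have S2: "integral {0..2*pi} (qst \<phi>) = 0" for \<phi>
  proof -
    have "(qst \<phi> has_integral qs \<phi> (\<rho> (2*pi)) (2*pi) - qs \<phi> (\<rho> 0) 0) {0..2*pi}"
    proof (rule fundamental_theorem_of_calculus)
      fix \<psi> :: real
      show "((\<lambda>\<psi>. qs \<phi> (\<rho> \<psi>) \<psi>) has_vector_derivative qst \<phi> \<psi>) (at \<psi> within {0..2*pi})"
        unfolding has_real_derivative_iff_has_vector_derivative[symmetric] qs_def qst_def
        by (rule DERIV_subset[where s = UNIV]) (auto intro!: derivative_eq_intros \<rho> simp: algebra_simps)
    qed simp
    then show ?thesis by (simp add: \<rho> qs_def integral_unique cos_diff sin_diff)
  qed
  \<comment> \<open>Because dq wedge dq = 0, differentiating the denominator contributes nothing,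
    and only the first power of q + e remains in \<open>M\<close>.\<close>
  have S3: "integral {0..2*pi} (N \<phi>) = integral {0..2*pi} (\<lambda>\<psi>. integral {0..1} (\<lambda>u. M (u * \<rho> \<psi>) \<psi> \<phi> * \<rho> \<psi>))" for \<phi>
    unfolding N_def
  proof (rule graph_stokes_quotient[where dr = "qr \<phi>" and d\<theta> = "q\<psi> \<phi>" and
        ar = "\<lambda>r \<psi>. - (((- sn K (\<rho> \<phi>) * K * sn K r - cs K (\<rho> \<phi>) * cs K r * cos (\<phi> - \<psi>)) * \<rho>' \<phi> +
            sn K (\<rho> \<phi>) * cs K r * sin (\<phi> - \<psi>)) * qr \<phi> r \<psi> +
          qs \<phi> r \<psi> * (cs K r * cs K (\<rho> \<phi>) + K * sn K r * sn K (\<rho> \<phi>) * cos (\<phi> - \<psi>)))" and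
        a\<theta> = "\<lambda>r \<psi>. - ((- cs K (\<rho> \<phi>) * sn K r * sin (\<phi> - \<psi>) * \<rho>' \<phi> - sn K (\<rho> \<phi>) * sn K r * cos (\<phi> - \<psi>)) * qr \<phi> r \<psi>
          - qs \<phi> r \<psi> * (cs K r * sn K (\<rho> \<phi>) * sin (\<phi> - \<psi>)))" and
        br = "\<lambda>r \<psi>. - (((- sn K (\<rho> \<phi>) * K * sn K r - cs K (\<rho> \<phi>) * cs K r * cos (\<phi> - \<psi>)) * \<rho>' \<phi> +
            sn K (\<rho> \<phi>) * cs K r * sin (\<phi> - \<psi>)) * q\<psi> \<phi> r \<psi> -
          qs \<phi> r \<psi> * (sn K (\<rho> \<phi>) * cs K r * sin (\<phi> - \<psi>)))" and
        g = "\<lambda>r \<psi>. M r \<psi> \<phi>"])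
    fix r \<psi>
    let ?s1 = "sn K (\<rho> \<phi>)" and ?c1 = "cs K (\<rho> \<phi>)" and ?s2 = "sn K r" and ?c2 = "cs K r"
    let ?C = "cos (\<phi> - \<psi>)" and ?S = "sin (\<phi> - \<psi>)" and ?d = "qp K (\<rho> \<phi>) \<phi> r \<psi> + e"
    \<comment> \<open>Here z stands for \<rho>' \<phi> and q for the value of \<open>qs\<close>;
      both are arbitrary, and every term containing q cancels.\<close>
    have eq: "c1\<^sup>2 + K * s1\<^sup>2 = 1 \<Longrightarrow> S\<^sup>2 + C\<^sup>2 = 1 \<Longrightarrow>
      (- (((- s1 * K * s2 - c1 * c2 * C) * z + s1 * c2 * S) * (- s1 * s2 * S) - q * (s1 * c2 * S)) -
       - ((- c1 * s2 * S * z - s1 * s2 * C) * (s2 * c1 - c2 * s1 * C) - q * (c2 * s1 * S))) * d -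
        (- q * (- s1 * s2 * S) * (s2 * c1 - c2 * s1 * C) - - q * (s2 * c1 - c2 * s1 * C) * (- s1 * s2 * S)) =
      (- s2\<^sup>2 * S * z + s2 * (s1 * (s1 * c2 - c1 * s2 * C))) * d" for c1 s1 c2 s2 S C z d q :: real
      by algebra
    show "M r \<psi> \<phi> = ((- (((- ?s1 * K * ?s2 - ?c1 * ?c2 * ?C) * \<rho>' \<phi> + ?s1 * ?c2 * ?S) * q\<psi> \<phi> r \<psi> - qs \<phi> r \<psi> * (?s1 * ?c2 * ?S)) -
       - ((- ?c1 * ?s2 * ?S * \<rho>' \<phi> - ?s1 * ?s2 * ?C) * qr \<phi> r \<psi> - qs \<phi> r \<psi> * (?c2 * ?s1 * ?S))) * ?d -
        (- qs \<phi> r \<psi> * q\<psi> \<phi> r \<psi> * qr \<phi> r \<psi> - - qs \<phi> r \<psi> * qr \<phi> r \<psi> * q\<psi> \<phi> r \<psi>)) / ?d\<^sup>2"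
      unfolding q\<psi>_def qr_def eq[OF cs_sn_sq sin_cos_squared_add] M_def
      using qe'[of "\<rho> \<phi>" \<phi> r \<psi>] by (simp add: power2_eq_square)
  qed (use qe in \<open>auto intro!: derivative_eq_intros continuous_intros \<rho> simp: \<rho>(3)[unfolded mult.commute[of 2]] qs_def qr_def q\<psi>_def qp_def cos_diff sin_diff cs_vers[of K "\<rho> \<phi>"] algebra_simps\<close>)
  \<comment> \<open>\<open>M\<close> is affine in \<rho>' \<phi>, hence again a 1-form in the first
    point evaluated on the boundary tangent. Its dR coefficient has a numerator independent of R, so
    \<open>ar\<close> is 0.\<close>
  have S5: "integral {0..2*pi} (M r \<psi>) = integral {0..2*pi} (\<lambda>\<phi>. integral {0..1} (\<lambda>v.
      sn K (v * \<rho> \<phi>) * sn K r * ((2 * e + K * e\<^sup>2) / (qp K (v * \<rho> \<phi>) \<phi> r \<psi> + e)\<^sup>2 - K) * \<rho> \<phi>))" for r \<psi>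
    unfolding M_def
  proof (rule graph_stokes_quotient[where dr = "\<lambda>R \<phi>. sn K R * cs K r - cs K R * sn K r * cos (\<phi> - \<psi>)" and
        d\<theta> = "\<lambda>R \<phi>. sn K R * sn K r * sin (\<phi> - \<psi>)" and ar = "\<lambda>R \<phi>. 0" and
        a\<theta> = "\<lambda>R \<phi>. - (sn K r)\<^sup>2 * cos (\<phi> - \<psi>)" and
        br = "\<lambda>R \<phi>. sn K r * (cs K R * (sn K R * cs K r - cs K R * sn K r * cos (\<phi> - \<psi>)) +
          sn K R * (cs K R * cs K r + K * sn K R * sn K r * cos (\<phi> - \<psi>)))"])
    fix R \<phi>
    let ?s1 = "sn K R" and ?c1 = "cs K R" and ?s2 = "sn K r" and ?c2 = "cs K r"
    let ?C = "cos (\<phi> - \<psi>)" and ?S = "sin (\<phi> - \<psi>)" and ?q = "qp K R \<phi> r \<psi>"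
    have "(?s2 * (?c1 * (?s1 * ?c2 - ?c1 * ?s2 * ?C) + ?s1 * (?c1 * ?c2 + K * ?s1 * ?s2 * ?C)) - - ?s2\<^sup>2 * ?C) * (?q + e) -
      (?s2 * (?s1 * (?s1 * ?c2 - ?c1 * ?s2 * ?C)) * (?s1 * ?c2 - ?c1 * ?s2 * ?C) - - ?s2\<^sup>2 * ?S * (?s1 * ?s2 * ?S)) =
      ?s1 * ?s2 * ((2 * e + K * e\<^sup>2) - K * (?q + e)\<^sup>2)"
      using chord_kernel[OF cs_vers[of K R] cs_vers[of K r] sn_sq sn_sq sin_cos_squared_add qp_def, of \<phi> \<psi> e]
      by (simp add: power2_eq_square algebra_simps)
    then show "?s1 * ?s2 * ((2 * e + K * e\<^sup>2) / (?q + e)\<^sup>2 - K) =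
      ((?s2 * (?c1 * (?s1 * ?c2 - ?c1 * ?s2 * ?C) + ?s1 * (?c1 * ?c2 + K * ?s1 * ?s2 * ?C)) - - ?s2\<^sup>2 * ?C) * (?q + e) -
      (?s2 * (?s1 * (?s1 * ?c2 - ?c1 * ?s2 * ?C)) * (?s1 * ?c2 - ?c1 * ?s2 * ?C) - - ?s2\<^sup>2 * ?S * (?s1 * ?s2 * ?S))) / (?q + e)\<^sup>2"
      using qe'[of R \<phi> r \<psi>] by (simp add: divide_simps)
  qed (use qe in \<open>auto intro!: derivative_eq_intros continuous_intros \<rho> simp: \<rho>(3)[unfolded mult.commute[of 2]] qp_def cos_diff sin_diff cs_vers[of K r] algebra_simps power2_eq_square\<close>)
  let ?I = "{0..2*pi}" and ?J = "{0..1::real}"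
  have "integral ?I (\<lambda>\<psi>. integral ?J (\<lambda>u. integral ?I (\<lambda>\<phi>. integral ?J (\<lambda>v. ?k v \<phi> u \<psi> * \<rho> \<phi>)) * \<rho> \<psi>)) =
    integral ?I (\<lambda>\<psi>. integral ?J (\<lambda>u. integral ?I (\<lambda>\<phi>. M (u * \<rho> \<psi>) \<psi> \<phi> * \<rho> \<psi>)))"
    by (simp add: S5)
  \<comment> \<open>The order of integration changes so that the integral over u and \<psi> becomes
    innermost; this is the form in which \<open>S3\<close> returns \<open>N\<close>.\<close>
  also have "\<dots> = integral ?I (\<lambda>\<psi>. integral ?I (\<lambda>\<phi>. integral ?J (\<lambda>u. M (u * \<rho> \<psi>) \<psi> \<phi> * \<rho> \<psi>)))"
  proof (intro integral_cong)
    fix \<psi>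
    show "integral ?J (\<lambda>u. integral ?I (\<lambda>\<phi>. M (u * \<rho> \<psi>) \<psi> \<phi> * \<rho> \<psi>)) = integral ?I (\<lambda>\<phi>. integral ?J (\<lambda>u. M (u * \<rho> \<psi>) \<psi> \<phi> * \<rho> \<psi>))"
      using integral_swap_continuous[of 0 0 1 "2*pi" "\<lambda>u \<phi>. M (u * \<rho> \<psi>) \<psi> \<phi> * \<rho> \<psi>"]
      by (simp add: split_def cM continuous_intros)
  qed
  also have "\<dots> = integral ?I (\<lambda>\<phi>. integral ?I (\<lambda>\<psi>. integral ?J (\<lambda>u. M (u * \<rho> \<psi>) \<psi> \<phi> * \<rho> \<psi>)))"
  proof -
    have "continuous_on (cbox (0, 0) (2*pi, 2*pi)) (\<lambda>x. integral (cbox 0 1) (\<lambda>u. M (u * \<rho> (fst x)) (fst x) (snd x) * \<rho> (fst x)))"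
      by (rule integral_continuous_on_param) (auto simp: split_def intro!: cM continuous_intros)
    then show ?thesis
      using integral_swap_continuous[of 0 0 "2*pi" "2*pi" "\<lambda>\<psi> \<phi>. integral ?J (\<lambda>u. M (u * \<rho> \<psi>) \<psi> \<phi> * \<rho> \<psi>)"]
      by (simp add: split_def)
  qed
  also have "\<dots> = integral ?I (\<lambda>\<phi>. integral ?I (N \<phi>))" by (simp add: S3)
  also have "\<dots> = integral ?I (\<lambda>\<phi>. integral ?I (\<lambda>\<psi>. qst \<phi> \<psi> + N \<phi> \<psi>))"
    using cN cqst by (simp add: integral_add integrable_continuous_interval S2)
  also have "\<dots> \<le> integral ?I (\<lambda>\<phi>. integral ?I (\<lambda>\<psi>. ?l \<phi> * ?l \<psi>))"
  proof (intro integral_le S1)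
    show "(\<lambda>\<psi>. qst \<phi> \<psi> + N \<phi> \<psi>) integrable_on ?I" "(\<lambda>\<psi>. ?l \<phi> * ?l \<psi>) integrable_on ?I" for \<phi>
      by (intro integrable_continuous_interval continuous_intros cN cqst)+
    show "(\<lambda>\<phi>. integral ?I (\<lambda>\<psi>. qst \<phi> \<psi> + N \<phi> \<psi>)) integrable_on ?I"
      using integral_continuous_on_param[of ?I 0 "2*pi" "\<lambda>\<phi> \<psi>. qst \<phi> \<psi> + N \<phi> \<psi>"]
        continuous_on_add[OF cqst(1) cN(1)]
      by (auto intro!: integrable_continuous_interval simp: split_def)
    show "(\<lambda>\<phi>. integral ?I (\<lambda>\<psi>. ?l \<phi> * ?l \<psi>)) integrable_on ?I"
      by (simp, intro integrable_continuous_interval continuous_intros)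
  qed
  also have "\<dots> = (integral ?I ?l)\<^sup>2" by (simp add: power2_eq_square)
  finally show ?thesis .
qed

section \<open>Orthonormal frames and geodesic polar coordinates\<close>

lemma ambient_form_simps:
  "ambient_form K (u + v) w = ambient_form K u w + ambient_form K v w"
  "ambient_form K w (u + v) = ambient_form K w u + ambient_form K w v"
  "ambient_form K (u - v) w = ambient_form K u w - ambient_form K v w"
  "ambient_form K w (u - v) = ambient_form K w u - ambient_form K w v"
  "ambient_form K (a *\<^sub>R u) w = a * ambient_form K u w"
  "ambient_form K w (a *\<^sub>R u) = a * ambient_form K w u"
  by (auto simp: ambient_form_def inner_simps algebra_simps)

lemma ambient_form_commute: "ambient_form K u v = ambient_form K v u"
  by (simp add: ambient_form_def inner_commute mult.commute)

lemma continuous_on_ambient_form [continuous_intros]: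
  assumes "continuous_on S f" "continuous_on S g"
  shows "continuous_on S (\<lambda>x. ambient_form K (f x) (g x))"
  unfolding ambient_form_def using assms by (cases "K < 0") (simp_all add: continuous_intros)

lemma space_form_iff:
  assumes "K \<noteq> 0"
  shows "x \<in> space_form K \<longleftrightarrow> ambient_form K x x = 1 / K \<and> (K < 0 \<longrightarrow> snd x > 0)"
proof (cases "K > 0")
  case True
  have "norm x = 1 / sqrt K \<longleftrightarrow> (norm x)\<^sup>2 = (1 / sqrt K)\<^sup>2"
    using True by (simp add: power2_eq_iff_nonneg)
  also have "(norm x)\<^sup>2 = ambient_form K x x"
    using True by (cases x) (simp add: ambient_form_def norm_Pair power2_norm_eq_inner power2_eq_square[symmetric])
  finally show ?thesis using True by (simp add: space_form_def power_divide)
qed (use assms in \<open>auto simp: space_form_def\<close>)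

lemma flat_space_form_iff: "x \<in> space_form 0 \<longleftrightarrow> snd x = 0"
  by (cases x) (simp add: space_form_def)

lemma closed_space_form: "closed (space_form K)"
proof -
  consider "K > 0" | "K = 0" | "K < 0" by linarith
  then show ?thesis
  proof cases
    case 3
    \<comment> \<open>The strict inequality may be relaxed to a closed one, because the form is
      nonnegative where the last coordinate is 0.\<close>
    have "space_form K = {x. ambient_form K x x = 1 / K} \<inter> {x. snd x \<ge> 0}"
    proof (intro equalityI subsetI)
      fix x assume x: "x \<in> {x. ambient_form K x x = 1 / K} \<inter> {x. snd x \<ge> 0}"
      have "snd x \<noteq> 0"
      proof
        assume "snd x = 0"
        then have "ambient_form K x x \<ge> 0" using 3 by (simp add: ambient_form_def)
        then show False using x 3 by simp
      qed
      then show "x \<in> space_form K" using x 3 by (simp add: space_form_iff)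
    qed (use 3 in \<open>auto simp: space_form_iff\<close>)
    then show ?thesis
      by (auto intro!: closed_Int closed_Collect_eq closed_Collect_le continuous_intros)
  qed (auto simp: space_form_def intro: closed_Times)
qed

text \<open>For timelike vectors the product of the last coordinates strictly dominates the inner
  product of the first ones, so it alone decides the sign of the form.\<close>

lemma timelike_same_sheet:
  assumes "K < 0" "ambient_form K x x < 0" "ambient_form K y y < 0" "snd x > 0"
  shows "ambient_form K x y < 0 \<longleftrightarrow> snd y > 0"
proof -
  have "(norm (fst x))\<^sup>2 < (snd x)\<^sup>2" "(norm (fst y))\<^sup>2 < \<bar>snd y\<bar>\<^sup>2"
    using assms by (simp_all add: ambient_form_def power2_norm_eq_inner) (simp_all add: power2_eq_square)
  then have n: "norm (fst x) < snd x" "norm (fst y) < \<bar>snd y\<bar>"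
    using assms(4) by (meson abs_ge_zero less_imp_le power2_less_imp_less)+
  then have "norm (fst x) * norm (fst y) < snd x * \<bar>snd y\<bar>"
    by (intro mult_strict_mono') auto
  then have "\<bar>fst x \<bullet> fst y\<bar> < snd x * \<bar>snd y\<bar>"
    using Cauchy_Schwarz_ineq2[of "fst x" "fst y"] by linarith
  moreover have "snd y \<noteq> 0" using n by auto
  ultimately show ?thesis using assms by (auto simp: ambient_form_def abs_if split: if_splits)
qed

text \<open>The plane is moved to height 1, so that in all three cases every ray from the origin meets the
  surface at most once and the cone over a subset makes sense.\<close>

definition lift :: "real \<Rightarrow> complex \<times> real \<Rightarrow> complex \<times> real" where
  "lift K x = (fst x, if K = 0 then 1 else snd x)"

text \<open>The height of the lifted base point, equal to the absolute determinant of any lifted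
  point with an orthonormal tangent basis.\<close>

definition apex :: "real \<Rightarrow> real" where
  "apex K = (if K = 0 then 1 else 1 / sqrt \<bar>K\<bar>)"

text \<open>The determinant of three vectors, expanded along the first.\<close>

definition triple :: "complex \<times> real \<Rightarrow> complex \<times> real \<Rightarrow> complex \<times> real \<Rightarrow> real" where
  "triple u v w =
     Re (fst u) * (Im (fst v) * snd w - snd v * Im (fst w)) -
     Im (fst u) * (Re (fst v) * snd w - snd v * Re (fst w)) +
     snd u * (Re (fst v) * Im (fst w) - Im (fst v) * Re (fst w))"

definition chord :: "real \<Rightarrow> complex \<times> real \<Rightarrow> complex \<times> real \<Rightarrow> real" where
  "chord K x y = ambient_form K (x - y) (x - y) / 2"

lemma continuous_on_chord [continuous_intros]:
  assumes "continuous_on S f" "continuous_on S g"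
  shows "continuous_on S (\<lambda>x. chord K (f x) (g x))"
  unfolding chord_def using assms by (auto intro!: continuous_intros)

locale frame =
  fixes K :: real and p e1 e2 :: "complex \<times> real"
  assumes p: "p \<in> space_form K"
    and e11: "ambient_form K e1 e1 = 1" and e22: "ambient_form K e2 e2 = 1"
    and e12: "ambient_form K e1 e2 = 0"
    and pe: "K \<noteq> 0 \<Longrightarrow> ambient_form K p e1 = 0" "K \<noteq> 0 \<Longrightarrow> ambient_form K p e2 = 0"
    and flat: "K = 0 \<Longrightarrow> snd e1 = 0" "K = 0 \<Longrightarrow> snd e2 = 0"
    and expand: "\<And>y. (K = 0 \<Longrightarrow> snd y = 0) \<Longrightarrow>
      y = (K * ambient_form K y p) *\<^sub>R p + ambient_form K y e1 *\<^sub>R e1 + ambient_form K y e2 *\<^sub>R e2"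
    and triple_frame: "(triple (lift K p) e1 e2)\<^sup>2 = (apex K)\<^sup>2"

text \<open>The two vectors are the unit directions of the coordinate lines: the radial derivative
  of \<open>polar\<close> and the normalised angular one.\<close>

lemma polar_frame:
  "frame K (polar K a \<phi>) ((- K * sn K a) *\<^sub>R base_point K + cs K a *\<^sub>R (cis \<phi>, 0)) (\<i> * cis \<phi>, 0)"
proof -
  define b where "b = snd (base_point K)"
  define c s where "c = cs K a" and "s = sn K a"
  define C S where "C = cos \<phi>" and "S = sin \<phi>"
  define g where "g = (if K < 0 then -1 else 1 :: real)"
  have cs: "c\<^sup>2 + K * s\<^sup>2 = 1" and CS: "C\<^sup>2 + S\<^sup>2 = 1"
    by (simp_all add: c_def s_def C_def S_def cs_sn_sq)
  have b: "base_point K = (0, b)" by (simp add: b_def base_point_def)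
  have P: "polar K a \<phi> = (Complex (s * C) (s * S), c * b)"
    by (simp add: polar_def geodesic_def b c_def s_def C_def S_def complex_eq_iff)
  have E1: "(- K * s) *\<^sub>R (0, b) + c *\<^sub>R (cis \<phi>, 0) = (Complex (c * C) (c * S), - K * s * b)"
    by (simp add: C_def S_def complex_eq_iff)
  have E2: "(\<i> * cis \<phi>, 0::real) = (Complex (- S) C, 0)"
    by (simp add: C_def S_def complex_eq_iff)
  have f: "ambient_form K (Complex x y, z) (Complex x' y', z') = x * x' + y * y' + g * z * z'" for x y z x' y' z'
    by (simp add: ambient_form_def inner_complex_def g_def)
  have Kb: "K \<noteq> 0 \<Longrightarrow> K * g * b\<^sup>2 = 1" "K = 0 \<Longrightarrow> b = 0"
    by (auto simp: b_def base_point_def g_def power_divide)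
  show ?thesis
    unfolding b P c_def[symmetric] s_def[symmetric] E1 E2
  proof unfold_locales
    show "(Complex (s * C) (s * S), c * b) \<in> space_form K"
    proof (cases "K = 0")
      case False
      have "ambient_form K (Complex (s * C) (s * S), c * b) (Complex (s * C) (s * S), c * b) = s\<^sup>2 + g * b\<^sup>2 * c\<^sup>2" (is "?f = _")
        unfolding f using CS by algebra
      moreover have "K * (s\<^sup>2 + g * b\<^sup>2 * c\<^sup>2) = 1" using Kb(1)[OF False] cs by algebra
      ultimately have "?f = 1 / K" using False by (simp add: field_simps)
      moreover have "c * b > 0" if "K < 0"
        using that cs_ge_1[of K a] by (simp add: c_def b_def base_point_def)
      ultimately show ?thesis using False by (simp add: space_form_iff)
    qed (use Kb in \<open>simp add: flat_space_form_iff\<close>)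
    show "ambient_form K (Complex (c * C) (c * S), - K * s * b) (Complex (c * C) (c * S), - K * s * b) = 1"
    proof (cases "K = 0")
      case False then show ?thesis unfolding f using Kb(1)[OF False] cs CS by algebra
    next
      case True show ?thesis unfolding f using cs CS True Kb(2)[OF True] by algebra
    qed
    show "ambient_form K (Complex (- S) C, 0) (Complex (- S) C, 0) = 1"
      "ambient_form K (Complex (c * C) (c * S), - K * s * b) (Complex (- S) C, 0) = 0"
      "ambient_form K (Complex (s * C) (s * S), c * b) (Complex (- S) C, 0) = 0"
      unfolding f using CS by algebra+
    show "ambient_form K (Complex (s * C) (s * S), c * b) (Complex (c * C) (c * S), - K * s * b) = 0" if "K \<noteq> 0"
      unfolding f using Kb(1)[OF that] cs CS by algebra
    show "snd (Complex (c * C) (c * S), - K * s * b) = 0" "snd (Complex (- S) C, 0::real) = 0" if "K = 0"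
      using that by simp_all
    fix y :: "complex \<times> real" assume y: "K = 0 \<Longrightarrow> snd y = 0"
    obtain y1 y2 y3 where yy: "y = (Complex y1 y2, y3)" by (metis complex.collapse prod.collapse)
    have "y1 = K * (y1 * (s * C) + y2 * (s * S) + g * y3 * (c * b)) * (s * C) +
        (y1 * (c * C) + y2 * (c * S) + g * y3 * (- K * s * b)) * (c * C) + (y1 * (- S) + y2 * C + g * y3 * 0) * (- S)"
      "y2 = K * (y1 * (s * C) + y2 * (s * S) + g * y3 * (c * b)) * (s * S) +
        (y1 * (c * C) + y2 * (c * S) + g * y3 * (- K * s * b)) * (c * S) + (y1 * (- S) + y2 * C + g * y3 * 0) * C"
      using cs CS by algebra+
    moreover have "y3 = K * (y1 * (s * C) + y2 * (s * S) + g * y3 * (c * b)) * (c * b) +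
        (y1 * (c * C) + y2 * (c * S) + g * y3 * (- K * s * b)) * (- K * s * b)"
    proof (cases "K = 0")
      case False then show ?thesis using Kb(1)[OF False] cs CS by algebra
    qed (use y yy in simp)
    ultimately show "y = (K * ambient_form K y (Complex (s * C) (s * S), c * b)) *\<^sub>R (Complex (s * C) (s * S), c * b) +
        ambient_form K y (Complex (c * C) (c * S), - K * s * b) *\<^sub>R (Complex (c * C) (c * S), - K * s * b) +
        ambient_form K y (Complex (- S) C, 0) *\<^sub>R (Complex (- S) C, 0)"
      unfolding yy f by (simp add: complex_eq_iff)
  next
    show "(triple (lift K (Complex (s * C) (s * S), c * b)) (Complex (c * C) (c * S), - K * s * b) (Complex (- S) C, 0))\<^sup>2 = (apex K)\<^sup>2"
    proof (cases "K = 0")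
      case True
      then show ?thesis
        using cs CS by (simp add: triple_def lift_def apex_def c_def[symmetric]) algebra
    next
      case False
      then have "triple (lift K (Complex (s * C) (s * S), c * b)) (Complex (c * C) (c * S), - K * s * b) (Complex (- S) C, 0) = b"
        using cs CS by (simp add: triple_def lift_def) algebra
      then show ?thesis using False by (simp add: apex_def b_def base_point_def)
    qed
  qed
qed

lemma base_frame: "frame K (base_point K) (1, 0) (\<i>, 0)"
proof -
  have "polar K 0 0 = base_point K" by (simp add: polar_def geodesic_def prod_eq_iff)
  moreover have "(- K * sn K 0) *\<^sub>R base_point K + cs K 0 *\<^sub>R (cis 0, 0::real) = (1, 0)" by (simp add: prod_eq_iff)
  ultimately show ?thesis using polar_frame[of K 0 0] by simp
qed

context frame
begin

definition dir :: "real \<Rightarrow> complex \<times> real" where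
  "dir \<theta> = cos \<theta> *\<^sub>R e1 + sin \<theta> *\<^sub>R e2"

definition X :: "real \<Rightarrow> real \<Rightarrow> complex \<times> real" where
  "X r \<theta> = geodesic K p (dir \<theta>) r"

lemma X_eq: "X r \<theta> = cs K r *\<^sub>R p + sn K r *\<^sub>R dir \<theta>"
  by (simp add: X_def geodesic_def)

lemma X_0 [simp]: "X 0 \<theta> = p"
  by (simp add: X_eq)

lemma X_periodic [simp]: "X r (\<theta> + 2 * pi) = X r \<theta>"
  by (simp add: X_eq dir_def)

lemma X_cis: "cis \<theta> = cis \<phi> \<Longrightarrow> X r \<theta> = X r \<phi>"
  by (simp add: X_eq dir_def complex_eq_iff)

lemma e21: "ambient_form K e2 e1 = 0" and ep: "K \<noteq> 0 \<Longrightarrow> ambient_form K e1 p = 0" "K \<noteq> 0 \<Longrightarrow> ambient_form K e2 p = 0"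
  using e12 pe by (simp_all add: ambient_form_commute)

lemma pp: "K \<noteq> 0 \<Longrightarrow> ambient_form K p p = 1 / K"
  using p by (simp add: space_form_iff)

lemma dir_dir: "ambient_form K (dir \<theta>) (dir \<phi>) = cos (\<theta> - \<phi>)"
  by (simp add: dir_def ambient_form_simps e11 e12 e22 e21 cos_diff)

lemma p_dir: "K \<noteq> 0 \<Longrightarrow> ambient_form K p (dir \<theta>) = 0" "K \<noteq> 0 \<Longrightarrow> ambient_form K (dir \<theta>) p = 0"
  by (simp_all add: dir_def ambient_form_simps pe ep)

lemma X_X: "K \<noteq> 0 \<Longrightarrow> ambient_form K (X r \<theta>) (X s \<phi>) = cs K r * cs K s / K + sn K r * sn K s * cos (\<theta> - \<phi>)"
  by (simp add: X_eq ambient_form_simps pp p_dir dir_dir)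

lemma flat_pX: "K = 0 \<Longrightarrow> snd p = 0" "K = 0 \<Longrightarrow> snd (X r \<theta>) = 0" "K = 0 \<Longrightarrow> snd (dir \<theta>) = 0"
proof -
  show p0: "snd p = 0" if "K = 0" using p that by (simp add: flat_space_form_iff)
  show d0: "snd (dir \<theta>) = 0" if "K = 0" for \<theta> unfolding dir_def using flat[OF that] by simp
  show "snd (X r \<theta>) = 0" if "K = 0" unfolding X_eq using p0[OF that] d0[OF that] by simp
qed

lemma X_in: "X r \<theta> \<in> space_form K"
proof (cases "K = 0")
  case False
  have f: "ambient_form K (X r \<theta>) (X r \<theta>) = 1 / K"
    using False cs_sn_sq[of K r] by (simp add: X_X field_simps power2_eq_square)
  have "snd (X r \<theta>) > 0" if "K < 0"
  proof -
    have "ambient_form K p (X r \<theta>) = cs K r / K" using False by (simp add: X_eq ambient_form_simps pp p_dir)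
    also have "\<dots> < 0" using cs_ge_1[of K r] that by (simp add: divide_neg_neg divide_less_0_iff)
    finally show ?thesis
      using timelike_same_sheet[of K p "X r \<theta>"] that p f pp by (simp add: space_form_iff)
  qed
  then show ?thesis using f False by (simp add: space_form_iff)
next
  case True
  then have "X r \<theta> \<in> space_form 0" using flat_pX(2) unfolding flat_space_form_iff by blast
  with True show ?thesis by metis
qed

lemma chord_eq:
  assumes "K \<noteq> 0" "x \<in> space_form K" "y \<in> space_form K"
  shows "chord K x y = 1 / K - ambient_form K x y"
  using assms ambient_form_commute[of K x y] by (simp add: chord_def ambient_form_simps space_form_iff)

lemma chord_X: "chord K (X r \<theta>) (X s \<phi>) = qp K r \<theta> s \<phi>"
proof (cases "K = 0")
  case False
  then show ?thesis
    unfolding chord_eq[OF False X_in X_in] X_X[OF False] qp_def cs_vers by (simp add: field_simps)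
next
  case True
  have "X r \<theta> - X s \<phi> = r *\<^sub>R dir \<theta> - s *\<^sub>R dir \<phi>"
    unfolding X_eq using True by (simp add: cs_def sn_def)
  then have "chord K (X r \<theta>) (X s \<phi>) = (r * r + s * s - 2 * r * s * cos (\<theta> - \<phi>)) / 2"
    using cos_minus[of "\<theta> - \<phi>"] unfolding chord_def
    by (simp add: ambient_form_simps dir_dir) (simp add: algebra_simps)
  then show ?thesis using True by (simp add: qp_def sn_def vers_def power2_eq_square)
qed

lemma chord_p_X: "chord K p (X r \<theta>) = vers K r"
  using chord_X[of 0 0 r \<theta>] by (simp add: qp_def)

lemma X_inj:
  assumes "X r \<theta> = X s \<phi>" "0 \<le> r" "K > 0 \<Longrightarrow> r \<le> pi / sqrt K" "0 \<le> s" "K > 0 \<Longrightarrow> s \<le> pi / sqrt K"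
  shows "r = s" "0 < s \<Longrightarrow> (K > 0 \<Longrightarrow> s < pi / sqrt K) \<Longrightarrow> cis \<theta> = cis \<phi>"
proof -
  show rs: "r = s"
    using chord_p_X[of r \<theta>] chord_p_X[of s \<phi>] assms by (intro vers_inj[of r s K]) auto
  assume "0 < s" "K > 0 \<Longrightarrow> s < pi / sqrt K"
  then have "sn K s > 0" using sn_pos by auto
  moreover have "sn K s *\<^sub>R dir \<theta> = sn K s *\<^sub>R dir \<phi>" using assms(1) rs by (simp add: X_eq)
  ultimately have d: "dir \<theta> = dir \<phi>" by simp
  have "ambient_form K (dir \<theta>) e1 = cos \<theta>" "ambient_form K (dir \<theta>) e2 = sin \<theta>" for \<theta>
    by (simp_all add: dir_def ambient_form_simps e11 e12 e22 e21)
  then show "cis \<theta> = cis \<phi>" using d by (metis complex_eqI cis.simps)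
qed

lemma X_surj:
  assumes y: "y \<in> space_form K"
  obtains r \<theta> where "0 \<le> r" "K > 0 \<longrightarrow> r \<le> pi / sqrt K" "0 \<le> \<theta>" "\<theta> < 2 * pi" "y = X r \<theta>"
proof -
  \<comment> \<open>In the plane a point is p plus a tangent vector, so the tangential part has to
    be read off from y - p.\<close>
  define d where "d = (if K = 0 then y - p else y)"
  define z where "z = Complex (ambient_form K d e1) (ambient_form K d e2)"
  define k where "k = (if K = 0 then 1 else K * ambient_form K y p)"
  have d0: "snd d = 0" if "K = 0" using that y flat_pX(1)[OF that] by (simp add: d_def flat_space_form_iff)
  have "d = (K * ambient_form K d p) *\<^sub>R p + Re z *\<^sub>R e1 + Im z *\<^sub>R e2"
    using expand[OF d0] by (simp add: z_def)
  then have yz: "y = k *\<^sub>R p + (Re z *\<^sub>R e1 + Im z *\<^sub>R e2)"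
    by (cases "K = 0") (auto simp: d_def k_def algebra_simps)
  have "k\<^sup>2 + K * (norm z)\<^sup>2 = 1"
  proof (cases "K = 0")
    case False
    have "ambient_form K y y = k\<^sup>2 / K + (norm z)\<^sup>2"
      by (subst (1 2) yz) (simp add: ambient_form_simps pp pe ep e11 e12 e21 e22 False,
          simp add: power2_eq_square[symmetric] cmod_power2)
    moreover have "ambient_form K y y = 1 / K" using False y by (simp add: space_form_iff)
    ultimately have "k\<^sup>2 / K + (norm z)\<^sup>2 = 1 / K" by simp
    then show ?thesis using False by (simp add: field_simps)
  qed (simp add: k_def)
  moreover have "0 < k" if "K < 0"
  proof -
    have "ambient_form K y p < 0"
      using timelike_same_sheet[of K y p] that y p by (simp add: space_form_iff)
    then show ?thesis using that by (simp add: k_def mult_neg_neg)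
  qed
  ultimately obtain r where r: "0 \<le> r" "K > 0 \<longrightarrow> r \<le> pi / sqrt K" "cs K r = k" "sn K r = norm z"
    using polar_radius_exists[of k K "norm z"] by (auto simp: k_def)
  have "Re z = norm z * cos (Arg2pi z)" "Im z = norm z * sin (Arg2pi z)"
    using Arg2pi_eq[of z] by (metis Re_exp Im_exp Re_rcis Im_rcis rcis_def cis_conv_exp mult.commute)+
  then have "y = X r (Arg2pi z)"
    by (subst yz) (simp add: X_eq dir_def r algebra_simps)
  then show thesis using that r Arg2pi_ge_0 Arg2pi_lt_2pi by blast
qed

lemma unit_tangent_dir: "dir \<theta> \<in> unit_tangent K p"
  using flat_pX(3) p_dir
  by (simp add: unit_tangent_def tangent_space_def dir_dir mem_Times_iff)

end

lemma polar_eq_X: "polar K r \<theta> = frame.X K (base_point K) (1, 0) (\<i>, 0) r \<theta>"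
proof -
  interpret frame K "base_point K" "(1, 0)" "(\<i>, 0)" by (rule base_frame)
  have "dir \<theta> = (cis \<theta>, 0)" by (simp add: dir_def complex_eq_iff)
  then show ?thesis by (simp add: X_def polar_def)
qed

text \<open>Polar coordinates at the base point reach every point, and \<open>polar_frame\<close>
  supplies a frame wherever they arrive.\<close>

lemma exists_frame:
  assumes "p \<in> space_form K"
  obtains e1 e2 where "frame K p e1 e2"
proof -
  interpret frame K "base_point K" "(1, 0)" "(\<i>, 0)" by (rule base_frame)
  obtain r \<theta> where "p = polar K r \<theta>" using X_surj[OF assms] unfolding polar_eq_X by metis
  then show thesis using polar_frame that by blast
qed

section \<open>The area measure\<close>

lemma vector3_measurable [measurable]:
  "(\<lambda>(a, b, c). vector [a, b, c] :: real^3) \<in> borel_measurable (borel :: (real \<times> real \<times> real) measure)"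
proof -
  have "(\<lambda>(a, b, c). vector [a, b, c] :: real^3) = (\<lambda>x. fst x *\<^sub>R axis 1 1 + fst (snd x) *\<^sub>R axis 2 1 + snd (snd x) *\<^sub>R axis 3 1)"
    by (auto simp: fun_eq_iff vec_eq_iff forall_3 vector_3 axis_def)
  then show ?thesis by (auto intro!: borel_measurable_continuous_onI continuous_intros)
qed

text \<open>Determinants and the change of variables formula live in \<open>real^3\<close>, Fubini's
  theorem in products; this identifies the two Lebesgue measures.\<close>

lemma distr_lborel_vector3:
  "distr lborel borel (\<lambda>(a, b, c). vector [a, b, c] :: real^3) = lborel"
proof (rule lborel_eqI[symmetric])
  fix l u :: "real^3" assume lu: "\<And>b. b \<in> Basis \<Longrightarrow> l \<bullet> b \<le> u \<bullet> b"
  have lu': "l $ i \<le> u $ i" for i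
    using lu[of "axis i 1"] by (simp add: inner_axis)
  have "(\<lambda>(a, b, c). vector [a, b, c] :: real^3) -` box l u = box (l$1, l$2, l$3) (u$1, u$2, u$3)"
    by (auto simp: mem_box_cart forall_3 vector_3 mem_box ball_Un Basis_prod_def)
  then have "emeasure (distr lborel borel (\<lambda>(a, b, c). vector [a, b, c])) (box l u) =
      emeasure lborel (box (l$1, l$2, l$3) (u$1, u$2, u$3))"
    by (simp add: emeasure_distr)
  also have "\<dots> = ennreal ((u$1 - l$1) * ((u$2 - l$2) * (u$3 - l$3)))"
    using lu' by (simp add: emeasure_lborel_box_eq Basis_prod_def prod.union_disjoint)
  also have "(u$1 - l$1) * ((u$2 - l$2) * (u$3 - l$3)) = (\<Prod>b\<in>Basis. (u - l) \<bullet> b)"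
  proof -
    have B: "(Basis :: (real^3) set) = (\<lambda>i. axis i 1) ` UNIV" by (auto simp: Basis_vec_def)
    have "inj (\<lambda>i::3. axis i (1::real))" by (auto simp: inj_def axis_eq_axis)
    then have "(\<Prod>b\<in>Basis. (u - l) \<bullet> b) = (\<Prod>i\<in>UNIV. (u - l) \<bullet> axis i 1)"
      unfolding B by (subst prod.reindex) simp_all
    also have "\<dots> = (u$1 - l$1) * ((u$2 - l$2) * (u$3 - l$3))"
      unfolding UNIV_3 by (simp add: inner_axis mult.assoc)
    finally show ?thesis by simp
  qed
  finally show "emeasure (distr lborel borel (\<lambda>(a, b, c). vector [a, b, c])) (box l u) = (\<Prod>b\<in>Basis. (u - l) \<bullet> b)" .
qed simp

context frame
begin

text \<open>The area measure as seen from this frame, with the density \<open>sn K r\<close> in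
  place of \<open>area_element\<close>.\<close>

definition polar_measure :: "(complex \<times> real) measure" where
  "polar_measure = distr (density lborel (\<lambda>(r, \<theta>). indicator (polar_domain K) (r, \<theta>) * ennreal (sn K r))) borel (\<lambda>(r, \<theta>). X r \<theta>)"

lemma sets_polar_measure [simp, measurable_cong]: "sets polar_measure = sets borel"
  and space_polar_measure [simp]: "space polar_measure = UNIV"
  by (simp_all add: polar_measure_def)

lemma continuous_on_X [continuous_intros]:
  fixes S :: "'a::t2_space set"
  assumes "continuous_on S f" "continuous_on S g"
  shows "continuous_on S (\<lambda>x. X (f x) (g x))"
  unfolding X_eq dir_def using assms by (intro continuous_intros)

lemma X_measurable [measurable]:
  "(\<lambda>(r, \<theta>). X r \<theta>) \<in> borel_measurable borel" "(\<lambda>x. X (fst x) (snd x)) \<in> borel_measurable borel"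
  unfolding split_def by (auto intro!: borel_measurable_continuous_onI continuous_intros)

lemma polar_domain_measurable [measurable]: "polar_domain K \<in> sets borel"
proof -
  have "polar_domain K = (if K > 0 then {0<..<pi / sqrt K} else {0<..}) \<times> {0..<2 * pi}"
    by (auto simp: polar_domain_def)
  then show ?thesis by (auto intro: borel_Times)
qed

lemma sn_measurable [measurable]: "(\<lambda>p :: real \<times> real. sn K (fst p)) \<in> borel_measurable borel"
  by (auto intro!: borel_measurable_continuous_onI continuous_intros)

lemma nn_integral_polar_measure:
  assumes [measurable]: "f \<in> borel_measurable borel"
  shows "(\<integral>\<^sup>+x. f x \<partial>polar_measure) =
    (\<integral>\<^sup>+(r, \<theta>). indicator (polar_domain K) (r, \<theta>) * ennreal (sn K r) * f (X r \<theta>) \<partial>lborel)"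
  unfolding polar_measure_def
  by (subst nn_integral_distr, simp, simp, subst nn_integral_density) (auto simp: split_def mult.assoc)

lemma emeasure_polar_measure:
  assumes [measurable]: "E \<in> sets borel"
  shows "emeasure polar_measure E =
    (\<integral>\<^sup>+(r, \<theta>). indicator (polar_domain K) (r, \<theta>) * ennreal (sn K r) * indicator E (X r \<theta>) \<partial>lborel)"
  using nn_integral_polar_measure[of "indicator E"] by simp

end

lemma apex_pos: "0 < apex K"
  by (simp add: apex_def)

lemma sn_pos_polar_domain: "(r, \<theta>) \<in> polar_domain K \<Longrightarrow> 0 < sn K r"
  by (auto simp: polar_domain_def intro: sn_pos)

section \<open>Volume of the cone over a set\<close>

definition vec3 :: "complex \<times> real \<Rightarrow> real^3" where
  "vec3 y = vector [Re (fst y), Im (fst y), snd y]"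

text \<open>No frame enters this set, which makes its volume a common value for all polar coordinate
  systems.\<close>

definition cone :: "real \<Rightarrow> (complex \<times> real) set \<Rightarrow> (real^3) set" where
  "cone K E = {t *\<^sub>R vec3 (lift K y) |t y. 0 < t \<and> t < 1 \<and> y \<in> E}"

lemma linear_vec3: "linear vec3"
  by (intro linearI) (simp_all add: vec3_def vec_eq_iff forall_3 vector_3)

lemma inj_vec3: "vec3 x = vec3 y \<longleftrightarrow> x = y"
  by (auto simp: vec3_def vec_eq_iff forall_3 vector_3 prod_eq_iff complex_eq_iff)

lemma has_derivative_cs_sn [derivative_intros]:
  assumes "(g has_derivative g') (at x within S)"
  shows "((\<lambda>x. cs K (g x)) has_derivative (\<lambda>h. g' h * (- K * sn K (g x)))) (at x within S)"
    "((\<lambda>x. sn K (g x)) has_derivative (\<lambda>h. g' h * cs K (g x))) (at x within S)"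
  using DERIV_compose_FDERIV[OF DERIV_cs assms] DERIV_compose_FDERIV[OF DERIV_sn assms] by simp_all

lemma lift_ray_inj:
  assumes "x \<in> space_form K" "y \<in> space_form K" "s *\<^sub>R lift K x = t *\<^sub>R lift K y" "0 < s" "0 < t"
  shows "s = t \<and> x = y"
proof (cases "K = 0")
  case True
  then show ?thesis
    using assms by (auto simp: lift_def prod_eq_iff flat_space_form_iff)
next
  case False
  then have l: "lift K x = x" "lift K y = y" by (simp_all add: lift_def)
  have "s * s * ambient_form K x x = t * t * ambient_form K y y"
    using arg_cong[OF assms(3), of "\<lambda>z. ambient_form K z z"] by (simp add: l ambient_form_simps)
  then have "s * s = t * t" using assms False by (simp add: space_form_iff)
  then have "s = t" using assms by (simp add: power2_eq_iff_nonneg flip: power2_eq_square)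
  then show ?thesis using assms l by simp
qed

context frame
begin

definition cone_chart :: "real^3 \<Rightarrow> real^3" where
  "cone_chart v = v$1 *\<^sub>R (cs K (v$2) *\<^sub>R vec3 (lift K p) + sn K (v$2) *\<^sub>R (cos (v$3) *\<^sub>R vec3 e1 + sin (v$3) *\<^sub>R vec3 e2))"

definition cone_domain :: "(complex \<times> real) set \<Rightarrow> (real^3) set" where
  "cone_domain E = {v. 0 < v$1 \<and> v$1 < 1 \<and> (v$2, v$3) \<in> polar_domain K \<and> X (v$2) (v$3) \<in> E}"

lemma lift_X: "lift K (X r \<theta>) = cs K r *\<^sub>R lift K p + sn K r *\<^sub>R dir \<theta>"
proof (cases "K = 0")
  case True
  then have "cs K r = 1" by (simp add: cs_def)
  then show ?thesis using flat_pX(3)[OF True, of \<theta>] unfolding lift_def X_eq by (simp add: prod_eq_iff)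
qed (simp add: lift_def X_eq prod_eq_iff)

lemma cone_chart_eq: "cone_chart v = v$1 *\<^sub>R vec3 (lift K (X (v$2) (v$3)))"
  by (simp add: cone_chart_def lift_X dir_def linear_add[OF linear_vec3] linear_scale[OF linear_vec3])

lemma cone_chart_image:
  "cone_chart ` cone_domain E = cone K (E \<inter> (\<lambda>(r, \<theta>). X r \<theta>) ` polar_domain K)"
proof (intro equalityI subsetI)
  fix w assume "w \<in> cone K (E \<inter> (\<lambda>(r, \<theta>). X r \<theta>) ` polar_domain K)"
  then obtain t r \<theta> where w: "0 < t" "t < 1" "(r, \<theta>) \<in> polar_domain K" "X r \<theta> \<in> E" "w = t *\<^sub>R vec3 (lift K (X r \<theta>))"
    by (auto simp: cone_def)
  then have "w = cone_chart (vector [t, r, \<theta>])" "vector [t, r, \<theta>] \<in> cone_domain E"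
    by (simp_all add: cone_chart_eq cone_domain_def vector_3)
  then show "w \<in> cone_chart ` cone_domain E" by blast
next
  fix w assume "w \<in> cone_chart ` cone_domain E"
  then obtain v where v: "v \<in> cone_domain E" "w = cone_chart v" by blast
  then have "X (v$2) (v$3) \<in> E \<inter> (\<lambda>(r, \<theta>). X r \<theta>) ` polar_domain K"
    by (force simp: cone_domain_def)
  then show "w \<in> cone K (E \<inter> (\<lambda>(r, \<theta>). X r \<theta>) ` polar_domain K)"
    using v unfolding cone_def cone_domain_def cone_chart_eq by blast
qed

lemma X_inj_on: "inj_on (\<lambda>(r, \<theta>). X r \<theta>) (polar_domain K)"
proof (intro inj_onI, clarify)
  fix r \<theta> s \<phi> assume a: "(r, \<theta>) \<in> polar_domain K" "(s, \<phi>) \<in> polar_domain K" "X r \<theta> = X s \<phi>"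
  have "r = s" "cis \<theta> = cis \<phi>"
    using a X_inj[OF a(3)] by (auto simp: polar_domain_def less_imp_le)
  moreover have "\<theta> = \<phi>" if "cis \<theta> = cis \<phi>"
    using that a Arg2pi_unique[of 1 \<theta> "cis \<theta>"] Arg2pi_unique[of 1 \<phi> "cis \<theta>"]
    by (simp add: polar_domain_def cis_conv_exp)
  ultimately show "r = s \<and> \<theta> = \<phi>" by blast
qed

lemma cone_chart_inj: "inj_on cone_chart (cone_domain E)"
proof (rule inj_onI)
  fix v w assume v: "v \<in> cone_domain E" and w: "w \<in> cone_domain E" and eq: "cone_chart v = cone_chart w"
  have "vec3 (v$1 *\<^sub>R lift K (X (v$2) (v$3))) = vec3 (w$1 *\<^sub>R lift K (X (w$2) (w$3)))"
    using eq by (simp add: cone_chart_eq linear_scale[OF linear_vec3])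
  then have "v$1 = w$1 \<and> X (v$2) (v$3) = X (w$2) (w$3)"
    using v w by (intro lift_ray_inj[OF X_in X_in]) (auto simp: inj_vec3 cone_domain_def)
  moreover have "(v$2, v$3) = (w$2, w$3)"
    using calculation v w X_inj_on by (intro inj_onD[OF X_inj_on]) (auto simp: cone_domain_def)
  ultimately show "v = w" by (simp add: vec_eq_iff forall_3)
qed

lemma cone_chart_derivative:
  "(cone_chart has_derivative (\<lambda>h.
     h$1 *\<^sub>R vec3 (lift K (X (v$2) (v$3))) +
     h$2 *\<^sub>R v$1 *\<^sub>R ((- K * sn K (v$2)) *\<^sub>R vec3 (lift K p) + cs K (v$2) *\<^sub>R (cos (v$3) *\<^sub>R vec3 e1 + sin (v$3) *\<^sub>R vec3 e2)) +
     h$3 *\<^sub>R (v$1 * sn K (v$2)) *\<^sub>R (- sin (v$3) *\<^sub>R vec3 e1 + cos (v$3) *\<^sub>R vec3 e2))) (at v within S)"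
proof -
  have [derivative_intros]: "((\<lambda>v. v$i) has_derivative (\<lambda>h. h$i)) (at v within S)" for i
    by (rule bounded_linear_imp_has_derivative[OF bounded_linear_vec_nth])
  show ?thesis
    unfolding cone_chart_def lift_X
    by (rule derivative_eq_intros refl)+
      (auto simp: fun_eq_iff vec_eq_iff dir_def linear_add[OF linear_vec3] linear_scale[OF linear_vec3] algebra_simps)
qed

text \<open>The columns are lift X, t X_r and t X_\<theta>. The first two arise from lift p and the
  unit direction by a matrix of determinant cs^2 + K sn^2 = 1, so only the factors t^2 and sn remain
  besides the volume of the frame.\<close>

lemma cone_chart_det:
  fixes v :: "real^3"
  defines "J \<equiv> (\<lambda>h::real^3.
     h$1 *\<^sub>R vec3 (lift K (X (v$2) (v$3))) +
     h$2 *\<^sub>R v$1 *\<^sub>R ((- K * sn K (v$2)) *\<^sub>R vec3 (lift K p) + cs K (v$2) *\<^sub>R (cos (v$3) *\<^sub>R vec3 e1 + sin (v$3) *\<^sub>R vec3 e2)) +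
     h$3 *\<^sub>R (v$1 * sn K (v$2)) *\<^sub>R (- sin (v$3) *\<^sub>R vec3 e1 + cos (v$3) *\<^sub>R vec3 e2))"
  shows "\<bar>det (matrix J)\<bar> = (v$1)\<^sup>2 * \<bar>sn K (v$2)\<bar> * apex K"
proof -
  have "det (matrix J) = (v$1)\<^sup>2 * sn K (v$2) * triple (lift K p) e1 e2"
    unfolding det_3 matrix_def J_def lift_X dir_def
    by (simp add: axis_def vec3_def vector_3 triple_def)
      (use cs_sn_sq[of K "v$2"] sin_cos_squared_add[of "v$3"] in algebra)
  moreover have "\<bar>triple (lift K p) e1 e2\<bar> = apex K"
    using arg_cong[OF triple_frame, of sqrt] apex_pos[of K] by simp
  ultimately show ?thesis by (simp add: abs_mult)
qed

lemma cone_domain_measurable [measurable]: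
  assumes [measurable]: "E \<in> sets borel"
  shows "cone_domain E \<in> sets borel"
proof -
  have [measurable]: "(\<lambda>v::real^3. v$i) \<in> borel_measurable borel" for i
    by (auto intro!: borel_measurable_continuous_onI continuous_intros)
  have "(\<lambda>v::real^3. (v$2, v$3)) \<in> borel_measurable borel"
    by (auto intro!: borel_measurable_continuous_onI continuous_intros)
  moreover have "polar_domain K \<inter> (\<lambda>(r, \<theta>). X r \<theta>) -` E \<in> sets borel"
    using measurable_sets_borel[OF X_measurable(1) assms] by auto
  ultimately have "(\<lambda>v::real^3. (v$2, v$3)) -` (polar_domain K \<inter> (\<lambda>(r, \<theta>). X r \<theta>) -` E) \<in> sets borel"
    by (rule measurable_sets_borel)
  moreover have "{v::real^3. 0 < v$1 \<and> v$1 < 1} \<in> sets borel" by measurable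
  moreover have "cone_domain E = {v. 0 < v$1 \<and> v$1 < 1} \<inter> (\<lambda>v::real^3. (v$2, v$3)) -` (polar_domain K \<inter> (\<lambda>(r, \<theta>). X r \<theta>) -` E)"
    by (auto simp: cone_domain_def)
  ultimately show ?thesis by simp
qed

lemma measure_cone_iff:
  assumes E: "E \<in> sets borel" "E \<subseteq> (\<lambda>(r, \<theta>). X r \<theta>) ` polar_domain K"
  shows "cone K E \<in> lmeasurable \<and> measure lebesgue (cone K E) = m \<longleftrightarrow>
    ((\<lambda>v. (v$1)\<^sup>2 * sn K (v$2) * apex K) has_integral m) (cone_domain E)"
proof -
  have "cone K E = cone_chart ` cone_domain E" using E by (simp add: cone_chart_image Int_absorb2)
  moreover have "cone_chart ` cone_domain E \<in> lmeasurable \<and> measure lebesgue (cone_chart ` cone_domain E) = m \<longleftrightarrow>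
    ((\<lambda>v. (v$1)\<^sup>2 * \<bar>sn K (v$2)\<bar> * apex K) has_integral m) (cone_domain E)"
    unfolding cone_chart_det[symmetric]
    by (intro has_measure_differentiable_image cone_chart_derivative cone_chart_inj) (use E in simp)
  moreover have "((\<lambda>v. (v$1)\<^sup>2 * \<bar>sn K (v$2)\<bar> * apex K) has_integral m) (cone_domain E) \<longleftrightarrow>
    ((\<lambda>v. (v$1)\<^sup>2 * sn K (v$2) * apex K) has_integral m) (cone_domain E)"
    by (intro has_integral_cong) (auto simp: cone_domain_def dest: sn_pos_polar_domain)
  ultimately show ?thesis by simp
qed

end

context frame
begin

text \<open>The Jacobian is a product of a function of t and the polar density, so the cone volume
  is a constant times the polar measure of its base.\<close>

lemma nn_integral_cone_domain:
  assumes [measurable]: "E \<in> sets borel"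
  shows "(\<integral>\<^sup>+v. ennreal ((v$1)\<^sup>2 * sn K (v$2) * apex K) * indicator (cone_domain E) v \<partial>lborel) =
    (\<integral>\<^sup>+t. ennreal (t\<^sup>2 * apex K) * indicator {0<..<1} t \<partial>lborel) * emeasure polar_measure E"
proof -
  let ?g = "\<lambda>t::real. ennreal (t\<^sup>2 * apex K) * indicator {0<..<1} t"
  let ?h = "\<lambda>x. indicator (polar_domain K) x * ennreal (sn K (fst x)) * indicator E (X (fst x) (snd x))"
  have apex: "apex K > 0" by (simp add: apex_def)
  have [measurable]: "(\<lambda>v::real^3. v$i) \<in> borel_measurable borel" for i
    by (auto intro!: borel_measurable_continuous_onI continuous_intros)
  have [measurable]: "(\<lambda>v::real^3. sn K (v$2)) \<in> borel_measurable borel"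
    by (auto intro!: borel_measurable_continuous_onI continuous_intros)
  have h [measurable]: "?h \<in> borel_measurable borel" by measurable
  let ?V = "\<lambda>(a, b, c). vector [a, b, c] :: real^3"
  let ?F = "\<lambda>v::real^3. ennreal ((v$1)\<^sup>2 * sn K (v$2) * apex K) * indicator (cone_domain E) v"
  have "(\<integral>\<^sup>+v. ?F v \<partial>lborel) = (\<integral>\<^sup>+v. ?F v \<partial>distr lborel borel ?V)"
    by (simp only: distr_lborel_vector3)
  also have "\<dots> = (\<integral>\<^sup>+x. ?F (?V x) \<partial>lborel)"
    by (rule nn_integral_distr) (simp, measurable)
  also have "\<dots> = (\<integral>\<^sup>+x. ?g (fst x) * ?h (snd x) \<partial>lborel)"
  proof (intro nn_integral_cong, clarify)
    fix t r \<theta> :: real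
    have "0 \<le> sn K r" if "(r, \<theta>) \<in> polar_domain K" using sn_pos_polar_domain[OF that] by simp
    then show "?F (vector [t, r, \<theta>]) = ?g (fst (t, r, \<theta>)) * ?h (snd (t, r, \<theta>))"
      using apex by (auto simp: indicator_def cone_domain_def vector_3 ennreal_mult mult_ac)
  qed
  also have "\<dots> = (\<integral>\<^sup>+t. \<integral>\<^sup>+x. ?g t * ?h x \<partial>lborel \<partial>lborel)"
  proof -
    have "(\<lambda>x. ?g (fst x) * ?h (snd x)) \<in> borel_measurable (lborel \<Otimes>\<^sub>M lborel)"
      using h by measurable
    from lborel.nn_integral_fst[OF this] show ?thesis by (simp add: lborel_prod)
  qed
  also have "\<dots> = (\<integral>\<^sup>+t. ?g t \<partial>lborel) * (\<integral>\<^sup>+x. ?h x \<partial>lborel)"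
    using h by (simp add: nn_integral_cmult nn_integral_multc)
  also have "(\<integral>\<^sup>+x. ?h x \<partial>lborel) = emeasure polar_measure E"
    by (simp add: emeasure_polar_measure split_def)
  finally show ?thesis .
qed

lemma emeasure_polar_measure_iff:
  assumes E: "E \<in> sets borel" "E \<subseteq> (\<lambda>(r, \<theta>). X r \<theta>) ` polar_domain K" and m: "0 \<le> m"
  shows "(\<integral>\<^sup>+t. ennreal (t\<^sup>2 * apex K) * indicator {0<..<1} t \<partial>lborel) * emeasure polar_measure E = ennreal m \<longleftrightarrow>
    cone K E \<in> lmeasurable \<and> measure lebesgue (cone K E) = m"
proof -
  let ?f = "\<lambda>v. (v$1)\<^sup>2 * sn K (v$2) * apex K"
  have nonneg: "0 \<le> ?f v" if "v \<in> cone_domain E" for v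
    using that apex_pos[of K] by (auto simp: cone_domain_def dest: sn_pos_polar_domain)
  have [measurable]: "(\<lambda>v::real^3. v$i) \<in> borel_measurable borel" "(\<lambda>v::real^3. sn K (v$2)) \<in> borel_measurable borel" for i
    by (auto intro!: borel_measurable_continuous_onI continuous_intros)
  have "(\<integral>\<^sup>+v. ennreal (?f v) * indicator (cone_domain E) v \<partial>lborel) = ennreal m \<longleftrightarrow> (?f has_integral m) (cone_domain E)"
  proof
    assume "(?f has_integral m) (cone_domain E)"
    then show "(\<integral>\<^sup>+v. ennreal (?f v) * indicator (cone_domain E) v \<partial>lborel) = ennreal m"
      using nonneg by (intro nn_integral_has_integral_lebesgue')
  next
    assume a: "(\<integral>\<^sup>+v. ennreal (?f v) * indicator (cone_domain E) v \<partial>lborel) = ennreal m"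
    have "((\<lambda>v. ?f v * indicator (cone_domain E) v) has_integral m) UNIV"
    proof (rule nn_integral_has_integral)
      show "(\<lambda>v. ?f v * indicator (cone_domain E) v) \<in> borel_measurable borel"
        using E by measurable
      show "(\<integral>\<^sup>+v. ennreal (?f v * indicator (cone_domain E) v) \<partial>lborel) = ennreal m"
        using a by (simp add: ennreal_indicator[symmetric] ennreal_mult'')
    qed (use nonneg m in \<open>auto simp: indicator_def\<close>)
    moreover have "(\<lambda>v. ?f v * indicator (cone_domain E) v) = (\<lambda>v. if v \<in> cone_domain E then ?f v else 0)"
      by (auto simp: indicator_def)
    ultimately show "(?f has_integral m) (cone_domain E)"
      by (simp only: has_integral_restrict_UNIV)
  qed
  then show ?thesis using measure_cone_iff[OF E] nn_integral_cone_domain[OF E(1)] by simp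
qed

lemma emeasure_polar_measure_point:
  "emeasure polar_measure {x} = 0"
proof -
  have "AE y in lborel. indicator (polar_domain K) y * ennreal (sn K (fst y)) * indicator {x} (X (fst y) (snd y)) = 0"
  proof -
    have sub: "{y \<in> polar_domain K. X (fst y) (snd y) = x} \<subseteq> {z}" if "z \<in> polar_domain K" "X (fst z) (snd z) = x" for z
    proof
      fix y assume "y \<in> {y \<in> polar_domain K. X (fst y) (snd y) = x}"
      then have "y = z" using that by (intro inj_onD[OF X_inj_on]) (simp_all add: split_def)
      then show "y \<in> {z}" by simp
    qed
    obtain z where z: "{y \<in> polar_domain K. X (fst y) (snd y) = x} \<subseteq> {z}"
    proof (cases "{y \<in> polar_domain K. X (fst y) (snd y) = x} = {}")
      case False
      then obtain z where "z \<in> polar_domain K" "X (fst z) (snd z) = x" by blast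
      then show ?thesis using that[OF sub] by simp
    qed (use that in fast)
    have "indicator (polar_domain K) y * ennreal (sn K (fst y)) * indicator {x} (X (fst y) (snd y)) = 0" if "y \<noteq> z" for y
    proof -
      have "y \<notin> polar_domain K \<or> X (fst y) (snd y) \<notin> {x}" using that z by auto
      then show ?thesis by (elim disjE) (simp_all add: indicator_simps(2))
    qed
    then show ?thesis by (rule eventually_mono[OF AE_lborel_singleton])
  qed
  then show ?thesis
    by (simp add: emeasure_polar_measure split_def) (subst nn_integral_0_iff_AE, auto)
qed

lemma emeasure_polar_measure_range:
  assumes [measurable]: "E \<in> sets borel" and "E \<inter> (\<lambda>(r, \<theta>). X r \<theta>) ` polar_domain K = {}"
  shows "emeasure polar_measure E = 0"
proof -
  have "indicator (polar_domain K) y * ennreal (sn K (fst y)) * indicator E (X (fst y) (snd y)) = 0" for y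
    using assms(2) by (force simp: indicator_def)
  then show ?thesis
    by (simp only: emeasure_polar_measure[OF assms(1)] split_def prod.collapse) simp
qed

lemma X_image_polar_domain:
  obtains F where "finite F" "(\<lambda>(r, \<theta>). X r \<theta>) ` polar_domain K = space_form K - F"
proof
  let ?F = "{p, X (pi / sqrt K) 0}"
  let ?I = "(\<lambda>(r, \<theta>). X r \<theta>) ` polar_domain K"
  \<comment> \<open>Subtracting \<open>?I\<close> matters for K < 0: there
    \<open>X (pi / sqrt K) 0\<close> has negative radius and is an ordinary point covered by the
    coordinates.\<close>
  show "?I = space_form K - (?F - ?I)"
  proof (intro equalityI subsetI)
    fix y assume y: "y \<in> space_form K - (?F - ?I)"
    then obtain r \<theta> where r: "0 \<le> r" "K > 0 \<longrightarrow> r \<le> pi / sqrt K" "0 \<le> \<theta>" "\<theta> < 2 * pi" "y = X r \<theta>"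
      using X_surj[of y] by blast
    show "y \<in> ?I"
    proof (cases "y \<in> ?F")
      case False
      then have "r \<noteq> 0" using r by auto
      moreover have "X (pi / sqrt K) \<theta> = X (pi / sqrt K) 0" if "K > 0"
        using that by (simp add: X_eq sn_def)
      then have "K > 0 \<Longrightarrow> r \<noteq> pi / sqrt K" using r False by auto
      ultimately have "(r, \<theta>) \<in> polar_domain K" using r by (auto simp: polar_domain_def)
      then show ?thesis using r by force
    qed (use y in blast)
  qed (use X_in in auto)
qed simp

end

text \<open>Agreement on all finite values leaves only the infinite one. This lets volume statements
  about sets of finite measure settle every case.\<close>

lemma ennreal_eqI:
  fixes a b :: ennreal
  assumes "\<And>m. 0 \<le> m \<Longrightarrow> a = ennreal m \<longleftrightarrow> b = ennreal m"
  shows "a = b"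
  using assms by (cases a; cases b) (metis, metis ennreal_neq_top, metis ennreal_neq_top, simp)

text \<open>Both measures are computed by the volume of the cone over a set.\<close>

theorem polar_measure_eq:
  assumes "frame K p e1 e2" "frame K p' e1' e2'"
  shows "frame.polar_measure K p e1 e2 = frame.polar_measure K p' e1' e2'"
proof (rule measure_eqI)
  interpret f: frame K p e1 e2 by fact
  interpret g: frame K p' e1' e2' by fact
  show "sets f.polar_measure = sets g.polar_measure" by simp
  fix E assume "E \<in> sets f.polar_measure"
  then have E [measurable]: "E \<in> sets borel" by simp
  obtain F where F: "finite F" "(\<lambda>(r, \<theta>). f.X r \<theta>) ` polar_domain K = space_form K - F"
    by (rule f.X_image_polar_domain)
  obtain G where G: "finite G" "(\<lambda>(r, \<theta>). g.X r \<theta>) ` polar_domain K = space_form K - G"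
    by (rule g.X_image_polar_domain)
  \<comment> \<open>The part of E that both coordinate systems cover; what is removed consists of
    finitely many points and of points off the surface.\<close>
  let ?E = "E \<inter> (space_form K - (F \<union> G))"
  have [measurable]: "space_form K \<in> sets borel" "F \<union> G \<in> sets borel"
    using closed_space_form[of K] borel_closed[OF finite_imp_closed, of "F \<union> G"] F G by auto
  let ?N = "(E \<inter> space_form K \<inter> (F \<union> G)) \<union> (E - space_form K)"
  have eq: "E = ?E \<union> ?N" and disj: "finite (E \<inter> space_form K \<inter> (F \<union> G))" using F G by auto
  have null: "?N \<in> null_sets M"
    if "\<And>x. emeasure M {x} = 0" "emeasure M (E - space_form K) = 0" "sets M = sets borel" for M :: "(complex \<times> real) measure"
  proof (intro null_sets.Un)
    have "(\<Union>x\<in>E \<inter> space_form K \<inter> (F \<union> G). {x}) \<in> null_sets M"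
      using that disj by (intro null_sets_UN') (auto intro: null_setsI countable_finite)
    then show "E \<inter> space_form K \<inter> (F \<union> G) \<in> null_sets M" by simp
    show "E - space_form K \<in> null_sets M"
      using that by (intro null_setsI) auto
  qed
  have "emeasure f.polar_measure E = emeasure f.polar_measure ?E"
    by (subst eq, rule emeasure_Un_null_set, simp, rule null)
      (use F in \<open>auto simp: f.emeasure_polar_measure_point intro!: f.emeasure_polar_measure_range\<close>)
  moreover have "emeasure g.polar_measure E = emeasure g.polar_measure ?E"
    by (subst eq, rule emeasure_Un_null_set, simp, rule null)
      (use G in \<open>auto simp: g.emeasure_polar_measure_point intro!: g.emeasure_polar_measure_range\<close>)
  moreover have "emeasure f.polar_measure ?E = emeasure g.polar_measure ?E"
  proof -
    let ?c = "\<integral>\<^sup>+t. ennreal (t\<^sup>2 * apex K) * indicator {0<..<1} t \<partial>lborel"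
    have c: "?c = ennreal (1 / 3 * apex K)"
    proof (rule nn_integral_has_integral_lebesgue')
      have "((\<lambda>t. t\<^sup>2 * apex K) has_integral (1 ^ 3 / 3 * apex K - 0 ^ 3 / 3 * apex K)) {0..1}"
        by (intro fundamental_theorem_of_calculus)
          (auto intro!: derivative_eq_intros simp flip: has_real_derivative_iff_has_vector_derivative)
      then show "((\<lambda>t. t\<^sup>2 * apex K) has_integral (1 / 3 * apex K)) {0<..<1}"
        using has_integral_open_interval[of "\<lambda>t. t\<^sup>2 * apex K" _ 0 1] by simp
    qed (use apex_pos[of K] in simp)
    have "?E \<subseteq> (\<lambda>(r, \<theta>). f.X r \<theta>) ` polar_domain K" "?E \<subseteq> (\<lambda>(r, \<theta>). g.X r \<theta>) ` polar_domain K"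
      using F G by auto
    \<comment> \<open>Both equations say that \<open>cone K ?E\<close> is measurable with volume
      m.\<close>
    then have "?c * emeasure f.polar_measure ?E = ennreal m \<longleftrightarrow> ?c * emeasure g.polar_measure ?E = ennreal m" if "0 \<le> m" for m
      using f.emeasure_polar_measure_iff[of ?E m] g.emeasure_polar_measure_iff[of ?E m] that by auto
    then have "?c * emeasure f.polar_measure ?E = ?c * emeasure g.polar_measure ?E"
      by (rule ennreal_eqI)
    then show ?thesis
      using apex_pos[of K] unfolding c by (subst (asm) ennreal_mult_cancel_left) auto
  qed
  ultimately show "emeasure f.polar_measure E = emeasure g.polar_measure E" by simp
qed

section \<open>Convex domains are star-shaped\<close>

text \<open>The vectors whose open ray meets the lifted surface. This set is open, so neighbourhoods
  on the surface can be exchanged for neighbourhoods in the ambient space.\<close>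

definition forward_cone :: "real \<Rightarrow> (complex \<times> real) set" where
  "forward_cone K = (if K > 0 then - {0} else if K = 0 then {z. snd z > 0} else {z. norm (fst z) < snd z})"

text \<open>Radial projection to the surface, followed in the flat case by the return from height 1
  to height 0.\<close>

definition normalise :: "real \<Rightarrow> complex \<times> real \<Rightarrow> complex \<times> real" where
  "normalise K z = (if K = 0 then ((1 / snd z) *\<^sub>R fst z, 0) else (1 / sqrt (K * ambient_form K z z)) *\<^sub>R z)"

lemma open_forward_cone: "open (forward_cone K)"
  unfolding forward_cone_def by (auto intro!: open_Collect_less continuous_intros)

lemma forward_cone_form:
  assumes "z \<in> forward_cone K" "K \<noteq> 0"
  shows "0 < K * ambient_form K z z"
proof (cases "K > 0")
  case True
  then have "ambient_form K z z = (norm z)\<^sup>2"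
    by (cases z) (simp add: ambient_form_def norm_Pair power2_norm_eq_inner power2_eq_square[symmetric])
  then show ?thesis using assms True by (simp add: forward_cone_def)
next
  case False
  then have "(norm (fst z))\<^sup>2 < (snd z)\<^sup>2"
    using assms by (intro power_strict_mono) (auto simp: forward_cone_def)
  then show ?thesis
    using False assms by (simp add: ambient_form_def mult_neg_neg power2_norm_eq_inner power2_eq_square[of "snd z"])
qed

lemma continuous_on_normalise: "continuous_on (forward_cone K) (normalise K)"
proof (cases "K = 0")
  case True
  then show ?thesis
    unfolding normalise_def by (auto intro!: continuous_intros simp: forward_cone_def)
next
  case False
  then have "K * ambient_form K z z \<noteq> 0" if "z \<in> forward_cone K" for z
    using forward_cone_form[OF that \<open>K \<noteq> 0\<close>] by auto
  then show ?thesis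
    using False unfolding normalise_def by (simp add: continuous_intros)
qed

lemma forward_cone_scale: "0 < c \<Longrightarrow> c *\<^sub>R z \<in> forward_cone K \<longleftrightarrow> z \<in> forward_cone K"
  by (auto simp: forward_cone_def zero_less_mult_iff)

lemma lift_forward_cone: "x \<in> space_form K \<Longrightarrow> lift K x \<in> forward_cone K"
proof -
  assume x: "x \<in> space_form K"
  consider "K > 0" | "K = 0" | "K < 0" by linarith
  then show ?thesis
  proof cases
    case 1
    then have "x \<noteq> 0" using x by (auto simp: space_form_iff ambient_form_def)
    then show ?thesis using 1 by (simp add: lift_def forward_cone_def)
  next
    case 3
    then have "ambient_form K x x < 0" "0 < snd x" using x by (simp_all add: space_form_iff)
    then have "(norm (fst x))\<^sup>2 < (snd x)\<^sup>2"
      using 3 by (simp add: ambient_form_def power2_norm_eq_inner power2_eq_square[of "snd x"])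
    then have "norm (fst x) < snd x" using \<open>0 < snd x\<close> by (meson less_imp_le power2_less_imp_less)
    then show ?thesis using 3 by (simp add: lift_def forward_cone_def)
  qed (simp add: lift_def forward_cone_def)
qed

lemma lift_nonflat: "K \<noteq> 0 \<Longrightarrow> lift K x = x"
  by (simp add: lift_def)

lemma normalise_scale: "0 < c \<Longrightarrow> normalise K (c *\<^sub>R z) = normalise K z"
proof -
  assume c: "0 < c"
  have "sqrt (K * (c * (c * f))) = c * sqrt (K * f)" for f
    using c by (simp add: real_sqrt_mult mult.left_commute)
  then show ?thesis using c by (simp add: normalise_def ambient_form_simps)
qed

lemma normalise_lift: "x \<in> space_form K \<Longrightarrow> normalise K (lift K x) = x"
  by (cases "K = 0") (auto simp: normalise_def lift_def prod_eq_iff flat_space_form_iff space_form_iff)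

lemma lift_normalise:
  assumes "z \<in> forward_cone K"
  obtains c where "0 < c" "lift K (normalise K z) = c *\<^sub>R z"
proof (cases "K = 0")
  case True
  then show ?thesis
    using assms that[of "1 / snd z"] by (simp add: normalise_def lift_def prod_eq_iff forward_cone_def)
next
  case False
  then show ?thesis
    using forward_cone_form[OF assms] that[of "1 / sqrt (K * ambient_form K z z)"] by (simp add: normalise_def lift_nonflat)
qed

lemma normalise_in:
  assumes "z \<in> forward_cone K"
  shows "normalise K z \<in> space_form K"
proof (cases "K = 0")
  case True
  then have "normalise K z \<in> space_form 0" by (simp add: normalise_def flat_space_form_iff)
  then show ?thesis using True by simp
next
  case False
  have f: "0 < K * ambient_form K z z" using forward_cone_form[OF assms False] .
  then have "ambient_form K (normalise K z) (normalise K z) = 1 / K"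
    using False by (auto simp: normalise_def ambient_form_simps divide_simps)
  moreover have "snd (normalise K z) > 0" if "K < 0"
  proof -
    have "norm (fst z) < snd z" using assms that by (simp add: forward_cone_def)
    then have "0 < snd z" by (rule le_less_trans[OF norm_ge_zero])
    then show ?thesis using f False by (simp add: normalise_def)
  qed
  ultimately show ?thesis using False by (simp add: space_form_iff)
qed

lemma normalise_eq:
  assumes "x \<in> space_form K" "lift K x = c *\<^sub>R z" "0 < c"
  shows "z \<in> forward_cone K" "normalise K z = x"
  using lift_forward_cone[OF assms(1)] normalise_lift[OF assms(1)] assms
  by (simp_all add: forward_cone_scale normalise_scale)

lemma continuous_on_lift [continuous_intros]:
  "continuous_on S f \<Longrightarrow> continuous_on S (\<lambda>x. lift K (f x))"
  unfolding lift_def by (cases "K = 0") (auto intro!: continuous_intros)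

text \<open>A geodesic stays in the plane spanned by its lifted end points; the coefficients come
  from the addition formula for \<open>sn\<close>. In the flat case it is linear
  interpolation.\<close>

lemma geodesic_interpolation:
  assumes "x \<in> space_form K" "v \<in> unit_tangent K x"
  shows "sn K l *\<^sub>R lift K (geodesic K x v t) = sn K (l - t) *\<^sub>R lift K x + sn K t *\<^sub>R lift K (geodesic K x v l)"
proof (cases "K = 0")
  case True
  then have "snd x = 0" "snd v = 0"
    using assms by (auto simp: flat_space_form_iff unit_tangent_def tangent_space_def)
  then show ?thesis
    using True by (simp add: lift_def geodesic_def cs_def sn_def prod_eq_iff algebra_simps)
next
  case False
  have "sn K l * cs K t = sn K (l - t) + sn K t * cs K l" by (simp add: sn_diff)
  then show ?thesis
    using False by (simp add: lift_nonflat geodesic_def scaleR_add_right scaleR_scaleR mult.commute flip: scaleR_add_left)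
qed

text \<open>Convexity of the cone over D. By \<open>geodesic_interpolation\<close> the ray of a x +
  b y meets the geodesic from x to y wherever the two coefficients are in the ratio a : b. Antipodal
  pairs are excluded because \<open>sn K l\<close> would be 0.\<close>

lemma geodesically_convex_combination:
  assumes D: "D \<subseteq> space_form K" "geodesically_convex K D"
    and xy: "x \<in> D" "y \<in> D" "K > 0 \<Longrightarrow> x \<noteq> - y"
    and ab: "0 \<le> a" "0 \<le> b" "0 < a + b"
  shows "a *\<^sub>R lift K x + b *\<^sub>R lift K y \<in> forward_cone K" (is ?A)
    and "normalise K (a *\<^sub>R lift K x + b *\<^sub>R lift K y) \<in> D" (is ?B)
proof -
  have "\<exists>z\<in>D. \<exists>c>0. lift K z = c *\<^sub>R (a *\<^sub>R lift K x + b *\<^sub>R lift K y)"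
  proof -
    obtain v l where v: "v \<in> unit_tangent K x" and l: "0 \<le> l" "K > 0 \<longrightarrow> l \<le> pi / sqrt K"
      and y: "geodesic K x v l = y" and seg: "\<And>t. t \<in> {0..l} \<Longrightarrow> geodesic K x v t \<in> D"
      using D(2) xy unfolding geodesically_convex_def by blast
    show ?thesis
    proof (cases "l = 0")
      case True
      then have "y = x" using y by (simp add: geodesic_def)
      then have "lift K x = (1 / (a + b)) *\<^sub>R (a *\<^sub>R lift K x + b *\<^sub>R lift K y)"
        using ab by (simp flip: scaleR_add_left)
      then show ?thesis using ab xy by (intro bexI[of _ x] exI[of _ "1 / (a + b)"]) auto
    next
      case False
      have "l \<noteq> pi / sqrt K" if "K > 0"
      proof
        assume "l = pi / sqrt K"
        then have "y = - x" using y that by (auto simp: geodesic_def cs_def sn_def)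
        then show False using xy that by simp
      qed
      then have sl: "sn K l > 0" using sn_pos[of l K] l False by force
      \<comment> \<open>A zero of f is a time at which the coefficients sn (l - t) and sn t are
        proportional to a and b.\<close>
      define f where "f = (\<lambda>t. a * sn K t - b * sn K (l - t))"
      have "continuous_on {0..l} f" unfolding f_def by (intro continuous_intros)
      moreover have "f 0 \<le> 0" "0 \<le> f l" using ab sl by (simp_all add: f_def)
      ultimately obtain t where t: "0 \<le> t" "t \<le> l" "f t = 0" using IVT'[of f 0 0 l] l by blast
      then have eq: "a * sn K t = b * sn K (l - t)" by (simp add: f_def)
      have nn: "0 \<le> sn K t" "0 \<le> sn K (l - t)" using t l by (auto intro!: sn_nonneg)
      have "sn K t \<noteq> 0 \<or> sn K (l - t) \<noteq> 0" using sn_add[of K t "l - t"] sl by auto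
      then have "\<exists>k>0. sn K t = k * b \<and> sn K (l - t) = k * a"
      proof (cases "a > 0")
        case True
        then have "sn K (l - t) \<noteq> 0" using eq \<open>_ \<or> _\<close> by auto
        then show ?thesis using eq nn True
          by (intro exI[of _ "sn K (l - t) / a"]) (auto simp: field_simps)
      next
        case False
        then have "b > 0" "sn K (l - t) = 0" using ab eq by auto
        then show ?thesis using False ab nn \<open>_ \<or> _\<close>
          by (intro exI[of _ "sn K t / b"]) auto
      qed
      then obtain k where k: "k > 0" "sn K t = k * b" "sn K (l - t) = k * a" by blast
      have "sn K l *\<^sub>R lift K (geodesic K x v t) = k *\<^sub>R (a *\<^sub>R lift K x + b *\<^sub>R lift K y)"
        using geodesic_interpolation[OF _ v, of l t] xy D k y by (auto simp: scaleR_add_right)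
      then have "lift K (geodesic K x v t) = (k / sn K l) *\<^sub>R (a *\<^sub>R lift K x + b *\<^sub>R lift K y)"
        using sl by (metis (no_types) divide_inverse_commute less_irrefl scaleR_left_imp_eq scaleR_scaleR nonzero_eq_divide_eq mult.commute)
      then show ?thesis using seg[of t] t k sl
        by (intro bexI[of _ "geodesic K x v t"] exI[of _ "k / sn K l"]) auto
    qed
  qed
  then obtain z c where "z \<in> D" "0 < c" "lift K z = c *\<^sub>R (a *\<^sub>R lift K x + b *\<^sub>R lift K y)" by blast
  then show ?A ?B using normalise_eq[of z K c "a *\<^sub>R lift K x + b *\<^sub>R lift K y"] D by auto
qed

abbreviation rel_interior_of :: "real \<Rightarrow> (complex \<times> real) set \<Rightarrow> (complex \<times> real) set" where
  "rel_interior_of K D \<equiv> top_of_set (space_form K) interior_of D"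

lemma in_rel_interior: "x \<in> rel_interior_of K D \<Longrightarrow> x \<in> D"
  using interior_of_subset[of _ D] by (rule subsetD)

lemma interior_of_iff:
  "x \<in> rel_interior_of K D \<longleftrightarrow> x \<in> space_form K \<and> (\<exists>T. open T \<and> x \<in> T \<and> T \<inter> space_form K \<subseteq> D)"
  unfolding interior_of_def openin_open by auto

text \<open>The cone over a convex set is convex, so a nontrivial combination of a point of \<open>D\<close> with an
  interior point is interior.\<close>

lemma interior_combination:
  assumes D: "D \<subseteq> space_form K" "geodesically_convex K D"
    and xy: "x \<in> D" "y \<in> rel_interior_of K D" "K > 0 \<Longrightarrow> x \<noteq> - y"
  obtains W where "open W" "lift K y \<in> W"
    "\<And>a b z w c. 0 \<le> a \<Longrightarrow> 0 < b \<Longrightarrow> z \<in> W \<Longrightarrow> 0 < c \<Longrightarrow> w \<in> space_form K \<Longrightarrow> c *\<^sub>R lift K w = a *\<^sub>R lift K x + b *\<^sub>R z \<Longrightarrow> w \<in> rel_interior_of K D"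
proof -
  obtain T where T: "open T" "y \<in> T" "T \<inter> space_form K \<subseteq> D" and yM: "y \<in> space_form K"
    using xy(2) unfolding interior_of_iff by blast
  \<comment> \<open>The nonnegative multiples of - x, a closed set; outside it the projected point
    is not antipodal to x.\<close>
  define R where "R = (if K > 0 then {z. norm z *\<^sub>R x = - norm x *\<^sub>R z} else {})"
  define W where "W = (forward_cone K \<inter> normalise K -` T) - R"
  have "closed R" unfolding R_def by (auto intro!: closed_Collect_eq continuous_intros)
  have "open (forward_cone K \<inter> normalise K -` T)"
    using continuous_on_open_vimage[OF open_forward_cone] continuous_on_normalise T by (metis inf_commute)
  then have oW: "open W" unfolding W_def using \<open>closed R\<close> by (rule open_Diff)
  have yW: "lift K y \<in> W"
  proof -
    have "lift K y \<notin> R"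
    proof
      assume r: "lift K y \<in> R"
      then have K: "K > 0" by (auto simp: R_def split: if_splits)
      have "norm x = 1 / sqrt K" "norm y = 1 / sqrt K" using yM D xy K by (auto simp: space_form_def)
      then have "x = - y" using r K by (simp add: R_def lift_nonflat flip: scaleR_minus_right)
      then show False using xy K by simp
    qed
    then show ?thesis using T yM by (simp add: W_def lift_forward_cone normalise_lift)
  qed
  have W: "a *\<^sub>R lift K x + b *\<^sub>R z \<in> forward_cone K \<and> normalise K (a *\<^sub>R lift K x + b *\<^sub>R z) \<in> D"
    if ab: "0 \<le> a" "0 < b" and z: "z \<in> W" for a b z
  proof -
    obtain c where c: "0 < c" "lift K (normalise K z) = c *\<^sub>R z" using z lift_normalise[of z K] by (auto simp: W_def)
    have nD: "normalise K z \<in> D" using z T normalise_in[of z K] by (auto simp: W_def)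
    have "x \<noteq> - normalise K z" if "K > 0"
    proof
      assume "x = - normalise K z"
      then have "z = (1 / c) *\<^sub>R (- x)" using c that by (simp add: lift_nonflat)
      then have "z \<in> R" using c that unfolding R_def by simp
      then show False using z by (simp add: W_def)
    qed
    then show ?thesis
      using geodesically_convex_combination[OF D xy(1) nD, of a "b / c"] ab c by (simp add: add_nonneg_pos)
  qed
  show thesis
  proof (rule that[OF oW yW])
    fix a b z w c assume ab: "0 \<le> a" "0 < b" and z: "z \<in> W" and c: "0 < c" and w: "w \<in> space_form K" "c *\<^sub>R lift K w = a *\<^sub>R lift K x + b *\<^sub>R z"
    \<comment> \<open>Solving the relation for z in terms of the point u: \<open>?h\<close> is
      continuous, so nearby points u are combinations with the same a and b and some z still in W,
      and hence lie in D.\<close>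
    let ?h = "\<lambda>u. (1 / b) *\<^sub>R (c *\<^sub>R lift K u - a *\<^sub>R lift K x)"
    have "open (?h -` W)"
      by (rule open_vimage[OF oW]) (intro continuous_intros)
    moreover have "w \<in> ?h -` W" using w z ab by simp
    moreover have "u \<in> D" if "?h u \<in> W" "u \<in> space_form K" for u
      using W[OF ab that(1)] normalise_lift[OF that(2)] normalise_scale[OF c] ab by simp
    ultimately show "w \<in> rel_interior_of K D"
      unfolding interior_of_iff using w by blast
  qed
qed

lemma (in frame) lift_X_between:
  "sn K r *\<^sub>R lift K (X t \<theta>) = sn K t *\<^sub>R lift K (X r \<theta>) + sn K (r - t) *\<^sub>R lift K p"
  using geodesic_interpolation[OF p unit_tangent_dir, of r \<theta> t] by (simp add: X_def add.commute)

lemma (in frame) X_antipode: "K > 0 \<Longrightarrow> X (pi / sqrt K) \<theta> = - p"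
  by (simp add: X_eq cs_def sn_def)

text \<open>Every point lies on a minimising geodesic from the antipode to a point near the interior point.\<close>

lemma (in frame) antipode_of_interior:
  assumes D: "D \<subseteq> space_form K" "geodesically_convex K D" and K: "K > 0"
    and p_int: "p \<in> rel_interior_of K D" and m: "- p \<in> D"
  shows "D = space_form K"
proof (intro equalityI subsetI)
  fix y assume "y \<in> space_form K"
  then obtain r \<theta> where r: "0 \<le> r" "K > 0 \<longrightarrow> r \<le> pi / sqrt K" "y = X r \<theta>"
    using X_surj by metis
  obtain T where T: "open T" "p \<in> T" "T \<inter> space_form K \<subseteq> D"
    using p_int unfolding interior_of_iff by blast
  show "y \<in> D"
  proof (cases "r = 0 \<or> r = pi / sqrt K")
    case True
    then show ?thesis using T p m K X_antipode r by auto
  next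
    case False
    then have r': "0 < r" "r < pi / sqrt K" using r K by auto
    have "open ((\<lambda>s. X s \<theta>) -` T)"
      using T by (intro open_vimage continuous_intros)
    moreover have "0 \<in> (\<lambda>s. X s \<theta>) -` T" using T by simp
    ultimately obtain d where d: "d > 0" "\<And>s. dist s 0 < d \<Longrightarrow> X s \<theta> \<in> T"
      unfolding open_dist by blast
    define s where "s = min (d / 2) (r / 2)"
    have s: "0 < s" "s < r" "X s \<theta> \<in> T" using d r' by (auto simp: s_def)
    have z: "X s \<theta> \<in> rel_interior_of K D"
      unfolding interior_of_iff using X_in T s by blast
    have sn: "sn K s > 0" "sn K r > 0" "sn K (r - s) \<ge> 0"
      using s r' by (auto intro!: sn_pos sn_nonneg)
    have ne: "- p \<noteq> - X s \<theta>"
      using X_inj(1)[of 0 \<theta> s \<theta>] s r' by auto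
    obtain W where W: "X s \<theta> \<in> W" "\<And>a b z w c. 0 \<le> a \<Longrightarrow> 0 < b \<Longrightarrow> z \<in> W \<Longrightarrow> 0 < c \<Longrightarrow> w \<in> space_form K \<Longrightarrow>
        c *\<^sub>R lift K w = a *\<^sub>R lift K (- p) + b *\<^sub>R z \<Longrightarrow> w \<in> rel_interior_of K D"
      using interior_combination[OF D m z] ne K by (metis lift_nonflat less_irrefl)
    \<comment> \<open>The radial relation at s, solved for X r: y lies between - p and X s on the
      geodesic through p.\<close>
    have "sn K s *\<^sub>R lift K (X r \<theta>) = sn K (r - s) *\<^sub>R lift K (- p) + sn K r *\<^sub>R X s \<theta>"
      using lift_X_between[of r s \<theta>] K by (simp add: lift_nonflat)
    then have "y \<in> rel_interior_of K D"
      unfolding r using W(2)[OF sn(3,2) W(1) sn(1) X_in] by blast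
    then show ?thesis by (rule in_rel_interior)
  qed
qed (use D in blast)

section \<open>The radial function of a star-shaped domain\<close>

locale star_domain = frame +
  fixes D :: "(complex \<times> real) set"
  assumes D_subset: "D \<subseteq> space_form K"
    and compact_D: "compact D"
    and convex_D: "geodesically_convex K D"
    and p_interior: "p \<in> rel_interior_of K D"
    and antipode: "K > 0 \<Longrightarrow> - p \<notin> D"
begin

lemma p_in: "p \<in> D"
  using p_interior by (rule in_rel_interior)

definition radii :: "real \<Rightarrow> real set" where
  "radii \<theta> = {r. 0 \<le> r \<and> (K > 0 \<longrightarrow> r \<le> pi / sqrt K) \<and> X r \<theta> \<in> D}"

definition rho :: "real \<Rightarrow> real" where
  "rho \<theta> = Sup (radii \<theta>)"

lemma radii_less: "r \<in> radii \<theta> \<Longrightarrow> K > 0 \<Longrightarrow> r < pi / sqrt K"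
  using antipode X_antipode[of \<theta>] by (force simp: radii_def less_le)

text \<open>One neighbourhood W of the lifted centre serves all t at once. This uniformity produces
  a cone of fixed opening at a boundary point.\<close>

lemma X_between_interior:
  assumes r: "r \<in> radii \<theta>"
  obtains W where "open W" "lift K p \<in> W" "\<And>t z w c. 0 \<le> t \<Longrightarrow> t < r \<Longrightarrow> z \<in> W \<Longrightarrow> 0 < c \<Longrightarrow> w \<in> space_form K \<Longrightarrow>
      c *\<^sub>R lift K w = sn K t *\<^sub>R lift K (X r \<theta>) + sn K (r - t) *\<^sub>R z \<Longrightarrow> w \<in> rel_interior_of K D"
proof -
  have ne: "X r \<theta> \<noteq> - p" if "K > 0" using r antipode[OF that] by (auto simp: radii_def)
  have sn: "sn K t \<ge> 0" "sn K (r - t) > 0" if "0 \<le> t" "t < r" for t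
    using that radii_less[OF r] by (auto intro!: sn_pos sn_nonneg)
  have rD: "X r \<theta> \<in> D" using r by (simp add: radii_def)
  show thesis
  proof (rule interior_combination[OF D_subset convex_D rD p_interior ne])
    fix W assume W: "open W" "lift K p \<in> W" "\<And>a b z w c. 0 \<le> a \<Longrightarrow> 0 < b \<Longrightarrow> z \<in> W \<Longrightarrow> 0 < c \<Longrightarrow>
      w \<in> space_form K \<Longrightarrow> c *\<^sub>R lift K w = a *\<^sub>R lift K (X r \<theta>) + b *\<^sub>R z \<Longrightarrow> w \<in> rel_interior_of K D"
    show thesis by (rule that[OF W(1,2)], rule W(3)[OF sn])
  qed
qed

lemma X_interior:
  assumes r: "r \<in> radii \<theta>" and t: "0 \<le> t" "t < r"
  shows "X t \<theta> \<in> rel_interior_of K D"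
proof -
  obtain W where W: "lift K p \<in> W" "\<And>t z w c. 0 \<le> t \<Longrightarrow> t < r \<Longrightarrow> z \<in> W \<Longrightarrow> 0 < c \<Longrightarrow> w \<in> space_form K \<Longrightarrow>
      c *\<^sub>R lift K w = sn K t *\<^sub>R lift K (X r \<theta>) + sn K (r - t) *\<^sub>R z \<Longrightarrow> w \<in> rel_interior_of K D"
    using X_between_interior[OF r] by metis
  have "sn K r > 0" using radii_less[OF r] t by (auto intro!: sn_pos)
  then show ?thesis using W(2)[OF t W(1) _ X_in] lift_X_between by blast
qed

lemma radii_props: "0 \<in> radii \<theta>" "closed (radii \<theta>)" "bdd_above (radii \<theta>)"
proof -
  show "0 \<in> radii \<theta>" using p_in by (simp add: radii_def)
  have "radii \<theta> = {0..} \<inter> {r. K > 0 \<longrightarrow> r \<le> pi / sqrt K} \<inter> (\<lambda>r. X r \<theta>) -` D"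
    by (auto simp: radii_def)
  then show "closed (radii \<theta>)"
    using compact_D compact_imp_closed
    by (auto intro!: closed_Int closed_vimage continuous_intros closed_Collect_imp closed_Collect_le open_Collect_const)
  show "bdd_above (radii \<theta>)"
  proof (cases "K > 0")
    case True
    then show ?thesis by (auto simp: radii_def)
  next
    case False
    have "bdd_above (chord K p ` D)"
      by (intro bounded_imp_bdd_above compact_imp_bounded compact_continuous_image compact_D continuous_intros)
    then obtain B where B: "\<And>x. x \<in> D \<Longrightarrow> chord K p x \<le> B"
      unfolding bdd_above_def by auto
    have "r \<le> sqrt (2 * B)" if "r \<in> radii \<theta>" for r
    proof -
      have "r\<^sup>2 / 2 \<le> B"
        using vers_ge_square[of K r] False B[of "X r \<theta>"] that by (auto simp: radii_def chord_p_X)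
      then show ?thesis by (intro real_le_rsqrt) simp
    qed
    then show ?thesis unfolding bdd_above_def by blast
  qed
qed

lemma rho_in: "rho \<theta> \<in> radii \<theta>"
  unfolding rho_def using radii_props[of \<theta>] by (intro closed_contains_Sup) auto

lemma le_rho: "r \<in> radii \<theta> \<Longrightarrow> r \<le> rho \<theta>"
  unfolding rho_def using radii_props by (intro cSup_upper) auto

lemma X_in_iff:
  assumes "0 \<le> r" "K > 0 \<Longrightarrow> r \<le> pi / sqrt K"
  shows "X r \<theta> \<in> D \<longleftrightarrow> r \<le> rho \<theta>"
proof
  assume "r \<le> rho \<theta>"
  then consider "r = rho \<theta>" | "r < rho \<theta>" by linarith
  then show "X r \<theta> \<in> D"
    using rho_in[of \<theta>] X_interior[OF rho_in, of r \<theta>] assms in_rel_interior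
    by cases (auto simp: radii_def)
qed (use assms le_rho in \<open>auto simp: radii_def\<close>)

lemma rho_less: "K > 0 \<Longrightarrow> rho \<theta> < pi / sqrt K"
  using rho_in[of \<theta>] antipode X_antipode[of \<theta>] by (force simp: radii_def less_le)

lemma X_interior_open:
  assumes "X r \<theta> \<in> rel_interior_of K D"
  shows "\<forall>\<^sub>F s in at r. X s \<theta> \<in> D" "\<forall>\<^sub>F \<phi> in at \<theta>. X r \<phi> \<in> D"
proof -
  obtain T where T: "open T" "X r \<theta> \<in> T" "T \<inter> space_form K \<subseteq> D"
    using assms unfolding interior_of_iff by blast
  have "isCont (\<lambda>s. X s \<theta>) r" "isCont (\<lambda>\<phi>. X r \<phi>) \<theta>"
    unfolding X_eq dir_def by (intro continuous_intros isCont_o2[OF _ DERIV_isCont[OF DERIV_cs]] isCont_o2[OF _ DERIV_isCont[OF DERIV_sn]])+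
  then have "\<forall>\<^sub>F s in at r. X s \<theta> \<in> T" "\<forall>\<^sub>F \<phi> in at \<theta>. X r \<phi> \<in> T"
    using T by (auto simp: isCont_def intro: topological_tendstoD)
  then show "\<forall>\<^sub>F s in at r. X s \<theta> \<in> D" "\<forall>\<^sub>F \<phi> in at \<theta>. X r \<phi> \<in> D"
    using T X_in by (auto elim!: eventually_mono)
qed

lemma rho_not_interior: "X (rho \<theta>) \<theta> \<notin> rel_interior_of K D"
proof
  assume "X (rho \<theta>) \<theta> \<in> rel_interior_of K D"
  then have "\<forall>\<^sub>F s in at_right (rho \<theta>). X s \<theta> \<in> D"
    using X_interior_open(1) unfolding eventually_at_split by blast
  \<comment> \<open>On the sphere, \<open>rho_less\<close> leaves room to move outwards while
    staying in the range of radii where \<open>X_in_iff\<close> applies.\<close>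
  moreover have "\<forall>\<^sub>F s in at_right (rho \<theta>). rho \<theta> < s \<and> (K > 0 \<longrightarrow> s < pi / sqrt K)"
  proof (cases "K > 0")
    case True
    then show ?thesis
      using eventually_at_right_less[of "rho \<theta>"] eventually_at_right_field[of _ "rho \<theta>"] rho_less[of \<theta>]
      by (auto simp: eventually_at_right_field intro!: exI[of _ "pi / sqrt K"])
  qed (simp add: eventually_at_right_less)
  ultimately have "\<forall>\<^sub>F s in at_right (rho \<theta>). False"
  proof eventually_elim
    case (elim s)
    moreover have "0 \<le> rho \<theta>" using rho_in by (simp add: radii_def)
    ultimately show False using X_in_iff[of s \<theta>] by auto
  qed
  then show False by simp
qed

lemma X_interior_iff:
  assumes "0 \<le> r" "K > 0 \<Longrightarrow> r \<le> pi / sqrt K"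
  shows "X r \<theta> \<in> rel_interior_of K D \<longleftrightarrow> r < rho \<theta>"
proof
  assume i: "X r \<theta> \<in> rel_interior_of K D"
  then have "r \<le> rho \<theta>" using X_in_iff[OF assms] in_rel_interior by blast
  moreover have "r \<noteq> rho \<theta>" using i rho_not_interior by auto
  ultimately show "r < rho \<theta>" by simp
qed (use X_interior[OF rho_in] assms in blast)

lemma rho_pos: "0 < rho \<theta>"
  using X_interior_iff[of 0 \<theta>] p_interior by simp

lemma sn_rho_pos: "0 < sn K (rho \<theta>)"
  using rho_pos rho_less by (rule sn_pos)

lemma rho_cis:
  assumes "cis \<theta> = cis \<phi>"
  shows "rho \<theta> = rho \<phi>"
  unfolding rho_def radii_def X_cis[OF assms] ..

lemma rho_periodic: "rho (\<theta> + 2 * pi) = rho \<theta>"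
  by (rule rho_cis) (simp add: complex_eq_iff)

lemma boundary_diff: "boundary K D = D - rel_interior_of K D"
proof -
  have "closedin (top_of_set (space_form K)) D"
    using D_subset compact_imp_closed[OF compact_D] by (rule closed_subset)
  then show ?thesis by (simp add: boundary_def frontier_of_def closure_of_closedin)
qed

lemma boundary_eq: "boundary K D = range (\<lambda>\<theta>. X (rho \<theta>) \<theta>)"
proof -
  show ?thesis
  proof (intro equalityI subsetI)
    fix y assume "y \<in> boundary K D"
    then have y: "y \<in> D" "y \<notin> rel_interior_of K D" using boundary_diff by auto
    then obtain r \<theta> where r: "0 \<le> r" "K > 0 \<longrightarrow> r \<le> pi / sqrt K" "y = X r \<theta>"
      using X_surj D_subset by (metis subsetD)
    then show "y \<in> range (\<lambda>\<theta>. X (rho \<theta>) \<theta>)"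
      using y X_in_iff[of r \<theta>] X_interior_iff[of r \<theta>] by auto
  next
    fix y assume "y \<in> range (\<lambda>\<theta>. X (rho \<theta>) \<theta>)"
    then show "y \<in> boundary K D"
      using boundary_diff rho_not_interior rho_in by (auto simp: radii_def)
  qed
qed

text \<open>Below the radius points are interior, an open condition; above it they lie outside the
  closed set D, again an open condition.\<close>

lemma isCont_rho: "isCont rho \<theta>"
  unfolding isCont_def
proof (rule order_tendstoI)
  fix a assume a: "a < rho \<theta>"
  show "\<forall>\<^sub>F \<phi> in at \<theta>. a < rho \<phi>"
  proof -
    obtain r where r: "a < r" "r < rho \<theta>" "0 \<le> r"
      using dense[of "max a 0" "rho \<theta>"] a rho_pos[of \<theta>] by auto
    have rK: "K > 0 \<Longrightarrow> r \<le> pi / sqrt K" using r rho_less[of \<theta>] by simp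
    have "\<forall>\<^sub>F \<phi> in at \<theta>. X r \<phi> \<in> D"
      using X_interior_iff[of r \<theta>] r rK X_interior_open(2) by blast
    then show ?thesis using r rK X_in_iff[of r] by (auto elim!: eventually_mono)
  qed
next
  fix a assume a: "rho \<theta> < a"
  \<comment> \<open>The cut at pi / sqrt K keeps r a legitimate radius on the sphere.\<close>
  define r where "r = (if K > 0 then min a (pi / sqrt K) else a)"
  have r: "rho \<theta> < r" "r \<le> a" "0 \<le> r" "K > 0 \<Longrightarrow> r \<le> pi / sqrt K"
    using a rho_less[of \<theta>] rho_pos[of \<theta>] by (auto simp: r_def)
  have "isCont (\<lambda>\<phi>. X r \<phi>) \<theta>" unfolding X_eq dir_def by (intro continuous_intros)
  moreover have "open (- D)" using compact_D compact_imp_closed by auto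
  moreover have "X r \<theta> \<in> - D" using r X_in_iff[of r \<theta>] by auto
  ultimately have "\<forall>\<^sub>F \<phi> in at \<theta>. X r \<phi> \<in> - D"
    unfolding isCont_def by (rule topological_tendstoD)
  then show "\<forall>\<^sub>F \<phi> in at \<theta>. rho \<phi> < a"
  proof (rule eventually_mono)
    fix \<phi> assume "X r \<phi> \<in> - D"
    then show "rho \<phi> < a" using X_in_iff[OF r(3,4), of \<phi>] r(2) by simp
  qed
qed

end

section \<open>Regularity of the radial function\<close>

text \<open>The solution \<rho> is already given and continuous, so only its differentiability is at
  stake: linearise G at the point, first with a crude error to get a Lipschitz bound, then with an
  arbitrary one.\<close>

lemma implicit_derivative:
  fixes G :: "real \<times> real \<Rightarrow> real" and \<rho> :: "real \<Rightarrow> real"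
  assumes G: "(G has_derivative (\<lambda>h. A * fst h + B * snd h)) (at (\<rho> t, t))" and A: "A \<noteq> 0"
    and \<rho>: "isCont \<rho> t" and zero: "\<forall>\<^sub>F s in nhds t. G (\<rho> s, s) = 0"
  shows "(\<rho> has_real_derivative - B / A) (at t)"
proof -
  \<comment> \<open>The Lipschitz constant obtained from error |A| / 2: half of the term |A| |\<rho>
    s - \<rho> t| is absorbed on the left.\<close>
  define C where "C = (\<bar>B\<bar> + \<bar>A\<bar> / 2) / (\<bar>A\<bar> / 2)"
  have C: "C \<ge> 0" by (simp add: C_def)
  have G0: "G (\<rho> t, t) = 0" using eventually_nhds_x_imp_x[OF zero] .
  have key: "\<exists>d>0. \<forall>s. dist s t < d \<longrightarrow> \<bar>A * (\<rho> s - \<rho> t) + B * (s - t)\<bar> \<le> e * (\<bar>\<rho> s - \<rho> t\<bar> + \<bar>s - t\<bar>)"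
    if "e > 0" for e
  proof -
    obtain d where d: "d > 0" "\<And>y. norm (y - (\<rho> t, t)) < d \<Longrightarrow>
        norm (G y - G (\<rho> t, t) - (A * fst (y - (\<rho> t, t)) + B * snd (y - (\<rho> t, t)))) \<le> e * norm (y - (\<rho> t, t))"
      using G \<open>e > 0\<close> unfolding has_derivative_within_alt by auto
    have "isCont (\<lambda>s. (\<rho> s, s)) t" using \<rho> by (intro continuous_intros)
    then have "\<forall>\<^sub>F s in nhds t. dist (\<rho> s, s) (\<rho> t, t) < d"
      unfolding continuous_at_eps_delta eventually_nhds_metric using d(1) by blast
    with zero have "\<forall>\<^sub>F s in nhds t. \<bar>A * (\<rho> s - \<rho> t) + B * (s - t)\<bar> \<le> e * (\<bar>\<rho> s - \<rho> t\<bar> + \<bar>s - t\<bar>)"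
    proof eventually_elim
      case (elim s)
      have "\<bar>A * (\<rho> s - \<rho> t) + B * (s - t)\<bar> \<le> e * norm ((\<rho> s, s) - (\<rho> t, t))"
        using d(2)[of "(\<rho> s, s)"] elim G0 by (simp add: dist_norm abs_minus_commute)
      also have "\<dots> \<le> e * (\<bar>\<rho> s - \<rho> t\<bar> + \<bar>s - t\<bar>)"
        using that norm_Pair_le[of "\<rho> s - \<rho> t" "s - t"] by (intro mult_left_mono) auto
      finally show ?case .
    qed
    then show ?thesis by (simp add: eventually_nhds_metric)
  qed
  obtain d0 where d0: "d0 > 0" "\<And>s. dist s t < d0 \<Longrightarrow> \<bar>A * (\<rho> s - \<rho> t) + B * (s - t)\<bar> \<le> \<bar>A\<bar> / 2 * (\<bar>\<rho> s - \<rho> t\<bar> + \<bar>s - t\<bar>)"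
    using key[of "\<bar>A\<bar> / 2"] A by auto
  have lip: "\<bar>\<rho> s - \<rho> t\<bar> \<le> C * \<bar>s - t\<bar>" if "dist s t < d0" for s
  proof -
    have "\<bar>A\<bar> * \<bar>\<rho> s - \<rho> t\<bar> - \<bar>B\<bar> * \<bar>s - t\<bar> \<le> \<bar>A * (\<rho> s - \<rho> t) + B * (s - t)\<bar>"
      unfolding abs_mult[symmetric] by linarith
    then have "\<bar>A\<bar> / 2 * \<bar>\<rho> s - \<rho> t\<bar> \<le> (\<bar>B\<bar> + \<bar>A\<bar> / 2) * \<bar>s - t\<bar>"
      using d0(2)[OF that] by (simp add: algebra_simps)
    then show ?thesis using A by (simp add: C_def field_simps)
  qed
  have "\<exists>d>0. \<forall>s. \<bar>s - t\<bar> < d \<longrightarrow> \<bar>\<rho> s - \<rho> t - (- B / A) * (s - t)\<bar> \<le> e * \<bar>s - t\<bar>" if "e > 0" for e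
  proof -
    define e' where "e' = e * \<bar>A\<bar> / (1 + C)"
    have e': "e' > 0" using that A C by (simp add: e'_def)
    obtain d where d: "d > 0" "\<And>s. dist s t < d \<Longrightarrow> \<bar>A * (\<rho> s - \<rho> t) + B * (s - t)\<bar> \<le> e' * (\<bar>\<rho> s - \<rho> t\<bar> + \<bar>s - t\<bar>)"
      using key[OF e'] by auto
    have "\<bar>\<rho> s - \<rho> t - (- B / A) * (s - t)\<bar> \<le> e * \<bar>s - t\<bar>" if s: "\<bar>s - t\<bar> < min d d0" for s
    proof -
      have "A * (\<rho> s - \<rho> t - (- B / A) * (s - t)) = A * (\<rho> s - \<rho> t) + B * (s - t)"
        using A by (simp add: field_simps)
      then have "\<bar>A\<bar> * \<bar>\<rho> s - \<rho> t - (- B / A) * (s - t)\<bar> = \<bar>A * (\<rho> s - \<rho> t) + B * (s - t)\<bar>"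
        by (metis abs_mult)
      also have "\<dots> \<le> e' * (\<bar>\<rho> s - \<rho> t\<bar> + \<bar>s - t\<bar>)" using d(2)[of s] s by (simp add: dist_real_def)
      also have "\<dots> \<le> e' * (C * \<bar>s - t\<bar> + \<bar>s - t\<bar>)" using lip[of s] s e' by (intro mult_left_mono) (auto simp: dist_real_def)
      also have "\<dots> = e' * (1 + C) * \<bar>s - t\<bar>" by (simp add: algebra_simps)
      also have "e' * (1 + C) = \<bar>A\<bar> * e" using C by (simp add: e'_def)
      finally have "\<bar>A\<bar> * \<bar>\<rho> s - \<rho> t - (- B / A) * (s - t)\<bar> \<le> \<bar>A\<bar> * (e * \<bar>s - t\<bar>)" by (simp only: mult.assoc)
      moreover have "\<bar>A\<bar> > 0" using A by simp
      ultimately show ?thesis by (simp only: mult_le_cancel_left_pos)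
    qed
    then show ?thesis using d d0 by (intro exI[of _ "min d d0"]) auto
  qed
  then show ?thesis
    unfolding has_field_derivative_def has_derivative_within_alt
    by (auto simp: bounded_linear_mult_right)
qed

context frame
begin

text \<open>The r-derivative of X. Together with \<open>ndir\<close>, the \<theta>-derivative
  divided by \<open>sn K r\<close>, it is an orthonormal basis of the tangent plane at X r
  \<theta>.\<close>

definition Xr :: "real \<Rightarrow> real \<Rightarrow> complex \<times> real" where
  "Xr r \<theta> = (- K * sn K r) *\<^sub>R p + cs K r *\<^sub>R dir \<theta>"

definition ndir :: "real \<Rightarrow> complex \<times> real" where
  "ndir \<theta> = - sin \<theta> *\<^sub>R e1 + cos \<theta> *\<^sub>R e2"

lemma has_derivative_X:
  assumes "(f has_derivative f') (at x within S)" "(g has_derivative g') (at x within S)"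
  shows "((\<lambda>x. X (f x) (g x)) has_derivative (\<lambda>h. f' h *\<^sub>R Xr (f x) (g x) + (g' h * sn K (f x)) *\<^sub>R ndir (g x))) (at x within S)"
  unfolding X_eq dir_def
  by (rule derivative_eq_intros assms refl)+
    (simp add: fun_eq_iff Xr_def ndir_def dir_def scaleR_add_right scaleR_add_left algebra_simps)

lemma has_vector_derivative_X:
  assumes "(f has_real_derivative f') (at t within S)" "(g has_real_derivative g') (at t within S)"
  shows "((\<lambda>t. X (f t) (g t)) has_vector_derivative f' *\<^sub>R Xr (f t) (g t) + (g' * sn K (f t)) *\<^sub>R ndir (g t)) (at t within S)"
proof -
  have "((\<lambda>t. X (f t) (g t)) has_derivative (\<lambda>h. (f' * h) *\<^sub>R Xr (f t) (g t) + (g' * h * sn K (f t)) *\<^sub>R ndir (g t))) (at t within S)"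
    using assms by (intro has_derivative_X) (simp_all add: has_field_derivative_def)
  then show ?thesis
    unfolding has_vector_derivative_def
    by (rule has_derivative_eq_rhs) (simp add: fun_eq_iff scaleR_add_right mult_ac)
qed

lemma frame_form:
  "ambient_form K (dir \<theta>) (ndir \<theta>) = 0" "ambient_form K (ndir \<theta>) (dir \<theta>) = 0" "ambient_form K (ndir \<theta>) (ndir \<theta>) = 1"
  "K \<noteq> 0 \<Longrightarrow> ambient_form K p (ndir \<theta>) = 0" "K \<noteq> 0 \<Longrightarrow> ambient_form K (ndir \<theta>) p = 0"
  by (simp_all add: dir_def ndir_def ambient_form_simps e11 e12 e21 e22 pe ep power2_eq_square[symmetric])

lemma Xr_form:
  "ambient_form K (Xr r \<theta>) (Xr r \<theta>) = 1" "ambient_form K (Xr r \<theta>) (ndir \<theta>) = 0" "ambient_form K (ndir \<theta>) (Xr r \<theta>) = 0"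
proof -
  have 1: "ambient_form K (dir \<theta>) (dir \<theta>) = 1" by (simp add: dir_dir)
  show "ambient_form K (Xr r \<theta>) (Xr r \<theta>) = 1"
  proof (cases "K = 0")
    case True
    then show ?thesis unfolding Xr_def ambient_form_simps 1 by (simp add: cs_def)
  next
    case False
    then show ?thesis
      using cs_sn_sq[of K r] by (simp add: Xr_def ambient_form_simps 1 p_dir pp power2_eq_square algebra_simps)
  qed
  show "ambient_form K (Xr r \<theta>) (ndir \<theta>) = 0" "ambient_form K (ndir \<theta>) (Xr r \<theta>) = 0"
    unfolding Xr_def ambient_form_simps frame_form using frame_form(4,5)[of \<theta>] by auto
qed

lemma tangent_space_X:
  assumes v: "v \<in> tangent_space K (X r \<theta>)"
  shows "v = ambient_form K v (Xr r \<theta>) *\<^sub>R Xr r \<theta> + ambient_form K v (ndir \<theta>) *\<^sub>R ndir \<theta>"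
proof -
  \<comment> \<open>The residual w is orthogonal to X, \<open>Xr\<close> and \<open>ndir\<close>,
    hence to p, e1 and e2; in the flat case it is also horizontal. The expansion in the frame then
    gives w = 0.\<close>
  define w where "w = v - ambient_form K v (Xr r \<theta>) *\<^sub>R Xr r \<theta> - ambient_form K v (ndir \<theta>) *\<^sub>R ndir \<theta>"
  have w: "ambient_form K w (Xr r \<theta>) = 0" "ambient_form K w (ndir \<theta>) = 0"
    by (simp_all add: w_def ambient_form_simps Xr_form frame_form)
  have wX: "ambient_form K w (X r \<theta>) = 0" if "K \<noteq> 0"
  proof -
    have "ambient_form K v (X r \<theta>) = 0" using v that by (simp add: tangent_space_def ambient_form_commute)
    moreover have "ambient_form K (Xr r \<theta>) (X r \<theta>) = 0" "ambient_form K (ndir \<theta>) (X r \<theta>) = 0"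
      using that by (simp_all add: Xr_def X_eq ambient_form_simps p_dir pp frame_form dir_dir)
    ultimately show ?thesis by (simp add: w_def ambient_form_simps)
  qed
  have d: "dir \<theta> = cs K r *\<^sub>R Xr r \<theta> + (K * sn K r) *\<^sub>R X r \<theta>"
  proof -
    have "cs K r *\<^sub>R Xr r \<theta> + (K * sn K r) *\<^sub>R X r \<theta> = ((cs K r)\<^sup>2 + K * (sn K r)\<^sup>2) *\<^sub>R dir \<theta>"
      by (simp add: Xr_def X_eq scaleR_add_right scaleR_add_left power2_eq_square algebra_simps)
    then show ?thesis by (simp add: cs_sn_sq)
  qed
  have pX: "p = cs K r *\<^sub>R X r \<theta> - sn K r *\<^sub>R Xr r \<theta>"
  proof -
    have "cs K r *\<^sub>R X r \<theta> - sn K r *\<^sub>R Xr r \<theta> = ((cs K r)\<^sup>2 + K * (sn K r)\<^sup>2) *\<^sub>R p"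
      by (simp add: Xr_def X_eq scaleR_add_right scaleR_add_left power2_eq_square algebra_simps)
    then show ?thesis by (simp add: cs_sn_sq)
  qed
  have wd: "ambient_form K w (dir \<theta>) = 0"
    unfolding d ambient_form_simps w using wX by (cases "K = 0") simp_all
  have wp: "K * ambient_form K w p = 0"
    using arg_cong[OF pX, of "ambient_form K w"] wX w unfolding ambient_form_simps by auto
  have "e1 = cos \<theta> *\<^sub>R dir \<theta> - sin \<theta> *\<^sub>R ndir \<theta>" "e2 = sin \<theta> *\<^sub>R dir \<theta> + cos \<theta> *\<^sub>R ndir \<theta>"
  proof -
    have "cos \<theta> *\<^sub>R dir \<theta> - sin \<theta> *\<^sub>R ndir \<theta> = ((cos \<theta>)\<^sup>2 + (sin \<theta>)\<^sup>2) *\<^sub>R e1"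
      "sin \<theta> *\<^sub>R dir \<theta> + cos \<theta> *\<^sub>R ndir \<theta> = ((cos \<theta>)\<^sup>2 + (sin \<theta>)\<^sup>2) *\<^sub>R e2"
      by (simp_all only: dir_def ndir_def scaleR_add_right scaleR_add_left power2_eq_square) (simp_all add: algebra_simps)
    then show "e1 = cos \<theta> *\<^sub>R dir \<theta> - sin \<theta> *\<^sub>R ndir \<theta>" "e2 = sin \<theta> *\<^sub>R dir \<theta> + cos \<theta> *\<^sub>R ndir \<theta>" by simp_all
  qed
  then have we: "ambient_form K w e1 = 0" "ambient_form K w e2 = 0"
    using wd w by (metis ambient_form_simps(4,6) diff_self mult_zero_right, metis ambient_form_simps(2,6) add_0 mult_zero_right)
  have "snd w = 0" if "K = 0"
  proof -
    have "snd v = 0" using v that by (auto simp: tangent_space_def)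
    moreover have "snd (Xr r \<theta>) = 0" "snd (ndir \<theta>) = 0"
      using flat[OF that] flat_pX[OF that] that unfolding Xr_def ndir_def by simp_all
    ultimately show ?thesis unfolding w_def by simp
  qed
  from expand[OF this] have "w = 0" using wp we by simp
  then show ?thesis by (simp add: w_def algebra_simps)
qed

end

section \<open>Transversality of the boundary and the radius\<close>

lemma abs_cos_diff: "\<bar>cos x - cos y\<bar> \<le> \<bar>x - y\<bar>" and abs_sin_diff: "\<bar>sin x - sin y\<bar> \<le> \<bar>x - y\<bar>" for x y :: real
proof -
  have "norm (cos x - cos y) \<le> 1 * norm (x - y)"
    by (rule field_differentiable_bound[where S = UNIV and f' = "\<lambda>x. - sin x"]) (auto intro!: derivative_eq_intros)
  then show "\<bar>cos x - cos y\<bar> \<le> \<bar>x - y\<bar>" by simp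
  have "norm (sin x - sin y) \<le> 1 * norm (x - y)"
    by (rule field_differentiable_bound[where S = UNIV and f' = cos]) (auto intro!: derivative_eq_intros)
  then show "\<bar>sin x - sin y\<bar> \<le> \<bar>x - y\<bar>" by simp
qed

lemma (in frame) norm_dir_diff: "norm (dir \<phi> - dir \<theta>) \<le> (norm e1 + norm e2) * \<bar>\<phi> - \<theta>\<bar>"
proof -
  have "dir \<phi> - dir \<theta> = (cos \<phi> - cos \<theta>) *\<^sub>R e1 + (sin \<phi> - sin \<theta>) *\<^sub>R e2"
    by (simp add: dir_def algebra_simps)
  then have "norm (dir \<phi> - dir \<theta>) \<le> \<bar>cos \<phi> - cos \<theta>\<bar> * norm e1 + \<bar>sin \<phi> - sin \<theta>\<bar> * norm e2"
    by (metis norm_scaleR norm_triangle_ineq)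
  also have "\<dots> \<le> \<bar>\<phi> - \<theta>\<bar> * norm e1 + \<bar>\<phi> - \<theta>\<bar> * norm e2"
    by (intro add_mono mult_right_mono abs_cos_diff abs_sin_diff) auto
  finally show ?thesis by (simp add: algebra_simps)
qed

lemma eventually_sn_ge_half: "\<forall>\<^sub>F t in at_right 0. t / 2 \<le> sn K t"
proof -
  have "((\<lambda>h. (sn K (0 + h) - sn K 0) / h) \<longlongrightarrow> 1) (at 0)"
    using DERIV_sn[of K 0] unfolding DERIV_def by simp
  then have "\<forall>\<^sub>F t in at 0. 1 / 2 < sn K t / t" by (auto dest: order_tendstoD(1)[of _ _ _ "1/2"])
  then have "\<forall>\<^sub>F t in at_right 0. 1 / 2 < sn K t / t" unfolding eventually_at_split by blast
  moreover have "\<forall>\<^sub>F t::real in at_right 0. 0 < t" by (rule eventually_at_right_less)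
  ultimately show ?thesis by eventually_elim (simp add: field_simps)
qed

context star_domain
begin

text \<open>Turning the radius from \<theta> to \<phi> shifts the lifted point by sn times dir
  \<phi> - dir \<theta>. The shift can be charged to the centre, whose coefficient in the
  combination is sn \<tau>, and W tolerates it when the angle is at most a small multiple of
  \<tau>.\<close>

lemma cone_at_boundary:
  obtains \<alpha> where "0 < \<alpha>"
    "\<forall>\<^sub>F \<tau> in at_right 0. \<forall>\<phi>. \<bar>\<phi> - \<theta>\<bar> \<le> \<alpha> * \<tau> \<longrightarrow> X (rho \<theta> - \<tau>) \<phi> \<in> rel_interior_of K D"
proof -
  let ?s = "sn K (rho \<theta>)"
  obtain W where W: "open W" "lift K p \<in> W" "\<And>t z w c. 0 \<le> t \<Longrightarrow> t < rho \<theta> \<Longrightarrow> z \<in> W \<Longrightarrow> 0 < c \<Longrightarrow> w \<in> space_form K \<Longrightarrow>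
      c *\<^sub>R lift K w = sn K t *\<^sub>R lift K (X (rho \<theta>) \<theta>) + sn K (rho \<theta> - t) *\<^sub>R z \<Longrightarrow> w \<in> rel_interior_of K D"
    using X_between_interior[OF rho_in] by metis
  obtain \<eta> where \<eta>: "\<eta> > 0" "ball (lift K p) \<eta> \<subseteq> W" using W(1,2) open_contains_ball by blast
  \<comment> \<open>Collects the bounds sn (rho - \<tau>) < s + 1, 1 / sn \<tau> \<le> 2 / \<tau>
    and the Lipschitz constant of \<open>dir\<close>; then \<alpha> = \<eta> / (M + 1) keeps the
    displacement below \<eta>.\<close>
  define M where "M = 2 * ?s * (?s + 1) * (norm e1 + norm e2)"
  have s: "?s > 0" by (rule sn_rho_pos)
  have M: "M \<ge> 0" using s by (simp add: M_def)
  define \<alpha> where "\<alpha> = \<eta> / (M + 1)"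
  have \<alpha>: "\<alpha> > 0" using \<eta> M by (simp add: \<alpha>_def)
  have "((\<lambda>\<tau>. sn K (rho \<theta> - \<tau>)) \<longlongrightarrow> sn K (rho \<theta> - 0)) (at_right 0)"
    by (intro isCont_tendsto_compose[OF DERIV_isCont[OF DERIV_sn]] tendsto_intros)
  then have e1: "\<forall>\<^sub>F \<tau> in at_right 0. sn K (rho \<theta> - \<tau>) < ?s + 1" by (auto dest: order_tendstoD(2)[of _ _ _ "?s + 1"])
  have e2: "\<forall>\<^sub>F \<tau> in at_right 0. 0 < \<tau> \<and> \<tau> < rho \<theta>"
    using rho_pos[of \<theta>] by (auto simp: eventually_at_right_field intro!: exI[of _ "rho \<theta>"])
  from e1 e2 eventually_sn_ge_half[of K]
  have "\<forall>\<^sub>F \<tau> in at_right 0. \<forall>\<phi>. \<bar>\<phi> - \<theta>\<bar> \<le> \<alpha> * \<tau> \<longrightarrow> X (rho \<theta> - \<tau>) \<phi> \<in> rel_interior_of K D"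
  proof eventually_elim
    case (elim \<tau>)
    show ?case
    proof (intro allI impI)
      fix \<phi> assume \<phi>: "\<bar>\<phi> - \<theta>\<bar> \<le> \<alpha> * \<tau>"
      let ?t = "rho \<theta> - \<tau>"
      let ?d = "(?s * sn K ?t / sn K \<tau>) *\<^sub>R (dir \<phi> - dir \<theta>)"
      have sn: "0 < sn K \<tau>" "\<tau> / 2 \<le> sn K \<tau>" using elim by auto
      have st: "0 \<le> sn K ?t" using elim rho_less[of \<theta>] by (intro sn_nonneg) auto
      have "norm ?d = ?s * sn K ?t / sn K \<tau> * norm (dir \<phi> - dir \<theta>)" using s sn st by simp
      also have "\<dots> \<le> ?s * (?s + 1) / (\<tau> / 2) * ((norm e1 + norm e2) * (\<alpha> * \<tau>))"
        using s sn st elim \<phi> order_trans[OF norm_dir_diff[of \<phi> \<theta>] mult_left_mono[OF \<phi>]]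
        by (intro mult_mono frac_le) auto
      also have "\<dots> = M * \<alpha>" using elim by (simp add: M_def)
      also have "\<dots> < \<eta>" using \<eta> M by (simp add: \<alpha>_def field_simps)
      finally have "norm ?d < \<eta>" .
      then have "lift K p + ?d \<in> ball (lift K p) \<eta>" by (simp only: mem_ball dist_norm) (simp add: norm_minus_commute)
      then have "lift K p + ?d \<in> W" by (rule subsetD[OF \<eta>(2)])
      moreover have "?s *\<^sub>R lift K (X ?t \<phi>) = sn K ?t *\<^sub>R lift K (X (rho \<theta>) \<theta>) + sn K (rho \<theta> - ?t) *\<^sub>R (lift K p + ?d)"
      proof -
        have "lift K (X ?t \<phi>) = lift K (X ?t \<theta>) + sn K ?t *\<^sub>R (dir \<phi> - dir \<theta>)"
          by (simp add: lift_X scaleR_diff_right)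
        then show ?thesis
          using lift_X_between[of "rho \<theta>" ?t \<theta>] sn by (simp add: scaleR_add_right)
      qed
      ultimately show "X ?t \<phi> \<in> rel_interior_of K D"
        using W(3)[of ?t "lift K p + ?d" ?s "X ?t \<phi>"] elim s X_in by simp
    qed
  qed
  then show thesis using \<alpha> that by blast
qed

text \<open>If f were stationary in the radial direction, its angular derivative would be nonzero,
  because the two directions span the tangent plane. Then f would have opposite signs at the ends of
  short arcs across the interior cone, and a zero of f on such an arc would be a boundary point
  inside the interior.\<close>

lemma transversal:
  fixes f :: "complex \<times> real \<Rightarrow> real" and f' :: "complex \<times> real \<Rightarrow> (complex \<times> real) \<Rightarrow>\<^sub>L real"
  assumes U: "open U" "X (rho \<theta>) \<theta> \<in> U" and f: "\<And>x. x \<in> U \<Longrightarrow> (f has_derivative blinfun_apply (f' x)) (at x)"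
    and v: "v \<in> tangent_space K (X (rho \<theta>) \<theta>)" "blinfun_apply (f' (X (rho \<theta>) \<theta>)) v \<noteq> 0"
    and S: "boundary K D \<inter> U = {x \<in> space_form K \<inter> U. f x = 0}"
  shows "blinfun_apply (f' (X (rho \<theta>) \<theta>)) (Xr (rho \<theta>) \<theta>) \<noteq> 0"
proof
  define F where "F = blinfun_apply (f' (X (rho \<theta>) \<theta>))"
  assume "blinfun_apply (f' (X (rho \<theta>) \<theta>)) (Xr (rho \<theta>) \<theta>) = 0"
  then have A: "F (Xr (rho \<theta>) \<theta>) = 0" by (simp add: F_def)
  define B where "B = sn K (rho \<theta>) * F (ndir \<theta>)"
  have "F v = ambient_form K v (Xr (rho \<theta>) \<theta>) * F (Xr (rho \<theta>) \<theta>) + ambient_form K v (ndir \<theta>) * F (ndir \<theta>)"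
    by (subst tangent_space_X[OF v(1)]) (simp add: F_def blinfun.add_right blinfun.scaleR_right)
  then have B: "B \<noteq> 0" using v(2) A sn_rho_pos[of \<theta>] by (auto simp: B_def F_def)
  have f0: "f (X (rho \<theta>) \<theta>) = 0" using S U(2) boundary_eq by blast
  obtain \<alpha> where \<alpha>: "0 < \<alpha>" and cone: "\<forall>\<^sub>F \<tau> in at_right 0. \<forall>\<phi>. \<bar>\<phi> - \<theta>\<bar> \<le> \<alpha> * \<tau> \<longrightarrow> X (rho \<theta> - \<tau>) \<phi> \<in> rel_interior_of K D"
    by (rule cone_at_boundary)
  \<comment> \<open>f along the edge of slope \<sigma> of the cone; the radial contribution
    vanishes, so only the sign of \<sigma> B matters to first order.\<close>
  define g where "g = (\<lambda>\<sigma> \<tau>. f (X (rho \<theta> - \<tau>) (\<theta> + \<sigma> * \<tau>)))"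
  have dg: "(g \<sigma> has_real_derivative \<sigma> * B) (at 0)" for \<sigma>
  proof -
    have "((\<lambda>\<tau>. X (rho \<theta> - \<tau>) (\<theta> + \<sigma> * \<tau>)) has_derivative
        (\<lambda>h. (- h) *\<^sub>R Xr (rho \<theta> - 0) (\<theta> + \<sigma> * 0) + (\<sigma> * h * sn K (rho \<theta> - 0)) *\<^sub>R ndir (\<theta> + \<sigma> * 0))) (at 0)"
      by (rule has_derivative_X) (auto intro!: derivative_eq_intros)
    then have "((\<lambda>\<tau>. f (X (rho \<theta> - \<tau>) (\<theta> + \<sigma> * \<tau>))) has_derivative
        (\<lambda>h. F ((- h) *\<^sub>R Xr (rho \<theta> - 0) (\<theta> + \<sigma> * 0) + (\<sigma> * h * sn K (rho \<theta> - 0)) *\<^sub>R ndir (\<theta> + \<sigma> * 0)))) (at 0)"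
      unfolding F_def by (rule has_derivative_compose) (use f[OF U(2)] in simp)
    then show ?thesis
      unfolding g_def has_field_derivative_def
      by (rule has_derivative_eq_rhs) (use A in \<open>simp add: fun_eq_iff B_def F_def blinfun.diff_right blinfun.add_right blinfun.scaleR_right blinfun.minus_right\<close>)
  qed
  have sign: "\<forall>\<^sub>F \<tau> in at_right 0. 0 < \<sigma> * B * g \<sigma> \<tau>" if "\<sigma> \<noteq> 0" for \<sigma>
  proof -
    have "((\<lambda>h. (g \<sigma> (0 + h) - g \<sigma> 0) / h) \<longlongrightarrow> \<sigma> * B) (at 0)"
      using dg[of \<sigma>] unfolding DERIV_def .
    moreover have "g \<sigma> 0 = 0" by (simp add: g_def f0)
    ultimately have "((\<lambda>h. \<sigma> * B * (g \<sigma> h / h)) \<longlongrightarrow> \<sigma> * B * (\<sigma> * B)) (at 0)"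
      by (intro tendsto_intros) simp
    moreover have "0 < \<sigma> * B * (\<sigma> * B)" using that B by (metis mult_eq_0_iff not_real_square_gt_zero)
    ultimately have "\<forall>\<^sub>F h in at 0. 0 < \<sigma> * B * (g \<sigma> h / h)" by (rule order_tendstoD(1))
    then have "\<forall>\<^sub>F h in at_right 0. 0 < \<sigma> * B * (g \<sigma> h / h)" unfolding eventually_at_split by blast
    moreover have "\<forall>\<^sub>F t::real in at_right 0. 0 < t" by (rule eventually_at_right_less)
    ultimately show ?thesis by eventually_elim (simp add: zero_less_divide_iff)
  qed
  have inU: "\<forall>\<^sub>F \<tau> in at_right 0. \<forall>\<phi>. \<bar>\<phi> - \<theta>\<bar> \<le> \<alpha> * \<tau> \<longrightarrow> X (rho \<theta> - \<tau>) \<phi> \<in> U"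
  proof -
    have "open ((\<lambda>x. X (fst x) (snd x)) -` U)" using U(1) by (intro open_vimage continuous_intros)
    moreover have "(rho \<theta>, \<theta>) \<in> (\<lambda>x. X (fst x) (snd x)) -` U" using U(2) by simp
    ultimately obtain d where d: "d > 0" "ball (rho \<theta>, \<theta>) d \<subseteq> (\<lambda>x. X (fst x) (snd x)) -` U"
      using open_contains_ball by blast
    have "\<forall>\<^sub>F \<tau> in at_right 0. 0 < \<tau> \<and> \<tau> < d / (1 + \<alpha>)"
      using d \<alpha> by (auto simp: eventually_at_right_field intro!: exI[of _ "d / (1 + \<alpha>)"])
    then show ?thesis
    proof eventually_elim
      case (elim \<tau>)
      show ?case
      proof (intro allI impI)
        fix \<phi> assume "\<bar>\<phi> - \<theta>\<bar> \<le> \<alpha> * \<tau>"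
        then have "norm (- \<tau>, \<phi> - \<theta>) \<le> \<tau> + \<alpha> * \<tau>"
          using norm_Pair_le[of "- \<tau>" "\<phi> - \<theta>"] elim by simp
        also have "\<dots> < d" using elim \<alpha> by (simp add: field_simps)
        finally have "(rho \<theta> - \<tau>, \<phi>) \<in> ball (rho \<theta>, \<theta>) d"
          by (simp add: dist_norm norm_Pair power2_commute)
        then show "X (rho \<theta> - \<tau>) \<phi> \<in> U" using d(2) by auto
      qed
    qed
  qed
  have "\<forall>\<^sub>F t::real in at_right 0. 0 < t" by (rule eventually_at_right_less)
  moreover have "\<forall>\<^sub>F \<tau> in at_right 0. 0 < \<alpha> * B * g \<alpha> \<tau>" "\<forall>\<^sub>F \<tau> in at_right 0. 0 < - \<alpha> * B * g (- \<alpha>) \<tau>"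
    using sign[of \<alpha>] sign[of "- \<alpha>"] \<alpha> by auto
  ultimately have "\<forall>\<^sub>F \<tau>::real in at_right 0. False"
    using cone inU
  proof eventually_elim
    case (elim \<tau>)
    have cont: "continuous_on {\<theta> - \<alpha> * \<tau>..\<theta> + \<alpha> * \<tau>} (\<lambda>\<phi>. f (X (rho \<theta> - \<tau>) \<phi>))"
    proof (rule continuous_on_compose2[of U f])
      show "continuous_on U f" using f has_derivative_continuous continuous_at_imp_continuous_on by blast
      show "(\<lambda>\<phi>. X (rho \<theta> - \<tau>) \<phi>) ` {\<theta> - \<alpha> * \<tau>..\<theta> + \<alpha> * \<tau>} \<subseteq> U"
        using elim by (force simp: abs_le_iff)
    qed (intro continuous_intros)
    have "\<exists>\<phi>\<in>{\<theta> - \<alpha> * \<tau>..\<theta> + \<alpha> * \<tau>}. f (X (rho \<theta> - \<tau>) \<phi>) = 0"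
    proof (cases "B > 0")
      case True
      then have "g (- \<alpha>) \<tau> \<le> 0" "0 \<le> g \<alpha> \<tau>" using elim \<alpha> by (auto simp: zero_less_mult_iff mult_less_0_iff)
      then show ?thesis
        using IVT'[OF _ _ _ cont, of 0] elim \<alpha> by (force simp: g_def)
    next
      case False
      then have "g \<alpha> \<tau> \<le> 0" "0 \<le> g (- \<alpha>) \<tau>" using elim \<alpha> B by (auto simp: zero_less_mult_iff mult_less_0_iff)
      then show ?thesis
        using IVT2'[OF _ _ _ cont, of 0] elim \<alpha> by (force simp: g_def)
    qed
    then obtain \<phi> where "\<phi> \<in> {\<theta> - \<alpha> * \<tau>..\<theta> + \<alpha> * \<tau>}" and \<phi>0: "f (X (rho \<theta> - \<tau>) \<phi>) = 0" by blast
    then have \<phi>: "\<bar>\<phi> - \<theta>\<bar> \<le> \<alpha> * \<tau>" by (auto simp: abs_le_iff)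
    then have "X (rho \<theta> - \<tau>) \<phi> \<in> boundary K D" "X (rho \<theta> - \<tau>) \<phi> \<in> rel_interior_of K D"
      using S elim \<phi>0 X_in by auto
    then show False using boundary_diff by blast
  qed
  then show False by simp
qed

lemma rho_C1:
  assumes "C1_submanifold K (boundary K D)"
  obtains \<rho>' where "\<And>\<theta>. (rho has_real_derivative \<rho>' \<theta>) (at \<theta>)" "continuous_on UNIV \<rho>'"
proof -
  have local: "\<exists>g. (\<forall>\<^sub>F t in nhds \<theta>. (rho has_real_derivative g t) (at t)) \<and> isCont g \<theta>" for \<theta>
  proof -
    have bd: "X (rho \<theta>) \<theta> \<in> boundary K D" unfolding boundary_eq by blast
    obtain U f f' v where U: "open U" "X (rho \<theta>) \<theta> \<in> U"
      and f: "\<And>x. x \<in> U \<Longrightarrow> (f has_derivative blinfun_apply (f' x)) (at x)"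
      and cf: "continuous_on U (f' :: complex \<times> real \<Rightarrow> (complex \<times> real) \<Rightarrow>\<^sub>L real)"
      and v: "v \<in> tangent_space K (X (rho \<theta>) \<theta>)" "blinfun_apply (f' (X (rho \<theta>) \<theta>)) v \<noteq> 0"
      and S: "boundary K D \<inter> U = {x \<in> space_form K \<inter> U. f x = 0}"
      using bspec[OF conjunct2[OF assms[unfolded C1_submanifold_def]] bd] by blast
    define A where "A = (\<lambda>t. blinfun_apply (f' (X (rho t) t)) (Xr (rho t) t))"
    define B where "B = (\<lambda>t. blinfun_apply (f' (X (rho t) t)) (sn K (rho t) *\<^sub>R ndir t))"
    have contX: "isCont (\<lambda>t. X (rho t) t) t" for t
      unfolding X_eq dir_def
      by (intro continuous_intros isCont_o2[OF isCont_rho DERIV_isCont[OF DERIV_cs]] isCont_o2[OF isCont_rho DERIV_isCont[OF DERIV_sn]])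
    have contXr: "isCont (\<lambda>t. Xr (rho t) t) t" "isCont (\<lambda>t. sn K (rho t) *\<^sub>R ndir t) t" for t
      unfolding Xr_def dir_def ndir_def
      by (intro continuous_intros isCont_o2[OF isCont_rho DERIV_isCont[OF DERIV_cs]] isCont_o2[OF isCont_rho DERIV_isCont[OF DERIV_sn]])+
    have cf': "isCont (\<lambda>t. f' (X (rho t) t)) \<theta>"
      by (rule isCont_o2[OF contX]) (use cf U in \<open>simp add: continuous_on_eq_continuous_at\<close>)
    have cAB: "isCont A \<theta>" "isCont B \<theta>"
      unfolding A_def B_def by (intro blinfun.continuous cf' contXr)+
    have A0: "A \<theta> \<noteq> 0" unfolding A_def by (rule transversal[OF U f v S])
    have evA: "\<forall>\<^sub>F t in nhds \<theta>. A t \<noteq> 0"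
    proof -
      have "\<forall>\<^sub>F t in at \<theta>. A t \<noteq> 0" using cAB(1) A0 unfolding isCont_def by (rule tendsto_imp_eventually_ne)
      then show ?thesis using A0 by (simp add: eventually_nhds_conv_at)
    qed
    have evU: "\<forall>\<^sub>F t in nhds \<theta>. X (rho t) t \<in> U"
    proof -
      have "\<forall>\<^sub>F t in at \<theta>. X (rho t) t \<in> U" using contX[of \<theta>] U unfolding isCont_def by (rule topological_tendstoD)
      then show ?thesis using U by (simp add: eventually_nhds_conv_at)
    qed
    \<comment> \<open>The formula is proved for all t near \<theta>, not just at \<theta>, so that
      the continuity of - B / A carries over to the derivative of \<open>rho\<close>.\<close>
    have "\<forall>\<^sub>F t in nhds \<theta>. (rho has_real_derivative - B t / A t) (at t)"
      using evA eventually_eventually[THEN iffD2, OF evU] evU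
    proof eventually_elim
      case (elim t)
      show ?case
      proof (rule implicit_derivative[where G = "\<lambda>x. f (X (fst x) (snd x))"])
        have "((\<lambda>x. X (fst x) (snd x)) has_derivative (\<lambda>h. fst h *\<^sub>R Xr (fst (rho t, t)) (snd (rho t, t)) +
            (snd h * sn K (fst (rho t, t))) *\<^sub>R ndir (snd (rho t, t)))) (at (rho t, t))"
          by (intro has_derivative_X derivative_intros)
        then have "((\<lambda>x. f (X (fst x) (snd x))) has_derivative (\<lambda>h. blinfun_apply (f' (X (rho t) t))
            (fst h *\<^sub>R Xr (rho t) t + (snd h * sn K (rho t)) *\<^sub>R ndir t))) (at (rho t, t))"
          using has_derivative_compose[OF _ f] elim by fastforce
        then show "((\<lambda>x. f (X (fst x) (snd x))) has_derivative (\<lambda>h. A t * fst h + B t * snd h)) (at (rho t, t))"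
          by (rule has_derivative_eq_rhs) (simp add: fun_eq_iff A_def B_def blinfun.add_right blinfun.scaleR_right)
        show "\<forall>\<^sub>F s in nhds t. f (X (fst (rho s, s)) (snd (rho s, s))) = 0"
          using elim(2)
        proof (rule eventually_mono)
          fix s assume "X (rho s) s \<in> U"
          moreover have "X (rho s) s \<in> boundary K D" unfolding boundary_eq by blast
          ultimately show "f (X (fst (rho s, s)) (snd (rho s, s))) = 0" using S by auto
        qed
      qed (use elim isCont_rho in auto)
    qed
    moreover have "isCont (\<lambda>t. - B t / A t) \<theta>" using cAB A0 by (intro continuous_intros)
    ultimately show ?thesis by (intro exI[of _ "\<lambda>t. - B t / A t"] conjI)
  qed
  define \<rho>' where "\<rho>' = deriv rho"
  have d: "(rho has_real_derivative \<rho>' \<theta>) (at \<theta>)" for \<theta>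
    using local[of \<theta>] eventually_nhds_x_imp_x unfolding \<rho>'_def by (metis DERIV_imp_deriv)
  have "isCont \<rho>' \<theta>" for \<theta>
  proof -
    obtain g where g: "\<forall>\<^sub>F t in nhds \<theta>. (rho has_real_derivative g t) (at t)" "isCont g \<theta>" using local by blast
    have "\<forall>\<^sub>F t in nhds \<theta>. g t = \<rho>' t"
      using g(1) by (rule eventually_mono) (use d DERIV_unique in blast)
    then show ?thesis using g(2) isCont_cong by blast
  qed
  then show thesis using that[OF d] by (simp add: continuous_at_imp_continuous_on)
qed

end

section \<open>Curves in the boundary\<close>

text \<open>Integrate the logarithmic derivative: w' = \<zeta>' / \<zeta> makes \<zeta> exp (- w)
  constant, so Im w plus the initial argument is a continuously differentiable angle.\<close>

lemma angle_lift:
  fixes \<zeta> \<zeta>' :: "real \<Rightarrow> complex"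
  assumes d: "\<And>t. t \<in> {0..1} \<Longrightarrow> (\<zeta> has_vector_derivative \<zeta>' t) (at t within {0..1})"
    and c: "continuous_on {0..1} \<zeta>'" and nz: "\<And>t. t \<in> {0..1} \<Longrightarrow> \<zeta> t \<noteq> 0"
  obtains \<theta> \<theta>' where "0 \<le> \<theta> 0" "\<theta> 0 < 2 * pi"
    "\<And>t. t \<in> {0..1} \<Longrightarrow> (\<theta> has_real_derivative \<theta>' t) (at t within {0..1})"
    "continuous_on {0..1} \<theta>'" "\<And>t. t \<in> {0..1} \<Longrightarrow> \<zeta> t = norm (\<zeta> t) * cis (\<theta> t)"
proof -
  define q where "q = (\<lambda>t. \<zeta>' t / \<zeta> t)"
  define w where "w = (\<lambda>t. integral {0..t} q)"
  have c\<zeta>: "continuous_on {0..1} \<zeta>" using d by (rule continuous_on_vector_derivative)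
  have cq: "continuous_on {0..1} q" unfolding q_def using c c\<zeta> nz by (intro continuous_intros) auto
  have dw: "(w has_vector_derivative q t) (at t within {0..1})" if "t \<in> {0..1}" for t
    unfolding w_def by (rule integral_has_vector_derivative[OF cq that])
  have "((\<lambda>t. \<zeta> t * exp (- w t)) has_vector_derivative 0) (at t within {0..1})" if t: "t \<in> {0..1}" for t
  proof -
    have "((\<lambda>t. - w t) has_vector_derivative - q t) (at t within {0..1})"
      by (intro derivative_intros dw t)
    then have "((exp \<circ> (\<lambda>t. - w t)) has_vector_derivative - q t * exp (- w t)) (at t within {0..1})"
      by (rule field_vector_diff_chain_within) (auto intro: DERIV_subset[OF DERIV_exp])
    from has_vector_derivative_mult[OF d[OF t] this]
    show ?thesis using nz[OF t] by (simp add: o_def q_def)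
  qed
  then obtain k where k: "\<And>t. t \<in> {0..1} \<Longrightarrow> \<zeta> t * exp (- w t) = k"
    using has_vector_derivative_zero_constant[of "{0..1}" "\<lambda>t. \<zeta> t * exp (- w t)"] by auto
  have "w 0 = 0" by (simp add: w_def)
  then have "k = \<zeta> 0" using k[of 0] by simp
  then have \<zeta>: "\<zeta> t = \<zeta> 0 * exp (w t)" if "t \<in> {0..1}" for t
    using k[OF that] by (simp add: exp_minus field_simps)
  define \<theta> where "\<theta> = (\<lambda>t. Arg2pi (\<zeta> 0) + Im (w t))"
  show thesis
  proof (rule that[of \<theta> "\<lambda>t. Im (q t)"])
    show "0 \<le> \<theta> 0" "\<theta> 0 < 2 * pi" using \<open>w 0 = 0\<close> Arg2pi_ge_0 Arg2pi_lt_2pi by (simp_all add: \<theta>_def)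
    show "continuous_on {0..1} (\<lambda>t. Im (q t))" by (intro continuous_intros cq)
    fix t :: real assume t: "t \<in> {0..1}"
    have "((\<lambda>t. Im (w t)) has_vector_derivative Im (q t)) (at t within {0..1})"
      by (rule bounded_linear.has_vector_derivative[OF bounded_linear_Im dw[OF t]])
    then show "(\<theta> has_real_derivative Im (q t)) (at t within {0..1})"
      unfolding \<theta>_def has_real_derivative_iff_has_vector_derivative
      using has_vector_derivative_add[OF has_vector_derivative_const[of "Arg2pi (\<zeta> 0)"]] by fastforce
    have "\<zeta> t = of_real (norm (\<zeta> 0)) * cis (Arg2pi (\<zeta> 0)) * (of_real (exp (Re (w t))) * cis (Im (w t)))"
    proof -
      have "\<zeta> 0 = of_real (norm (\<zeta> 0)) * cis (Arg2pi (\<zeta> 0))"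
        using Arg2pi_eq[of "\<zeta> 0"] by (simp add: cis_conv_exp)
      then show ?thesis using \<zeta>[OF t] unfolding exp_eq_polar[of "w t"] by metis
    qed
    also have "\<dots> = of_real (norm (\<zeta> 0) * exp (Re (w t))) * cis (\<theta> t)"
      by (simp add: \<theta>_def mult_ac flip: cis_mult)
    also have "norm (\<zeta> 0) * exp (Re (w t)) = norm (\<zeta> t)"
      by (simp add: \<zeta>[OF t] norm_mult norm_exp_eq_Re)
    finally show "\<zeta> t = norm (\<zeta> t) * cis (\<theta> t)" .
  qed
qed

lemma integral_period_shift:
  fixes f :: "real \<Rightarrow> real"
  assumes f: "continuous_on UNIV f" "\<And>x. f (x + P) = f x" and a: "0 \<le> a" "a \<le> P"
  shows "integral {a..a + P} f = integral {0..P} f" "integral {a - P..a} f = integral {0..P} f"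
proof -
  have i: "f integrable_on {x..y}" for x y
    using f(1) by (auto intro: integrable_continuous_interval continuous_on_subset)
  have s: "integral {x + P..y + P} f = integral {x..y} f" for x y
    using integral_shift_Icc_real[of x y f P] f(2) by (simp add: o_def add.commute)
  have "integral {a..a + P} f = integral {a..P} f + integral {P..a + P} f"
    using a i by (intro Henstock_Kurzweil_Integration.integral_combine[symmetric]) auto
  also have "integral {P..a + P} f = integral {0..a} f" using s[of 0 a] by simp
  also have "integral {a..P} f + integral {0..a} f = integral {0..P} f"
    using a i Henstock_Kurzweil_Integration.integral_combine[of 0 a P f] by simp
  finally show 1: "integral {a..a + P} f = integral {0..P} f" .
  show "integral {a - P..a} f = integral {0..P} f" using 1 s[of "a - P" a] by simp
qed

lemma cis_eq_imp: "cis a = cis b \<Longrightarrow> \<exists>k::int. a = b + 2 * pi * k"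
  by (metis cis.sel complex_eq_iff sin_cos_eq_iff mult.commute mult.assoc)

lemma (in frame) Xr_ndir_form:
  "ambient_form K (a *\<^sub>R Xr r \<theta> + b *\<^sub>R ndir \<theta>) (a *\<^sub>R Xr r \<theta> + b *\<^sub>R ndir \<theta>) = a\<^sup>2 + b\<^sup>2"
  by (simp add: ambient_form_simps Xr_form frame_form power2_eq_square)

section \<open>Length of closed curves in the boundary\<close>

locale smooth_star_domain = star_domain +
  fixes rho' :: "real \<Rightarrow> real"
  assumes DERIV_rho: "\<And>\<theta>. (rho has_real_derivative rho' \<theta>) (at \<theta>)"
    and continuous_rho': "continuous_on UNIV rho'"
begin

definition speed :: "real \<Rightarrow> real" where
  "speed \<theta> = sqrt ((rho' \<theta>)\<^sup>2 + (sn K (rho \<theta>))\<^sup>2)"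

lemma continuous_on_rho [continuous_intros]:
  assumes "continuous_on S g"
  shows "continuous_on S (\<lambda>x. rho (g x))" "continuous_on S (\<lambda>x. rho' (g x))" "continuous_on S (\<lambda>x. speed (g x))"
proof -
  have "continuous_on UNIV rho" using isCont_rho by (simp add: continuous_at_imp_continuous_on)
  then show 1: "continuous_on S (\<lambda>x. rho (g x))" "continuous_on S (\<lambda>x. rho' (g x))"
    using continuous_rho' assms by (auto intro: continuous_on_compose2)
  show "continuous_on S (\<lambda>x. speed (g x))" unfolding speed_def by (intro continuous_intros 1)
qed

lemma rho'_periodic: "rho' (\<theta> + 2 * pi) = rho' \<theta>"
proof -
  have "((\<lambda>t. rho (t + 2 * pi)) has_real_derivative rho' (\<theta> + 2 * pi)) (at \<theta>)"
    by (rule DERIV_chain2[OF DERIV_rho, where Db = 1, simplified]) (auto intro!: derivative_eq_intros)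
  then show ?thesis unfolding rho_periodic using DERIV_rho DERIV_unique by blast
qed

lemma speed_periodic: "speed (\<theta> + 2 * pi) = speed \<theta>"
  by (simp add: speed_def rho_periodic rho'_periodic)

lemma speed_nonneg: "0 \<le> speed \<theta>"
  by (simp add: speed_def)

lemma curve_derivative:
  assumes "(\<theta> has_real_derivative \<theta>') (at t within S)"
  shows "((\<lambda>t. X (rho (\<theta> t)) (\<theta> t)) has_vector_derivative
    (\<theta>' * rho' (\<theta> t)) *\<^sub>R Xr (rho (\<theta> t)) (\<theta> t) + (\<theta>' * sn K (rho (\<theta> t))) *\<^sub>R ndir (\<theta> t)) (at t within S)"
  using has_vector_derivative_X[OF DERIV_chain2[OF DERIV_rho assms] assms] by (simp add: mult.commute)

lemma curve_speed:
  "sqrt (ambient_form K ((a * rho' \<theta>) *\<^sub>R Xr (rho \<theta>) \<theta> + (a * sn K (rho \<theta>)) *\<^sub>R ndir \<theta>)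
      ((a * rho' \<theta>) *\<^sub>R Xr (rho \<theta>) \<theta> + (a * sn K (rho \<theta>)) *\<^sub>R ndir \<theta>)) = \<bar>a\<bar> * speed \<theta>"
proof -
  have "(a * rho' \<theta>)\<^sup>2 + (a * sn K (rho \<theta>))\<^sup>2 = a\<^sup>2 * ((rho' \<theta>)\<^sup>2 + (sn K (rho \<theta>))\<^sup>2)"
    by (simp add: power_mult_distrib algebra_simps)
  then show ?thesis by (simp add: Xr_ndir_form speed_def real_sqrt_mult)
qed

text \<open>Guarantees that the choice operator in \<open>length_of\<close> returns a genuine
  parametrization.\<close>

lemma boundary_parametrizable: "\<exists>\<Gamma>. parametrizes \<Gamma> (boundary K D)"
proof -
  define \<gamma> where "\<gamma> = (\<lambda>t. X (rho (2 * pi * t)) (2 * pi * t))"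
  define \<gamma>' where "\<gamma>' = (\<lambda>t. (2 * pi * rho' (2 * pi * t)) *\<^sub>R Xr (rho (2 * pi * t)) (2 * pi * t) +
      (2 * pi * sn K (rho (2 * pi * t))) *\<^sub>R ndir (2 * pi * t))"
  have d: "(\<gamma> has_vector_derivative \<gamma>' t) (at t)" for t
    unfolding \<gamma>_def \<gamma>'_def by (rule curve_derivative) (auto intro!: derivative_eq_intros)
  have "continuous_on UNIV \<gamma>'"
    unfolding \<gamma>'_def Xr_def ndir_def dir_def by (intro continuous_intros)
  then have C1: "\<gamma> C1_differentiable_on UNIV"
    unfolding C1_differentiable_on_def using d by blast
  have nz: "vector_derivative \<gamma> (at t) \<noteq> 0" for t
  proof
    assume "vector_derivative \<gamma> (at t) = 0"
    then have "\<gamma>' t = 0" using vector_derivative_at[OF d] by simp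
    then have "2 * pi * speed (2 * pi * t) = 0"
      using curve_speed[of "2 * pi" "2 * pi * t"] ambient_form_simps(5)[of K 0 0 0] by (simp add: \<gamma>'_def)
    then show False using sn_rho_pos[of "2 * pi * t"] by (simp add: speed_def sum_power2_eq_zero_iff)
  qed
  have per: "\<gamma> (t + 1) = \<gamma> t" for t
    using rho_periodic[of "2 * pi * t"] by (simp add: \<gamma>_def distrib_left)
  have inj: "inj_on \<gamma> {0..<1}"
  proof (rule inj_onI)
    fix s t assume st: "s \<in> {0..<1}" "t \<in> {0..<1}" and eq: "\<gamma> s = \<gamma> t"
    have "X (rho (2 * pi * s)) (2 * pi * s) = X (rho (2 * pi * t)) (2 * pi * t)" using eq by (simp add: \<gamma>_def)
    moreover have "(rho (2 * pi * s), 2 * pi * s) \<in> polar_domain K" "(rho (2 * pi * t), 2 * pi * t) \<in> polar_domain K"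
      using st rho_pos rho_less by (auto simp: polar_domain_def)
    ultimately show "s = t" using inj_onD[OF X_inj_on] by fastforce
  qed
  have "range \<gamma> = boundary K D"
  proof -
    have "range \<gamma> = (\<lambda>\<theta>. X (rho \<theta>) \<theta>) ` range (\<lambda>t. 2 * pi * t)" by (simp only: \<gamma>_def image_image)
    also have "range (\<lambda>t. 2 * pi * t) = UNIV"
      by (rule surjI[of _ "\<lambda>x. x / (2 * pi)"]) simp
    finally show ?thesis by (simp add: boundary_eq)
  qed
  then have "parametrizes {\<gamma>} (boundary K D)"
    using C1 nz per inj by (simp add: parametrizes_def simple_closed_C1_curve_def)
  then show ?thesis by blast
qed

text \<open>Along \<gamma> the polar angle changes by 2 pi k, and k \<noteq> 0 by injectivity. The
  length is the integral of |\<theta>'| \<open>speed\<close> \<theta>, at least the absolute value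
  of the signed integral, which by substitution covers a full period.\<close>

lemma curve_length_ge:
  assumes \<gamma>: "simple_closed_C1_curve \<gamma>" "range \<gamma> \<subseteq> boundary K D"
  shows "integral {0..2 * pi} speed \<le> curve_length K \<gamma>"
proof -
  let ?I = "{0..1::real}"
  obtain \<gamma>' where d: "\<And>t. (\<gamma> has_vector_derivative \<gamma>' t) (at t)" and c: "continuous_on UNIV \<gamma>'"
    using \<gamma>(1) unfolding simple_closed_C1_curve_def C1_differentiable_on_def by auto
  \<comment> \<open>Orthogonal projection to the tangent plane at p, read as a complex number. It
    sends X r \<theta> - p to sn r cis \<theta>; subtracting p matters only in the plane, where p
    need not be orthogonal to e1 and e2.\<close>
  define Z where "Z = (\<lambda>y. Complex (ambient_form K y e1) (ambient_form K y e2))"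
  have "linear Z" by (rule linearI) (simp_all add: Z_def ambient_form_simps complex_eq_iff)
  then have Z: "bounded_linear Z" by (simp add: linear_conv_bounded_linear)
  define \<zeta> where "\<zeta> = (\<lambda>t. Z (\<gamma> t - p))"
  have ZX: "Z (X r \<theta> - p) = sn K r * cis \<theta>" for r \<theta>
  proof (cases "K = 0")
    case True
    then have "X r \<theta> - p = sn K r *\<^sub>R dir \<theta>" unfolding X_eq by (simp add: cs_def)
    then show ?thesis
      by (simp add: Z_def complex_eq_iff dir_def ambient_form_simps e11 e12 e21 e22)
  next
    case False
    then show ?thesis
      by (simp add: Z_def complex_eq_iff X_eq dir_def ambient_form_simps e11 e12 e21 e22 pe)
  qed
  have on: "\<exists>\<phi>. \<gamma> t = X (rho \<phi>) \<phi>" for t using \<gamma>(2) unfolding boundary_eq by auto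
  have nz: "\<zeta> t \<noteq> 0" for t
  proof -
    obtain \<phi> where "\<gamma> t = X (rho \<phi>) \<phi>" using on by blast
    then show ?thesis using sn_rho_pos[of \<phi>] by (simp add: \<zeta>_def ZX)
  qed
  have d\<zeta>: "(\<zeta> has_vector_derivative Z (\<gamma>' t)) (at t within ?I)" for t
    unfolding \<zeta>_def
    by (rule bounded_linear.has_vector_derivative[OF Z])
      (auto intro!: derivative_eq_intros has_vector_derivative_at_within[OF d])
  have c\<zeta>: "continuous_on ?I (\<lambda>t. Z (\<gamma>' t))"
    by (intro bounded_linear.continuous_on[OF Z] continuous_on_subset[OF c]) auto
  obtain \<theta> \<theta>' where \<theta>0: "0 \<le> \<theta> 0" "\<theta> 0 < 2 * pi"
    and d\<theta>: "\<And>t. t \<in> ?I \<Longrightarrow> (\<theta> has_real_derivative \<theta>' t) (at t within ?I)"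
    and c\<theta>': "continuous_on ?I \<theta>'" and \<zeta>\<theta>: "\<And>t. t \<in> ?I \<Longrightarrow> \<zeta> t = norm (\<zeta> t) * cis (\<theta> t)"
    using angle_lift[OF d\<zeta> c\<zeta> nz] by metis
  have c\<theta>: "continuous_on ?I \<theta>" using d\<theta> by (rule DERIV_continuous_on)
  have \<gamma>\<theta>: "\<gamma> t = X (rho (\<theta> t)) (\<theta> t)" if t: "t \<in> ?I" for t
  proof -
    obtain \<phi> where \<phi>: "\<gamma> t = X (rho \<phi>) \<phi>" using on by blast
    then have z: "\<zeta> t = sn K (rho \<phi>) * cis \<phi>" by (simp add: \<zeta>_def ZX)
    then have "norm (\<zeta> t) = sn K (rho \<phi>)" using sn_rho_pos[of \<phi>] by (simp add: norm_mult)
    then have "cis \<phi> = cis (\<theta> t)" using \<zeta>\<theta>[OF t] z sn_rho_pos[of \<phi>] by simp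
    then show ?thesis using \<phi> rho_cis X_cis by metis
  qed
  have sp: "sqrt (ambient_form K (vector_derivative \<gamma> (at t)) (vector_derivative \<gamma> (at t))) = \<bar>\<theta>' t\<bar> * speed (\<theta> t)"
    if t: "t \<in> ?I" for t
  proof -
    have "(\<gamma> has_vector_derivative (\<theta>' t * rho' (\<theta> t)) *\<^sub>R Xr (rho (\<theta> t)) (\<theta> t) + (\<theta>' t * sn K (rho (\<theta> t))) *\<^sub>R ndir (\<theta> t)) (at t within ?I)"
      by (rule has_vector_derivative_transform[OF t _ curve_derivative[OF d\<theta>[OF t]]]) (use \<gamma>\<theta> in auto)
    then have "\<gamma>' t = (\<theta>' t * rho' (\<theta> t)) *\<^sub>R Xr (rho (\<theta> t)) (\<theta> t) + (\<theta>' t * sn K (rho (\<theta> t))) *\<^sub>R ndir (\<theta> t)"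
      using vector_derivative_unique_within_closed_interval[of 0 1 t \<gamma>] has_vector_derivative_at_within[OF d] t by auto
    then show ?thesis using vector_derivative_at[OF d] curve_speed by simp
  qed
  have "\<gamma> 1 = \<gamma> 0" using \<gamma>(1) unfolding simple_closed_C1_curve_def by (metis add_0)
  then have "\<zeta> 1 = \<zeta> 0" by (simp add: \<zeta>_def)
  then have "norm (\<zeta> 0) * cis (\<theta> 1) = norm (\<zeta> 0) * cis (\<theta> 0)" using \<zeta>\<theta>[of 0] \<zeta>\<theta>[of 1] by simp
  then have "cis (\<theta> 1) = cis (\<theta> 0)" using nz[of 0] by simp
  then obtain k :: int where k: "\<theta> 1 = \<theta> 0 + 2 * pi * k" using cis_eq_imp by blast
  have inj: "s = t" if "\<theta> s = \<theta> t" "s \<in> {0..<1}" "t \<in> {0..<1}" for s t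
  proof -
    have "\<gamma> s = \<gamma> t" using that \<gamma>\<theta>[of s] \<gamma>\<theta>[of t] by simp
    then show ?thesis using \<gamma>(1) that unfolding simple_closed_C1_curve_def inj_on_def by blast
  qed
  \<comment> \<open>With k = 0 the angle would return to its start, and the value m halfway between
    \<theta> 0 and \<theta> (1/2) would be taken once in each half of the period.\<close>
  have "k \<noteq> 0"
  proof
    assume "k = 0"
    then have e: "\<theta> 1 = \<theta> 0" using k by simp
    define m where "m = (\<theta> 0 + \<theta> (1/2)) / 2"
    have ne: "\<theta> 0 \<noteq> \<theta> (1/2)" using inj[of 0 "1/2"] by auto
    have c1: "continuous_on {0..1/2} \<theta>" and c2: "continuous_on {1/2..1} \<theta>"
      using c\<theta> by (auto intro: continuous_on_subset)
    have "(\<exists>s\<in>{0..1/2}. \<theta> s = m) \<and> (\<exists>t\<in>{1/2..1}. \<theta> t = m)"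
    proof (cases "\<theta> 0 < \<theta> (1/2)")
      case True
      then show ?thesis
        using IVT'[of \<theta> 0 m "1/2"] IVT2'[of \<theta> 1 m "1/2"] c1 c2 e by (fastforce simp: m_def)
    next
      case False
      then show ?thesis
        using IVT2'[of \<theta> "1/2" m 0] IVT'[of \<theta> "1/2" m 1] c1 c2 e ne by (fastforce simp: m_def)
    qed
    then obtain s t where st: "s \<in> {0..1/2}" "t \<in> {1/2..1}" "\<theta> s = m" "\<theta> t = m" by blast
    have m: "m \<noteq> \<theta> 1" "m \<noteq> \<theta> (1/2)" using ne e by (auto simp: m_def)
    have "s \<noteq> 1/2" using m(2) st(3) by metis
    moreover have "t \<noteq> 1" using m(1) st(4) by metis
    ultimately have "s < 1/2" "t < 1" using st by auto
    then show False using inj[of s t] st by auto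
  qed
  have "bounded (\<theta> ` ?I)" by (intro compact_imp_bounded compact_continuous_image c\<theta>) auto
  then obtain B where B: "\<theta> ` ?I \<subseteq> {- B..B}" using bounded_subset_cbox_symmetric[of "\<theta> ` ?I"] by (auto simp: cbox_interval)
  have cs: "continuous_on S speed" for S using continuous_on_rho(3)[of S "\<lambda>x. x"] by simp
  \<comment> \<open>The oriented integral of \<open>speed\<close> from \<theta> 0 to \<theta> 1: one
    of the two intervals is empty.\<close>
  let ?P = "integral {\<theta> 0..\<theta> 1} speed - integral {\<theta> 1..\<theta> 0} speed"
  have sub: "((\<lambda>t. \<theta>' t *\<^sub>R speed (\<theta> t)) has_integral ?P) ?I"
    using has_integral_substitution_general[of "{}" 0 1 \<theta> "- B" B speed \<theta>'] B cs c\<theta> d\<theta> by auto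
  have "integral {0..2 * pi} speed \<le> \<bar>?P\<bar>"
  proof (cases "k > 0")
    case True
    then have "2 * pi * 1 \<le> 2 * pi * real_of_int k" by (intro mult_left_mono) auto
    then have le: "\<theta> 0 + 2 * pi \<le> \<theta> 1" using k by simp
    have "integral {0..2 * pi} speed = integral {\<theta> 0..\<theta> 0 + 2 * pi} speed"
      using integral_period_shift(1)[of speed "2 * pi" "\<theta> 0"] cs speed_periodic \<theta>0 by simp
    also have "\<dots> \<le> integral {\<theta> 0..\<theta> 1} speed"
      using le speed_nonneg by (intro integral_subset_le integrable_continuous_interval cs) auto
    also have "\<dots> \<le> \<bar>?P\<bar>"
    proof -
      have "\<theta> 0 < \<theta> 1" using le pi_gt_zero by linarith
      then show ?thesis by simp
    qed
    finally show ?thesis .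
  next
    case False
    then have "k \<le> -1" using \<open>k \<noteq> 0\<close> by simp
    then have "2 * pi * real_of_int k \<le> 2 * pi * (-1)" by (intro mult_left_mono) auto
    then have le: "\<theta> 1 \<le> \<theta> 0 - 2 * pi" using k by simp
    have "integral {0..2 * pi} speed = integral {\<theta> 0 - 2 * pi..\<theta> 0} speed"
      using integral_period_shift(2)[of speed "2 * pi" "\<theta> 0"] cs speed_periodic \<theta>0 by simp
    also have "\<dots> \<le> integral {\<theta> 1..\<theta> 0} speed"
      using le speed_nonneg by (intro integral_subset_le integrable_continuous_interval cs) auto
    also have "\<dots> \<le> \<bar>?P\<bar>"
    proof -
      have "\<theta> 1 < \<theta> 0" using le pi_gt_zero by linarith
      then show ?thesis by simp
    qed
    finally show ?thesis .
  qed
  also have "\<dots> = norm (integral ?I (\<lambda>t. \<theta>' t * speed (\<theta> t)))" using integral_unique[OF sub] by simp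
  also have "\<dots> \<le> integral ?I (\<lambda>t. \<bar>\<theta>' t\<bar> * speed (\<theta> t))"
    by (intro integral_norm_bound_integral integrable_continuous_interval continuous_intros c\<theta> c\<theta>')
      (simp add: abs_mult speed_nonneg)
  also have "\<dots> = curve_length K \<gamma>"
    unfolding curve_length_def by (rule integral_cong) (simp add: sp)
  finally show ?thesis .
qed

text \<open>A single member of the chosen family is already long enough, and the others have
  nonnegative length by the same estimate.\<close>

lemma length_of_ge: "integral {0..2 * pi} speed \<le> length_of K (boundary K D)"
proof -
  define \<Gamma> where "\<Gamma> = (SOME \<Gamma>. parametrizes \<Gamma> (boundary K D))"
  have \<Gamma>: "parametrizes \<Gamma> (boundary K D)"
    unfolding \<Gamma>_def by (rule someI_ex[OF boundary_parametrizable])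
  have "boundary K D \<noteq> {}" unfolding boundary_eq by simp
  then obtain \<gamma> where \<gamma>: "\<gamma> \<in> \<Gamma>" using \<Gamma> unfolding parametrizes_def by auto
  have ge: "integral {0..2 * pi} speed \<le> curve_length K \<delta>" if "\<delta> \<in> \<Gamma>" for \<delta>
    using \<Gamma> that unfolding parametrizes_def by (intro curve_length_ge) auto
  have nonneg: "0 \<le> integral {0..2 * pi} speed"
    using speed_nonneg by (intro integral_nonneg integrable_continuous_interval continuous_on_rho(3)[of _ "\<lambda>x. x", simplified]) auto
  have "curve_length K \<gamma> \<le> (\<Sum>\<delta>\<in>\<Gamma>. curve_length K \<delta>)"
    using \<Gamma> \<gamma> ge nonneg unfolding parametrizes_def by (intro member_le_sum) (auto intro: order_trans)
  then show ?thesis using ge[OF \<gamma>] by (simp add: length_of_def \<Gamma>_def)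
qed

end

section \<open>Letting the regularisation tend to zero\<close>

lemma chord_nonneg:
  assumes "x \<in> space_form K" "y \<in> space_form K"
  shows "0 \<le> chord K x y"
proof -
  obtain e1 e2 where "frame K x e1 e2" using exists_frame[OF assms(1)] .
  then interpret frame K x e1 e2 .
  obtain r \<theta> where "y = X r \<theta>" using X_surj[OF assms(2)] by metis
  then show ?thesis using chord_p_X vers_nonneg by simp
qed

section \<open>Integrals over the domain in polar coordinates\<close>

context smooth_star_domain
begin

text \<open>The integral of g over D for the area, with the radius rescaled to [0, 1] as in the
  output of \<open>graph_stokes\<close>.\<close>

definition pint :: "(complex \<times> real \<Rightarrow> real) \<Rightarrow> real" where
  "pint g = integral {0..2 * pi} (\<lambda>\<theta>. integral {0..1} (\<lambda>u. sn K (u * rho \<theta>) * g (X (u * rho \<theta>) \<theta>) * rho \<theta>))"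

lemma continuous_on_X_compose:
  fixes S :: "'x::t2_space set"
  assumes "continuous_on (space_form K) g" "continuous_on S a" "continuous_on S b"
  shows "continuous_on S (\<lambda>x. g (X (a x) (b x)))"
  by (rule continuous_on_compose2[OF assms(1)]) (use X_in assms in \<open>auto intro!: continuous_intros\<close>)

lemma continuous_on_inner:
  assumes g: "continuous_on (space_form K) g"
  shows "continuous_on S (\<lambda>\<theta>. integral {0..1} (\<lambda>u. sn K (u * rho \<theta>) * g (X (u * rho \<theta>) \<theta>) * rho \<theta>))"
proof -
  have "continuous_on S (\<lambda>\<theta>. integral (cbox 0 1) (\<lambda>u. sn K (u * rho \<theta>) * g (X (u * rho \<theta>) \<theta>) * rho \<theta>))"
    by (rule integral_continuous_on_param)
      (auto simp: split_def intro!: continuous_intros continuous_on_X_compose[OF g])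
  then show ?thesis by simp
qed

lemma integrand_nonneg:
  assumes "\<And>x. x \<in> space_form K \<Longrightarrow> 0 \<le> g x" "0 \<le> r" "r \<le> rho \<theta>"
  shows "0 \<le> sn K r * g (X r \<theta>)"
  using assms(2,3) rho_less[of \<theta>] assms(1)[OF X_in] by (intro mult_nonneg_nonneg sn_nonneg) auto

lemma inner_nonneg:
  assumes g: "continuous_on (space_form K) g" "\<And>x. x \<in> space_form K \<Longrightarrow> 0 \<le> g x"
  shows "0 \<le> integral {0..1} (\<lambda>u. sn K (u * rho \<theta>) * g (X (u * rho \<theta>) \<theta>) * rho \<theta>)"
proof (rule integral_nonneg)
  show "(\<lambda>u. sn K (u * rho \<theta>) * g (X (u * rho \<theta>) \<theta>) * rho \<theta>) integrable_on {0..1}"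
    by (intro integrable_continuous_interval continuous_intros continuous_on_X_compose[OF g(1)])
  fix u :: real assume u: "u \<in> {0..1}"
  have "0 \<le> sn K (u * rho \<theta>) * g (X (u * rho \<theta>) \<theta>)"
    by (rule integrand_nonneg[OF g(2)]) (use u rho_pos[of \<theta>] in \<open>auto simp: mult_le_cancel_right1\<close>)
  then show "0 \<le> sn K (u * rho \<theta>) * g (X (u * rho \<theta>) \<theta>) * rho \<theta>"
    using rho_pos[of \<theta>] by simp
qed

lemma pint_nonneg:
  assumes g: "continuous_on (space_form K) g" "\<And>x. x \<in> space_form K \<Longrightarrow> 0 \<le> g x"
  shows "0 \<le> pint g"
  unfolding pint_def
  by (intro integral_nonneg integrable_continuous_interval continuous_on_inner inner_nonneg g)

lemma pint_linear:
  assumes "continuous_on (space_form K) f" "continuous_on (space_form K) g"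
  shows "pint (\<lambda>x. a * f x - b * g x) = a * pint f - b * pint g"
proof -
  let ?i = "\<lambda>g \<theta>. integral {0..1} (\<lambda>u. sn K (u * rho \<theta>) * g (X (u * rho \<theta>) \<theta>) * rho \<theta>)"
  have i: "(\<lambda>u. sn K (u * rho \<theta>) * g (X (u * rho \<theta>) \<theta>) * rho \<theta>) integrable_on {0..1}"
    if "continuous_on (space_form K) g" for g \<theta>
    by (intro integrable_continuous_interval continuous_intros continuous_on_X_compose[OF that])
  have "?i (\<lambda>x. a * f x - b * g x) \<theta> = a * ?i f \<theta> - b * ?i g \<theta>" for \<theta>
  proof -
    have "?i (\<lambda>x. a * f x - b * g x) \<theta> = integral {0..1} (\<lambda>u. a * (sn K (u * rho \<theta>) * f (X (u * rho \<theta>) \<theta>) * rho \<theta>) -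
        b * (sn K (u * rho \<theta>) * g (X (u * rho \<theta>) \<theta>) * rho \<theta>))"
      by (simp add: algebra_simps)
    also have "\<dots> = a * ?i f \<theta> - b * ?i g \<theta>"
      using i[OF assms(1), of \<theta>] i[OF assms(2), of \<theta>]
      by (subst integral_diff) (simp_all add: integrable_on_mult_right)
    finally show ?thesis .
  qed
  then have "pint (\<lambda>x. a * f x - b * g x) = integral {0..2*pi} (\<lambda>\<theta>. a * ?i f \<theta> - b * ?i g \<theta>)"
    by (simp add: pint_def)
  also have "\<dots> = integral {0..2*pi} (\<lambda>\<theta>. a * ?i f \<theta>) - integral {0..2*pi} (\<lambda>\<theta>. b * ?i g \<theta>)"
    by (rule integral_diff; rule integrable_continuous_interval; rule continuous_on_mult_left; rule continuous_on_inner; fact)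
  also have "\<dots> = a * pint f - b * pint g"
    by (simp only: pint_def integral_mult_right)
  finally show ?thesis .
qed

lemma kernel_continuous:
  assumes "e > 0"
  shows "continuous_on (space_form K \<times> space_form K) (\<lambda>(y, x). 1 / (chord K x y + e)\<^sup>2)"
    "y \<in> space_form K \<Longrightarrow> continuous_on (space_form K) (\<lambda>x. 1 / (chord K x y + e)\<^sup>2)"
proof -
  have nz: "chord K x y + e \<noteq> 0" if "x \<in> space_form K" "y \<in> space_form K" for x y
    using chord_nonneg[OF that] assms by simp
  show "continuous_on (space_form K \<times> space_form K) (\<lambda>(y, x). 1 / (chord K x y + e)\<^sup>2)"
    unfolding split_def using nz by (intro continuous_intros) auto
  show "continuous_on (space_form K) (\<lambda>x. 1 / (chord K x y + e)\<^sup>2)" if "y \<in> space_form K"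
    using nz that by (intro continuous_intros) auto
qed

lemma pint_kernel_continuous:
  assumes "e > 0"
  shows "continuous_on (space_form K) (\<lambda>y. pint (\<lambda>x. 1 / (chord K x y + e)\<^sup>2))"
proof -
  have nz: "chord K (X r \<theta>) y + e \<noteq> 0" if "y \<in> space_form K" for r \<theta> y
    using chord_nonneg[OF X_in that, of r \<theta>] assms by simp
  have c: "continuous_on S (\<lambda>z. 1 / (chord K (X (b z) (c z)) (a z) + e)\<^sup>2)"
    if "continuous_on S a" "continuous_on S b" "continuous_on S c" "\<And>z. z \<in> S \<Longrightarrow> a z \<in> space_form K"
    for S :: "'x::t2_space set" and a b c
    using that nz by (intro continuous_intros) auto
  have 1: "continuous_on (space_form K \<times> cbox 0 (2 * pi)) (\<lambda>(y, \<theta>). integral (cbox 0 1) (\<lambda>u. sn K (u * rho \<theta>) * (1 / (chord K (X (u * rho \<theta>) \<theta>) y + e)\<^sup>2) * rho \<theta>))"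
    unfolding split_def
    by (rule integral_continuous_on_param) (auto simp: split_def nz intro!: continuous_intros c)
  have "continuous_on (space_form K) (\<lambda>y. integral (cbox 0 (2 * pi)) (\<lambda>\<theta>. integral (cbox 0 1) (\<lambda>u. sn K (u * rho \<theta>) * (1 / (chord K (X (u * rho \<theta>) \<theta>) y + e)\<^sup>2) * rho \<theta>)))"
    by (rule integral_continuous_on_param[OF 1])
  then show ?thesis by (simp add: pint_def)
qed

text \<open>This is \<open>graph_isoperimetric\<close> freed from coordinates: qp is the chord of
  the two points, and the constant part of the kernel splits off as K times the squared
  area.\<close>

lemma kernel_isoperimetric:
  assumes e: "0 < e" "- K * e \<le> 2"
  shows "(2 * e + K * e\<^sup>2) * pint (\<lambda>y. pint (\<lambda>x. 1 / (chord K x y + e)\<^sup>2)) - K * (pint (\<lambda>_. 1))\<^sup>2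
    \<le> (integral {0..2 * pi} speed)\<^sup>2"
proof -
  let ?c = "2 * e + K * e\<^sup>2"
  let ?h = "\<lambda>y. pint (\<lambda>x. 1 / (chord K x y + e)\<^sup>2)"
  have inner: "integral {0..2*pi} (\<lambda>\<phi>. integral {0..1} (\<lambda>v. sn K (v * rho \<phi>) * sn K (u * rho \<psi>) *
      (?c / (qp K (v * rho \<phi>) \<phi> (u * rho \<psi>) \<psi> + e)\<^sup>2 - K) * rho \<phi>)) =
    sn K (u * rho \<psi>) * (?c * ?h (X (u * rho \<psi>) \<psi>) - K * pint (\<lambda>_. 1))" for u \<psi>
  proof -
    let ?y = "X (u * rho \<psi>) \<psi>"
    have "integral {0..2*pi} (\<lambda>\<phi>. integral {0..1} (\<lambda>v. sn K (v * rho \<phi>) * sn K (u * rho \<psi>) *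
        (?c / (qp K (v * rho \<phi>) \<phi> (u * rho \<psi>) \<psi> + e)\<^sup>2 - K) * rho \<phi>)) =
      integral {0..2*pi} (\<lambda>\<phi>. integral {0..1} (\<lambda>v. sn K (u * rho \<psi>) * (sn K (v * rho \<phi>) *
        (?c * (1 / (chord K (X (v * rho \<phi>) \<phi>) ?y + e)\<^sup>2) - K * 1) * rho \<phi>)))"
      by (simp add: chord_X mult_ac)
    also have "\<dots> = sn K (u * rho \<psi>) * pint (\<lambda>x. ?c * (1 / (chord K x ?y + e)\<^sup>2) - K * 1)"
      by (simp only: pint_def integral_mult_right)
    also have "pint (\<lambda>x. ?c * (1 / (chord K x ?y + e)\<^sup>2) - K * 1) = ?c * ?h ?y - K * pint (\<lambda>_. 1)"
      by (rule pint_linear[OF kernel_continuous(2)[OF e(1) X_in] continuous_on_const])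
    finally show ?thesis .
  qed
  have "(integral {0..2 * pi} speed)\<^sup>2 \<ge> integral {0..2*pi} (\<lambda>\<psi>. integral {0..1} (\<lambda>u.
      sn K (u * rho \<psi>) * (?c * ?h (X (u * rho \<psi>) \<psi>) - K * pint (\<lambda>_. 1)) * rho \<psi>))"
    using graph_isoperimetric[OF DERIV_rho continuous_rho' _ sn_rho_pos e] rho_periodic[of 0]
    unfolding inner by (simp add: speed_def[abs_def])
  also have "integral {0..2*pi} (\<lambda>\<psi>. integral {0..1} (\<lambda>u.
      sn K (u * rho \<psi>) * (?c * ?h (X (u * rho \<psi>) \<psi>) - K * pint (\<lambda>_. 1)) * rho \<psi>)) =
    pint (\<lambda>y. ?c * ?h y - (K * pint (\<lambda>_. 1)) * 1)" by (simp add: pint_def)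
  also have "\<dots> = ?c * pint ?h - (K * pint (\<lambda>_. 1)) * pint (\<lambda>_. 1)"
    by (rule pint_linear[OF pint_kernel_continuous[OF e(1)] continuous_on_const])
  finally show ?thesis by (simp add: power2_eq_square)
qed

lemma D_measurable [measurable]: "D \<in> sets borel"
  by (rule borel_closed[OF compact_imp_closed[OF compact_D]])

text \<open>Passing from iterated integrals to a measure makes Fatou's lemma and the change of
  centre available.\<close>

lemma nn_integral_D:
  assumes g: "continuous_on (space_form K) g" "\<And>x. x \<in> space_form K \<Longrightarrow> 0 \<le> g x"
  shows "(\<integral>\<^sup>+x. ennreal (indicator D x *\<^sub>R g x) \<partial>polar_measure) = ennreal (pint g)"
proof -
  let ?F = "\<lambda>r \<theta>. sn K r * g (X r \<theta>)"
  let ?G = "\<lambda>\<theta>. integral {0..1} (\<lambda>u. sn K (u * rho \<theta>) * g (X (u * rho \<theta>) \<theta>) * rho \<theta>)"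
  have [measurable]: "(\<lambda>x. ennreal (indicator D x *\<^sub>R g x)) \<in> borel_measurable borel"
    using borel_measurable_continuous_on_indicator[OF D_measurable continuous_on_subset[OF g(1) D_subset]] by measurable
  have F0: "0 \<le> ?F r \<theta>" if "0 \<le> r" "r \<le> rho \<theta>" for r \<theta>
    using g(2) that by (rule integrand_nonneg)
  \<comment> \<open>At r = 0 the indicators on the two sides differ, but \<open>sn\<close> vanishes
    there.\<close>
  have ptw: "indicator (polar_domain K) (r, \<theta>) * ennreal (sn K r) * ennreal (indicator D (X r \<theta>) *\<^sub>R g (X r \<theta>)) =
    indicator {0..<2*pi} \<theta> * (ennreal (?F r \<theta>) * indicator {0..rho \<theta>} r)" for r \<theta>
  proof (cases "0 < r \<and> r \<le> rho \<theta> \<and> 0 \<le> \<theta> \<and> \<theta> < 2 * pi")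
    case True
    then have rK: "K > 0 \<Longrightarrow> r < pi / sqrt K" using rho_less[of \<theta>] by force
    have "(r, \<theta>) \<in> polar_domain K" using True rK by (auto simp: polar_domain_def)
    moreover have "X r \<theta> \<in> D" using True X_in_iff[OF _ less_imp_le[OF rK]] by simp
    ultimately have "(r, \<theta>) \<in> polar_domain K" "X r \<theta> \<in> D" by blast+
    then show ?thesis
      using True ennreal_mult[OF less_imp_le[OF sn_pos_polar_domain] g(2)[OF X_in], of r \<theta> K r \<theta>] by simp
  next
    case False
    have "(r, \<theta>) \<notin> polar_domain K \<or> X r \<theta> \<notin> D"
    proof (rule disjCI)
      assume XD: "\<not> X r \<theta> \<notin> D"
      show "(r, \<theta>) \<notin> polar_domain K"
      proof
        assume P: "(r, \<theta>) \<in> polar_domain K"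
        then have r: "0 < r" "K > 0 \<Longrightarrow> r < pi / sqrt K" by (auto simp: polar_domain_def)
        then have "r \<le> rho \<theta>" using XD X_in_iff[OF less_imp_le less_imp_le, of r \<theta>] by blast
        then show False using False P by (auto simp: polar_domain_def)
      qed
    qed
    then show ?thesis using False by (cases "r = 0") (auto simp: indicator_def)
  qed
  have inner: "(\<integral>\<^sup>+r. ennreal (?F r \<theta>) * indicator {0..rho \<theta>} r \<partial>lborel) = ennreal (?G \<theta>)" for \<theta>
  proof (rule nn_integral_has_integral_lebesgue')
    have cF: "continuous_on {0..rho \<theta>} (\<lambda>r. ?F r \<theta>)"
      by (intro continuous_intros continuous_on_X_compose[OF g(1)])
    have "((\<lambda>u. rho \<theta> *\<^sub>R ?F (u * rho \<theta>) \<theta>) has_integral integral {0 * rho \<theta>..1 * rho \<theta>} (\<lambda>r. ?F r \<theta>)) {0..1}"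
      by (rule has_integral_substitution[where c = 0 and d = "rho \<theta>"])
        (use rho_pos[of \<theta>] cF in \<open>auto intro!: derivative_eq_intros mult_le_cancel_right1[THEN iffD2]\<close>)
    from integral_unique[OF this] have "?G \<theta> = integral {0..rho \<theta>} (\<lambda>r. ?F r \<theta>)"
      by (simp add: mult_ac)
    then show "((\<lambda>r. ?F r \<theta>) has_integral ?G \<theta>) {0..rho \<theta>}"
      using integrable_continuous_interval[OF cF] by (simp add: has_integral_integrable_integral)
  qed (use F0 in auto)
  have G0: "0 \<le> ?G \<theta>" for \<theta> by (rule inner_nonneg[OF g])
  have "(\<integral>\<^sup>+x. ennreal (indicator D x *\<^sub>R g x) \<partial>polar_measure) =
    (\<integral>\<^sup>+(r, \<theta>). indicator (polar_domain K) (r, \<theta>) * ennreal (sn K r) * ennreal (indicator D (X r \<theta>) *\<^sub>R g (X r \<theta>)) \<partial>lborel)"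
    by (rule nn_integral_polar_measure) measurable
  also have "\<dots> = (\<integral>\<^sup>+\<theta>. \<integral>\<^sup>+r. indicator (polar_domain K) (r, \<theta>) * ennreal (sn K r) * ennreal (indicator D (X r \<theta>) *\<^sub>R g (X r \<theta>)) \<partial>lborel \<partial>lborel)"
  proof -
    have "(\<lambda>(r, \<theta>). indicator (polar_domain K) (r, \<theta>) * ennreal (sn K r) * ennreal (indicator D (X r \<theta>) *\<^sub>R g (X r \<theta>)))
      \<in> borel_measurable (borel :: (real \<times> real) measure)"
      unfolding split_def prod.collapse by measurable
    then have "(\<lambda>(r, \<theta>). indicator (polar_domain K) (r, \<theta>) * ennreal (sn K r) * ennreal (indicator D (X r \<theta>) *\<^sub>R g (X r \<theta>)))
      \<in> borel_measurable (lborel \<Otimes>\<^sub>M lborel)"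
      by (simp add: lborel_prod)
    from lborel_pair.nn_integral_snd[OF this] show ?thesis by (simp add: lborel_prod)
  qed
  also have "\<dots> = (\<integral>\<^sup>+\<theta>. indicator {0..<2*pi} \<theta> * ennreal (?G \<theta>) \<partial>lborel)"
    unfolding ptw inner[symmetric]
  proof (rule nn_integral_cong, rule nn_integral_cmult)
    fix \<theta>
    have [measurable]: "(\<lambda>r. ?F r \<theta>) \<in> borel_measurable borel"
      by (intro borel_measurable_continuous_onI continuous_intros continuous_on_X_compose[OF g(1)])
    show "(\<lambda>r. ennreal (?F r \<theta>) * indicator {0..rho \<theta>} r) \<in> borel_measurable lborel" by measurable
  qed
  also have "\<dots> = (\<integral>\<^sup>+\<theta>. ennreal (?G \<theta>) * indicator {0..2*pi} \<theta> \<partial>lborel)"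
    using AE_lborel_singleton[of "2 * pi"]
    by (intro nn_integral_cong_AE) (auto simp: indicator_def elim!: eventually_mono)
  also have "\<dots> = ennreal (pint g)"
    unfolding pint_def
    by (rule nn_integral_has_integral_lebesgue'[OF G0 integrable_integral
          [OF integrable_continuous_interval[OF continuous_on_inner[OF g(1)]]]])
  finally show ?thesis .
qed

lemma emeasure_D: "emeasure polar_measure D = ennreal (pint (\<lambda>_. 1))"
proof -
  have "emeasure polar_measure D = (\<integral>\<^sup>+x. ennreal (indicator D x *\<^sub>R 1) \<partial>polar_measure)"
    by (simp add: ennreal_indicator)
  also have "\<dots> = ennreal (pint (\<lambda>_. 1))" by (rule nn_integral_D) auto
  finally show ?thesis .
qed

lemma boundary_measurable [measurable]: "boundary K D \<in> sets borel" "rel_interior_of K D \<in> sets borel"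
proof -
  have "openin (top_of_set (space_form K)) (rel_interior_of K D)" by simp
  then obtain T where T: "open T" "rel_interior_of K D = space_form K \<inter> T"
    unfolding openin_open by blast
  then show i: "rel_interior_of K D \<in> sets borel" using closed_space_form[of K] by auto
  show "boundary K D \<in> sets borel" unfolding boundary_diff using i D_measurable by simp
qed

text \<open>Each ray from p meets the boundary only at radius \<open>rho\<close>, so the set is null
  by Fubini.\<close>

lemma emeasure_boundary: "emeasure polar_measure (boundary K D) = 0"
proof -
  let ?f = "\<lambda>(r, \<theta>). indicator (polar_domain K) (r, \<theta>) * ennreal (sn K r) * indicator (boundary K D) (X r \<theta>)"
  have "?f \<in> borel_measurable (borel :: (real \<times> real) measure)"
    unfolding split_def prod.collapse using boundary_measurable by measurable
  then have "?f \<in> borel_measurable (lborel \<Otimes>\<^sub>M lborel)" by (simp add: lborel_prod)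
  from lborel_pair.nn_integral_snd[OF this]
  have "emeasure polar_measure (boundary K D) = (\<integral>\<^sup>+\<theta>. \<integral>\<^sup>+r. ?f (r, \<theta>) \<partial>lborel \<partial>lborel)"
    by (simp add: emeasure_polar_measure lborel_prod split_def)
  also have "\<dots> = (\<integral>\<^sup>+\<theta>. 0 \<partial>(lborel :: real measure))"
  proof (intro nn_integral_cong)
    fix \<theta> :: real
    have "?f (r, \<theta>) = 0" if "r \<noteq> rho \<theta>" for r
    proof (cases "(r, \<theta>) \<in> polar_domain K")
      case True
      then have r: "0 < r" "K > 0 \<Longrightarrow> r < pi / sqrt K" by (auto simp: polar_domain_def)
      have "X r \<theta> \<notin> boundary K D"
      proof
        assume "X r \<theta> \<in> boundary K D"
        then obtain \<phi> where \<phi>: "X r \<theta> = X (rho \<phi>) \<phi>" unfolding boundary_eq by blast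
        have "r = rho \<phi>" "cis \<theta> = cis \<phi>"
          using X_inj[OF \<phi>] r rho_pos[of \<phi>] rho_less[of \<phi>] by force+
        then show False using rho_cis that by metis
      qed
      then show ?thesis by simp
    qed simp
    then have "AE r in lborel. ?f (r, \<theta>) = 0"
      using AE_lborel_singleton[of "rho \<theta>"] by (rule eventually_mono[rotated])
    then have "(\<integral>\<^sup>+r. ?f (r, \<theta>) \<partial>lborel) = (\<integral>\<^sup>+r. 0 \<partial>(lborel :: real measure))" by (rule nn_integral_cong_AE)
    then show "(\<integral>\<^sup>+r. ?f (r, \<theta>) \<partial>lborel) = 0" by simp
  qed
  finally show ?thesis by simp
qed

lemma emeasure_interior: "emeasure polar_measure (rel_interior_of K D) = emeasure polar_measure D"
proof -
  have "D = rel_interior_of K D \<union> boundary K D"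
    using boundary_diff in_rel_interior by blast
  then show ?thesis
    using emeasure_Un_null_set[of "rel_interior_of K D" polar_measure "boundary K D"] emeasure_boundary boundary_measurable
    by (metis null_setsI sets_polar_measure)
qed

end

text \<open>In polar coordinates at \<open>x\<close> the kernel has the primitive \<open>- 1 / (vers r + e)\<close>.\<close>

lemma (in frame) kernel_ball_lower_bound:
  assumes d: "0 < d" "K > 0 \<Longrightarrow> d < pi / sqrt K" and e: "0 < e"
    and S: "S \<in> sets borel" "\<And>r \<theta>. 0 < r \<Longrightarrow> r \<le> d \<Longrightarrow> X r \<theta> \<in> S"
    and g: "g \<in> borel_measurable borel" "\<And>y. y \<in> S \<Longrightarrow> ennreal (1 / (chord K p y + e)\<^sup>2) \<le> g y"
  shows "ennreal (2 * pi * (1 / e - 1 / (vers K d + e))) \<le> (\<integral>\<^sup>+y. g y \<partial>polar_measure)"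
proof -
  let ?k = "\<lambda>r. sn K r / (vers K r + e)\<^sup>2"
  have ve: "vers K r + e > 0" for r using vers_nonneg[of K r] e by simp
  have ve': "vers K r + e \<noteq> 0" for r using ve[of r] by simp
  have k0: "0 \<le> ?k r" if "r \<in> {0..d}" for r
    using that d by (intro divide_nonneg_nonneg sn_nonneg) auto
  have "(?k has_integral (- 1 / (vers K d + e)) - (- 1 / (vers K 0 + e))) {0..d}"
  proof (rule fundamental_theorem_of_calculus)
    fix r
    show "((\<lambda>r. - 1 / (vers K r + e)) has_vector_derivative ?k r) (at r within {0..d})"
      unfolding has_real_derivative_iff_has_vector_derivative[symmetric]
      using ve'[of r] by (auto intro!: derivative_eq_intros simp: power2_eq_square)
  qed (use d in simp)
  then have ki: "(?k has_integral (1 / e - 1 / (vers K d + e))) {0..d}" by simp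
  have I0: "0 \<le> 1 / e - 1 / (vers K d + e)"
    using has_integral_nonneg[OF ki] k0 by blast
  have k: "(\<integral>\<^sup>+r. ennreal (?k r) * indicator {0..d} r \<partial>lborel) = ennreal (1 / e - 1 / (vers K d + e))"
    by (rule nn_integral_has_integral_lebesgue'[OF k0 ki])
  let ?f = "\<lambda>(r, \<theta>). indicator {0..d} r * ennreal (?k r) * indicator {0..<2*pi} \<theta>"
  have mk [measurable]: "(\<lambda>r. ?k r) \<in> borel_measurable borel"
    using ve' by (intro borel_measurable_continuous_onI continuous_intros) auto
  have le: "?f (r, \<theta>) \<le> indicator (polar_domain K) (r, \<theta>) * ennreal (sn K r) * g (X r \<theta>)" for r \<theta>
  proof (cases "0 < r \<and> r \<le> d \<and> 0 \<le> \<theta> \<and> \<theta> < 2 * pi")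
    case True
    then have P: "(r, \<theta>) \<in> polar_domain K" using d by (force simp: polar_domain_def)
    have "ennreal (?k r) = ennreal (sn K r) * ennreal (1 / (chord K p (X r \<theta>) + e)\<^sup>2)"
      using sn_pos_polar_domain[OF P] by (simp add: chord_p_X flip: ennreal_mult)
    also have "\<dots> \<le> ennreal (sn K r) * g (X r \<theta>)"
      using True S g by (intro mult_left_mono) auto
    finally show ?thesis using True P by simp
  next
    case False
    then show ?thesis by (cases "r = 0") (auto simp: indicator_def)
  qed
  have "ennreal (2 * pi * (1 / e - 1 / (vers K d + e))) = ennreal (1 / e - 1 / (vers K d + e)) * ennreal (2 * pi)"
    using I0 by (simp add: ennreal_mult[symmetric] mult.commute)
  also have "\<dots> = (\<integral>\<^sup>+\<theta>. ennreal (1 / e - 1 / (vers K d + e)) * indicator {0..<2*pi} \<theta> \<partial>lborel)"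
    by (subst nn_integral_cmult_indicator) simp_all
  also have "\<dots> = (\<integral>\<^sup>+\<theta>. \<integral>\<^sup>+r. ?f (r, \<theta>) \<partial>lborel \<partial>lborel)"
    unfolding k[symmetric] by (intro nn_integral_cong) (auto simp: indicator_def mult.commute)
  also have "\<dots> = (\<integral>\<^sup>+x. ?f x \<partial>lborel)"
  proof -
    have "?f \<in> borel_measurable (lborel \<Otimes>\<^sub>M lborel)" by measurable
    from lborel_pair.nn_integral_snd[OF this] show ?thesis by (simp add: lborel_prod)
  qed
  also have "\<dots> \<le> (\<integral>\<^sup>+(r, \<theta>). indicator (polar_domain K) (r, \<theta>) * ennreal (sn K r) * g (X r \<theta>) \<partial>lborel)"
    by (intro nn_integral_mono) (use le in force)
  also have "\<dots> = (\<integral>\<^sup>+y. g y \<partial>polar_measure)"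
    by (rule nn_integral_polar_measure[OF g(1), symmetric])
  finally show ?thesis .
qed

text \<open>The distance of X r \<theta> to p has a bound \<open>?b r\<close> independent of
  \<theta> that tends to 0.\<close>

lemma (in frame) interior_contains_ball:
  assumes "p \<in> rel_interior_of K D"
  obtains d where "0 < d" "K > 0 \<Longrightarrow> d < pi / sqrt K" "\<And>r \<theta>. 0 < r \<Longrightarrow> r \<le> d \<Longrightarrow> X r \<theta> \<in> D"
proof -
  obtain T where T: "open T" "p \<in> T" "T \<inter> space_form K \<subseteq> D"
    using assms unfolding interior_of_iff by blast
  obtain \<eta> where \<eta>: "\<eta> > 0" "ball p \<eta> \<subseteq> T" using T open_contains_ball by blast
  let ?b = "\<lambda>r. \<bar>cs K r - 1\<bar> * norm p + \<bar>sn K r\<bar> * (norm e1 + norm e2)"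
  have "norm (X r \<theta> - p) \<le> ?b r" for r \<theta>
  proof -
    have "X r \<theta> - p = (cs K r - 1) *\<^sub>R p + sn K r *\<^sub>R dir \<theta>" by (simp add: X_eq algebra_simps)
    then have "norm (X r \<theta> - p) \<le> \<bar>cs K r - 1\<bar> * norm p + \<bar>sn K r\<bar> * norm (dir \<theta>)"
      by (metis norm_scaleR norm_triangle_ineq)
    also have "norm (dir \<theta>) \<le> \<bar>cos \<theta>\<bar> * norm e1 + \<bar>sin \<theta>\<bar> * norm e2"
      unfolding dir_def by (metis norm_scaleR norm_triangle_ineq)
    also have "\<dots> \<le> 1 * norm e1 + 1 * norm e2"
      by (intro add_mono mult_right_mono) auto
    finally show ?thesis by (simp add: mult_left_mono)
  qed
  moreover have "((\<lambda>r. ?b r) \<longlongrightarrow> \<bar>cs K 0 - 1\<bar> * norm p + \<bar>sn K 0\<bar> * (norm e1 + norm e2)) (at_right 0)"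
    by (intro tendsto_intros isCont_tendsto_compose[OF DERIV_isCont[OF DERIV_cs]] isCont_tendsto_compose[OF DERIV_isCont[OF DERIV_sn]])
  then have "\<forall>\<^sub>F r in at_right 0. ?b r < \<eta>" using \<eta>(1) by (intro order_tendstoD(2)) auto
  then obtain b where b: "b > 0" "\<And>r. 0 < r \<Longrightarrow> r < b \<Longrightarrow> ?b r < \<eta>"
    by (auto simp: eventually_at_right_field)
  define d where "d = (if K > 0 then min (b / 2) (pi / sqrt K / 2) else b / 2)"
  show thesis
  proof (rule that[of d])
    show "0 < d" using b by (simp add: d_def)
    show "d < pi / sqrt K" if "K > 0"
    proof -
      have "w / 2 < w" if "0 < w" for w :: real using that by simp
      from this[of "pi / sqrt K"] have "pi / sqrt K / 2 < pi / sqrt K" using that by simp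
      then show ?thesis using that by (simp add: d_def min_less_iff_disj)
    qed
    fix r \<theta> :: real assume r: "0 < r" "r \<le> d"
    have "norm (X r \<theta> - p) < \<eta>"
      using calculation[of r \<theta>] b(2)[of r] r b(1) by (auto simp: d_def split: if_splits)
    then have "X r \<theta> \<in> T" using \<eta>(2) by (auto simp: dist_norm norm_minus_commute)
    then show "X r \<theta> \<in> D" using T X_in by blast
  qed
qed

section \<open>Passage to the limit\<close>

context smooth_star_domain
begin

theorem isoperimetric_pint:
  "4 * pi * pint (\<lambda>_. 1) - K * (pint (\<lambda>_. 1))\<^sup>2 \<le> (integral {0..2 * pi} speed)\<^sup>2"
proof -
  let ?A = "pint (\<lambda>_. 1)"
  let ?B = "(integral {0..2 * pi} speed)\<^sup>2 + K * ?A\<^sup>2"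
  \<comment> \<open>The factor 1 / (1 + |K|) gives |K| e \<le> 1 for every n, hence both
    \<open>- K * e \<le> 2\<close> and \<open>c \<ge> 0\<close>.\<close>
  define e where "e = (\<lambda>n. 1 / (1 + \<bar>K\<bar>) / real (Suc n))"
  define c where "c = (\<lambda>n. 2 * e n + K * (e n)\<^sup>2)"
  define h where "h = (\<lambda>n y. pint (\<lambda>x. 1 / (chord K x y + e n)\<^sup>2))"
  define f where "f = (\<lambda>n y. ennreal (indicator D y *\<^sub>R (c n * h n y)))"
  have e0: "e n > 0" for n by (simp add: e_def)
  have e_lim: "e \<longlonglongrightarrow> 0"
    unfolding e_def using tendsto_mult[OF tendsto_const[of "1 / (1 + \<bar>K\<bar>)"] LIMSEQ_inverse_real_of_nat]
    by (simp add: field_simps)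
  have "\<bar>K\<bar> * e n \<le> 1" for n
  proof -
    have "1 / (1 + \<bar>K\<bar>) / real (Suc n) \<le> 1 / (1 + \<bar>K\<bar>) / 1" by (intro divide_left_mono) auto
    then have "e n \<le> 1 / (1 + \<bar>K\<bar>)" by (simp add: e_def)
    then have "\<bar>K\<bar> * e n \<le> \<bar>K\<bar> * (1 / (1 + \<bar>K\<bar>))" by (intro mult_left_mono) auto
    also have "\<dots> \<le> 1" by (simp add: field_simps)
    finally show ?thesis .
  qed
  then have Ke: "- 1 \<le> K * e n" "- K * e n \<le> 2" for n
    using e0[of n] abs_mult[of K "e n"] by (auto simp: abs_le_iff) (smt (verit))+
  have c0: "0 \<le> c n" for n
  proof -
    have "c n = e n * (2 + K * e n)" by (simp add: c_def power2_eq_square algebra_simps)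
    then show ?thesis using e0[of n] Ke(1)[of n] by simp
  qed
  have ch: "continuous_on (space_form K) (h n)" for n unfolding h_def by (rule pint_kernel_continuous[OF e0])
  have nn_kernel: "(\<integral>\<^sup>+x. ennreal (indicator D x *\<^sub>R (1 / (chord K x y + e n)\<^sup>2)) \<partial>polar_measure) = ennreal (h n y)"
    if "y \<in> space_form K" for y n
    unfolding h_def by (rule nn_integral_D[OF kernel_continuous(2)[OF e0 that]]) simp
  have h0: "0 \<le> h n y" if "y \<in> space_form K" for n y
    unfolding h_def by (rule pint_nonneg[OF kernel_continuous(2)[OF e0 that]]) simp
  have fm [measurable]: "f n \<in> borel_measurable borel" for n
  proof -
    have "continuous_on D (\<lambda>y. c n * h n y)"
      by (intro continuous_intros continuous_on_subset[OF ch D_subset])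
    then show ?thesis
      unfolding f_def using borel_measurable_continuous_on_indicator[OF D_measurable] by measurable
  qed
  have int_f: "(\<integral>\<^sup>+y. f n y \<partial>polar_measure) \<le> ennreal ?B" for n
  proof -
    have "(\<integral>\<^sup>+y. f n y \<partial>polar_measure) = ennreal (pint (\<lambda>y. c n * h n y))"
      unfolding f_def by (rule nn_integral_D) (auto intro!: continuous_intros ch mult_nonneg_nonneg c0 h0)
    also have "pint (\<lambda>y. c n * h n y) = c n * pint (h n)"
      using pint_linear[OF ch[of n] continuous_on_const[of _ 0], of "c n" 0] by simp
    also have "\<dots> \<le> ?B"
      using kernel_isoperimetric[OF e0 Ke(2), of n] by (simp add: c_def h_def[abs_def])
    finally show ?thesis by (simp add: ennreal_leI)
  qed
  \<comment> \<open>A disc about x inside D contributes at least 2 pi (1 / e - 1 / (vers d + e)),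
    and c / e tends to 2.\<close>
  have lower: "ennreal (4 * pi) * indicator (rel_interior_of K D) x \<le> liminf (\<lambda>n. f n x)" for x
  proof (cases "x \<in> rel_interior_of K D")
    case True
    then have xD: "x \<in> D" "x \<in> space_form K" using in_rel_interior D_subset by blast+
    obtain a1 a2 where fr: "frame K x a1 a2" using exists_frame[OF xD(2)] .
    interpret F: frame K x a1 a2 by (rule fr)
    obtain d where d: "0 < d" "K > 0 \<Longrightarrow> d < pi / sqrt K" "\<And>r \<theta>. 0 < r \<Longrightarrow> r \<le> d \<Longrightarrow> F.X r \<theta> \<in> D"
      using F.interior_contains_ball[OF True] by metis
    have v0: "vers K d > 0" using vers_strict_mono[of 0 d K] d(1) less_imp_le[OF d(2)] by simp
    let ?l = "\<lambda>n. c n * (2 * pi * (1 / e n - 1 / (vers K d + e n)))"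
    have "ennreal (?l n) \<le> f n x" for n
    proof -
      have "ennreal (2 * pi * (1 / e n - 1 / (vers K d + e n))) \<le>
          (\<integral>\<^sup>+y. ennreal (indicator D y *\<^sub>R (1 / (chord K y x + e n)\<^sup>2)) \<partial>F.polar_measure)"
      proof (rule F.kernel_ball_lower_bound[OF d(1,2) e0 D_measurable d(3)])
        show "(\<lambda>y. ennreal (indicator D y *\<^sub>R (1 / (chord K y x + e n)\<^sup>2))) \<in> borel_measurable borel"
          using borel_measurable_continuous_on_indicator[OF D_measurable
            continuous_on_subset[OF kernel_continuous(2)[OF e0 xD(2)] D_subset]] by measurable
        have "chord K x y = chord K y x" for y
          using ambient_form_simps(5)[of K "-1" "x - y" "x - y"] ambient_form_simps(6)[of K "y - x" "-1" "x - y"]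
          by (simp add: chord_def)
        then show "ennreal (1 / (chord K x y + e n)\<^sup>2) \<le> ennreal (indicator D y *\<^sub>R (1 / (chord K y x + e n)\<^sup>2))"
          if "y \<in> D" for y using that by simp
      qed
      \<comment> \<open>The disc estimate is made in coordinates centred at x, while
        \<open>h\<close> is an integral in coordinates centred at p; independence of the frame joins
        them.\<close>
      also have "F.polar_measure = polar_measure" by (rule polar_measure_eq[OF fr frame_axioms])
      finally have "2 * pi * (1 / e n - 1 / (vers K d + e n)) \<le> h n x"
        unfolding nn_kernel[OF xD(2)] using h0[OF xD(2)] by (simp add: ennreal_le_iff)
      then show ?thesis
        using xD c0 by (auto simp: f_def intro!: ennreal_leI mult_left_mono)
    qed
    then have "liminf (\<lambda>n. ennreal (?l n)) \<le> liminf (\<lambda>n. f n x)"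
      by (intro Liminf_mono) simp
    moreover have "?l \<longlonglongrightarrow> (2 + K * 0) * (2 * pi * (1 - 0 / (vers K d + 0)))"
    proof -
      have l: "?l n = (2 + K * e n) * (2 * pi * (1 - e n / (vers K d + e n)))" for n
      proof -
        have "1 / e n - 1 / (vers K d + e n) = (1 - e n / (vers K d + e n)) / e n"
          using e0[of n] by (simp add: diff_divide_distrib)
        moreover have "c n = e n * (2 + K * e n)" by (simp add: c_def power2_eq_square algebra_simps)
        ultimately show ?thesis using e0[of n] by simp
      qed
      moreover have "(\<lambda>n. (2 + K * e n) * (2 * pi * (1 - e n / (vers K d + e n)))) \<longlonglongrightarrow> (2 + K * 0) * (2 * pi * (1 - 0 / (vers K d + 0)))"
        using v0 by (intro tendsto_intros e_lim) auto
      ultimately show ?thesis unfolding l by simp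
    qed
    then have "(\<lambda>n. ennreal (?l n)) \<longlonglongrightarrow> ennreal (4 * pi)" by (intro tendsto_ennrealI) simp
    then have "liminf (\<lambda>n. ennreal (?l n)) = ennreal (4 * pi)" by (intro lim_imp_Liminf) auto
    ultimately show ?thesis using True by simp
  qed simp
  have "ennreal (4 * pi * ?A) = ennreal (4 * pi) * emeasure polar_measure (rel_interior_of K D)"
    unfolding emeasure_interior emeasure_D by (simp add: ennreal_mult')
  also have "\<dots> = (\<integral>\<^sup>+x. ennreal (4 * pi) * indicator (rel_interior_of K D) x \<partial>polar_measure)"
    by (simp add: nn_integral_cmult_indicator boundary_measurable)
  also have "\<dots> \<le> (\<integral>\<^sup>+x. liminf (\<lambda>n. f n x) \<partial>polar_measure)"
    by (intro nn_integral_mono lower)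
  \<comment> \<open>Fatou's lemma; the integrals on the right are bounded uniformly in n by the
    regularised inequality.\<close>
  also have "\<dots> \<le> liminf (\<lambda>n. \<integral>\<^sup>+x. f n x \<partial>polar_measure)"
    by (intro nn_integral_liminf) simp
  also have "\<dots> \<le> liminf (\<lambda>n. ennreal ?B)"
    by (intro Liminf_mono) (simp add: int_f)
  also have "\<dots> = ennreal ?B" by (simp add: Liminf_const)
  finally have le: "ennreal (4 * pi * ?A) \<le> ennreal ?B" .
  \<comment> \<open>\<open>ennreal\<close> sends negative reals to 0, so the sign of the right-hand
    side has to be known before returning to the reals.\<close>
  have "0 \<le> ?B"
  proof -
    have "0 \<le> c 0 * pint (h 0)" by (intro mult_nonneg_nonneg c0 pint_nonneg ch h0)
    also have "\<dots> \<le> ?B"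
      using kernel_isoperimetric[OF e0 Ke(2), of 0] by (simp add: c_def h_def[abs_def])
    finally show ?thesis .
  qed
  then have "4 * pi * ?A \<le> ?B" using le by (simp add: ennreal_le_iff)
  then show ?thesis by simp
qed

end

section \<open>Area in the given coordinates, and the full sphere\<close>

lemma area_element_eq:
  assumes "(r, \<theta>) \<in> polar_domain K"
  shows "area_element K r \<theta> = sn K r"
proof -
  interpret frame K "base_point K" "(1, 0)" "(\<i>, 0)" by (rule base_frame)
  have X: "polar K s \<phi> = X s \<phi>" for s \<phi> by (simp add: polar_eq_X)
  have "((\<lambda>s. X s \<theta>) has_vector_derivative 1 *\<^sub>R Xr r \<theta> + (0 * sn K r) *\<^sub>R ndir \<theta>) (at r)"
    by (rule has_vector_derivative_X) (auto intro!: derivative_eq_intros)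
  then have 1: "vector_derivative (\<lambda>s. polar K s \<theta>) (at r) = Xr r \<theta>"
    unfolding X by (simp add: vector_derivative_at)
  have "((\<lambda>\<phi>. X r \<phi>) has_vector_derivative 0 *\<^sub>R Xr r \<theta> + (1 * sn K r) *\<^sub>R ndir \<theta>) (at \<theta>)"
    by (rule has_vector_derivative_X) (auto intro!: derivative_eq_intros)
  then have 2: "vector_derivative (\<lambda>\<phi>. polar K r \<phi>) (at \<theta>) = sn K r *\<^sub>R ndir \<theta>"
    unfolding X by (simp add: vector_derivative_at)
  show ?thesis
    using sn_pos_polar_domain[OF assms]
    by (simp add: area_element_def Let_def 1 2 ambient_form_simps Xr_form frame_form real_sqrt_mult_self)
qed

text \<open>\<open>area\<close> is tied to the base point; \<open>polar_measure_eq\<close> moves it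
  to any centre. An infinite measure gives 0 on both sides, by \<open>enn2real\<close> and by the
  Bochner integral alike.\<close>

lemma area_eq:
  assumes S [measurable]: "S \<in> sets borel" and fr: "frame K p e1 e2"
  shows "area K S = enn2real (emeasure (frame.polar_measure K p e1 e2) S)"
proof -
  interpret frame K "base_point K" "(1, 0)" "(\<i>, 0)" by (rule base_frame)
  have X: "polar K s \<phi> = X s \<phi>" for s \<phi> by (simp add: polar_eq_X)
  let ?A = "{(r, \<theta>) \<in> polar_domain K. polar K r \<theta> \<in> S}"
  let ?f = "\<lambda>x. indicator (polar_domain K) x * (sn K (fst x) * indicator S (X (fst x) (snd x)))"
  have "area K S = (\<integral>x. ?f x \<partial>lborel)"
    unfolding area_def set_lebesgue_integral_def
    by (intro Bochner_Integration.integral_cong) (auto simp: indicator_def area_element_eq X)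
  also have "\<dots> = enn2real (\<integral>\<^sup>+x. ennreal (?f x) \<partial>lborel)"
  proof (rule integral_eq_nn_integral)
    show "?f \<in> borel_measurable lborel" by measurable
    have "0 \<le> ?f x" for x
      using sn_pos_polar_domain[of "fst x" "snd x" K] by (auto simp: indicator_def)
    then show "AE x in lborel. 0 \<le> ?f x" by simp
  qed
  also have "(\<integral>\<^sup>+x. ennreal (?f x) \<partial>lborel) = emeasure polar_measure S"
    unfolding emeasure_polar_measure[OF S] split_def prod.collapse
    using sn_pos_polar_domain[of _ _ K]
    by (intro nn_integral_cong) (auto simp: indicator_def)
  also have "polar_measure = frame.polar_measure K p e1 e2"
    by (rule polar_measure_eq[OF frame_axioms fr])
  finally show ?thesis .
qed

lemma area_sphere:
  assumes K: "K > 0"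
  shows "area K (space_form K) = 4 * pi / K"
proof -
  interpret frame K "base_point K" "(1, 0)" "(\<i>, 0)" by (rule base_frame)
  have [measurable]: "space_form K \<in> sets borel" using closed_space_form[of K] by auto
  let ?f = "\<lambda>(r, \<theta>). indicator {0..pi / sqrt K} r * ennreal (sn K r) * indicator {0..<2*pi} \<theta>"
  have 0: "sn K (pi / sqrt K) = 0" "vers K (pi / sqrt K) = 2 / K"
    using K by (simp_all add: sn_def vers_def cs_def)
  have "(sn K has_integral vers K (pi / sqrt K) - vers K 0) {0..pi / sqrt K}"
    by (rule fundamental_theorem_of_calculus)
      (use K in \<open>auto simp flip: has_real_derivative_iff_has_vector_derivative intro: DERIV_subset[OF DERIV_vers]\<close>)
  then have k: "(\<integral>\<^sup>+r. ennreal (sn K r) * indicator {0..pi / sqrt K} r \<partial>lborel) = ennreal (2 / K)"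
    by (intro nn_integral_has_integral_lebesgue') (auto simp: 0 intro!: sn_nonneg)
  have mk [measurable]: "sn K \<in> borel_measurable borel"
    by (intro borel_measurable_continuous_onI continuous_intros)
  \<comment> \<open>The closed interval of radii adds only the poles, where \<open>sn\<close> is
    0.\<close>
  have eq: "indicator (polar_domain K) (r, \<theta>) * ennreal (sn K r) * indicator (space_form K) (X r \<theta>) = ?f (r, \<theta>)" for r \<theta>
    using X_in[of r \<theta>] K 0(1) by (cases "r = 0 \<or> r = pi / sqrt K") (auto simp: indicator_def polar_domain_def)
  have "emeasure polar_measure (space_form K) = (\<integral>\<^sup>+x. ?f x \<partial>lborel)"
    unfolding emeasure_polar_measure[OF \<open>space_form K \<in> sets borel\<close>] using eq by (simp add: split_def)
  also have "\<dots> = (\<integral>\<^sup>+\<theta>. \<integral>\<^sup>+r. ?f (r, \<theta>) \<partial>lborel \<partial>lborel)"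
  proof -
    have "?f \<in> borel_measurable (lborel \<Otimes>\<^sub>M lborel)" by measurable
    from lborel_pair.nn_integral_snd[OF this] show ?thesis by (simp add: lborel_prod)
  qed
  also have "\<dots> = (\<integral>\<^sup>+\<theta>. ennreal (2 / K) * indicator {0..<2*pi} \<theta> \<partial>lborel)"
    unfolding k[symmetric] by (intro nn_integral_cong) (auto simp: indicator_def mult.commute)
  also have "\<dots> = ennreal (2 / K) * ennreal (2 * pi)"
    by (subst nn_integral_cmult_indicator) simp_all
  also have "\<dots> = ennreal (4 * pi / K)" using K by (simp flip: ennreal_mult)
  finally show ?thesis
    using area_eq[OF \<open>space_form K \<in> sets borel\<close> frame_axioms] K by simp
qed

lemma length_of_empty: "length_of K {} = 0"
proof -
  have "parametrizes \<Gamma> {} \<longleftrightarrow> \<Gamma> = {}" for \<Gamma>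
    unfolding parametrizes_def by auto
  then show ?thesis by (simp add: length_of_def)
qed

theorem mainTheorem7:
  fixes K :: real and D :: "(complex \<times> real) set"
  assumes "D \<subseteq> space_form K"
    and "compact D"
    and "top_of_set (space_form K) interior_of D \<noteq> {}"
    and "geodesically_convex K D"
    and "C1_submanifold K (boundary K D)"
  shows "(length_of K (boundary K D))\<^sup>2 \<ge> 4 * pi * area K D - K * (area K D)\<^sup>2"
proof (cases "K > 0 \<and> D = space_form K")
  \<comment> \<open>The full sphere has empty boundary and area 4 pi / K, so the inequality is the
    equality 0 = 0.\<close>
  case True
  have "boundary K D = {}"
    using True frontier_of_topspace[of "top_of_set (space_form K)"] by (simp add: boundary_def)
  moreover have "area K D = 4 * pi / K" using True area_sphere by simp
  moreover have "4 * pi * (4 * pi / K) - K * (4 * pi / K)\<^sup>2 = 0"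
    using True by (simp add: power2_eq_square)
  ultimately show ?thesis by (simp add: length_of_empty)
next
  case False
  obtain p where p_int: "p \<in> rel_interior_of K D" using assms(3) by blast
  then have pM: "p \<in> space_form K" using in_rel_interior assms(1) by blast
  obtain e1 e2 where fr: "frame K p e1 e2" using exists_frame[OF pM] .
  interpret frame K p e1 e2 by (rule fr)
  \<comment> \<open>Any interior point may serve as centre: if its antipode belonged to D, then D
    would be the whole sphere.\<close>
  interpret star_domain K p e1 e2 D
    using assms p_int antipode_of_interior[OF assms(1,4) _ p_int] False by unfold_locales auto
  obtain \<rho>' where \<rho>': "\<And>\<theta>. (rho has_real_derivative \<rho>' \<theta>) (at \<theta>)" "continuous_on UNIV \<rho>'"
    using rho_C1[OF assms(5)] by metis
  interpret smooth_star_domain K p e1 e2 D \<rho>'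
    using \<rho>' by unfold_locales
  have "area K D = pint (\<lambda>_. 1)"
    using area_eq[OF D_measurable fr] pint_nonneg[of "\<lambda>_. 1"] by (simp add: emeasure_D)
  moreover have "(integral {0..2 * pi} speed)\<^sup>2 \<le> (length_of K (boundary K D))\<^sup>2"
    using speed_nonneg
    by (intro power_mono length_of_ge integral_nonneg integrable_continuous_interval
        continuous_on_rho(3)[of _ "\<lambda>x. x", simplified]) auto
  ultimately show ?thesis using isoperimetric_pint by simp
qed

end
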